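(* Let $\mathrm{Gr}(n,k)$ be the real Grassmannian with the canonical metric. For every $p\in\mathrm{Gr}(n,k)$, every unit vector $v\in T_p\mathrm{Gr}(n,k)$, all $w_1,w_2\in T_p\mathrm{Gr}(n,k)$, and every $0<r<\pi$, $$\|(\nabla\mathrm{d}\exp_p)_{rv}(w_1,w_2)\|\le\frac{8r}{3}\,\|w_1\|\,\|w_2\|.$$
   Context: The real Grassmannian is the symmetric space $\mathrm{Gr}(n,k)=\mathrm{SO}(n)/(\mathrm{SO}(k)\times\mathrm{SO}(n-k))$ with the quotient metric, where $\mathrm{SO}(n)$ carries the bi-invariant metric generated by the inner product $\langle X,Y\rangle=\frac12\mathrm{tr}(X^{\top}Y)$ on its Lie algebra of skew-symmetric matrices. Manifolds are assumed to have dimension at least $2$. $\exp_p$ is the Riemannian exponential map. Hessian of the exponential map: with $M=\mathrm{Gr}(n,k)$, $\mathrm{d}\exp_p$ is viewed as a section of the bundle $T_p^*M\otimes\exp_p^*(TM)$ over $T_pM$, with the connection induced by the flat connection $\nabla^{\mathrm{flat}}$ on $T_pM$ and the pullback of the Levi-Civita connection. For vector fields $\overline W_1,\overline W_2$ on an open subset of $T_pM$, $(\nabla\mathrm{d}\exp_p)(\overline W_1,\overline W_2)=\nabla_{\overline W_1}(\mathrm{d}\exp_p(\overline W_2))-\mathrm{d}\exp_p(\nabla^{\mathrm{flat}}_{\overline W_1}\overline W_2)$, where the first $\nabla$ on the right is the pullback connection along $\exp_p$. At each $u\in T_pM$ this is a symmetric bilinear map $(\nabla\mathrm{d}\exp_p)_u:T_pM\times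 T_pM\to T_{\exp_p(u)}M$. *)

theory Defs
  imports "HOL-Analysis.Analysis"
begin

section \<open>Riemannian manifolds given by an atlas\<close>

text \<open>
  A manifold modelled on the Euclidean space \<open>'e\<close> is given by a family of local
  parametrizations: the chart \<open>c\<close> is the inverse of the injective map \<open>param M c\<close> on the open
  set \<open>chart_dom M c\<close>. The function \<open>metric M c x\<close> is the coordinate expression of the
  Riemannian metric at the point with coordinates \<open>x\<close>.
\<close>

record ('c, 'e, 'a) riemannian =
  atlas :: "'c set"
  chart_dom :: "'c \<Rightarrow> 'e set"
  param :: "'c \<Rightarrow> 'e \<Rightarrow> 'a"
  metric :: "'c \<Rightarrow> 'e \<Rightarrow> 'e \<Rightarrow> 'e \<Rightarrow> real"

definition charts_at :: "('c, 'e, 'a) riemannian \<Rightarrow> 'a \<Rightarrow> 'c set" where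
  "charts_at M p = {c \<in> atlas M. p \<in> param M c ` chart_dom M c}"

definition coord :: "('c, 'e, 'a) riemannian \<Rightarrow> 'c \<Rightarrow> 'a \<Rightarrow> 'e" where
  "coord M c p = inv_into (chart_dom M c) (param M c) p"

text \<open>
  A tangent vector at \<open>p\<close> is the family of its components in all charts around \<open>p\<close>; the
  components in two charts are related by the derivative of the transition map. Components in
  charts not around \<open>p\<close> are \<open>0\<close>, so that equality of tangent vectors is equality of functions.
  The vector space operations are the pointwise ones.
\<close>

definition tangent_space ::
  "('c, 'e::euclidean_space, 'a) riemannian \<Rightarrow> 'a \<Rightarrow> ('c \<Rightarrow> 'e) set" where
  "tangent_space M p = {\<xi>.
     (\<forall>c\<in>charts_at M p. \<forall>c'\<in>charts_at M p.
        \<xi> c' = frechet_derivative (\<lambda>y. coord M c' (param M c y)) (at (coord M c p)) (\<xi> c)) \<and>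
     (\<forall>c. c \<notin> charts_at M p \<longrightarrow> \<xi> c = 0)}"

definition tnorm :: "('c, 'e::euclidean_space, 'a) riemannian \<Rightarrow> 'a \<Rightarrow> ('c \<Rightarrow> 'e) \<Rightarrow> real" where
  "tnorm M p \<xi> =
     (let c = (SOME c. c \<in> charts_at M p) in sqrt (metric M c (coord M c p) (\<xi> c) (\<xi> c)))"

text \<open>
  The Levi-Civita connection of a metric \<open>g\<close> on an open subset of \<open>'e\<close>: for constant vector
  fields \<open>u\<close>, \<open>v\<close>, the derivative \<open>\<nabla>\<^sub>u v\<close> is \<open>christoffel g x u v\<close>. This is the Koszul
  formula, in which all brackets vanish.
\<close>

definition christoffel ::
  "('e::euclidean_space \<Rightarrow> 'e \<Rightarrow> 'e \<Rightarrow> real) \<Rightarrow> 'e \<Rightarrow> 'e \<Rightarrow> 'e \<Rightarrow> 'e" where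
  "christoffel g x u v = (THE z. \<forall>w. 2 * g x z w =
     frechet_derivative (\<lambda>y. g y v w) (at x) u
     + frechet_derivative (\<lambda>y. g y u w) (at x) v
     - frechet_derivative (\<lambda>y. g y u v) (at x) w)"

definition velocity ::
  "('c, 'e::euclidean_space, 'a) riemannian \<Rightarrow> real set \<Rightarrow> (real \<Rightarrow> 'a) \<Rightarrow> real \<Rightarrow> 'c \<Rightarrow> 'e" where
  "velocity M S \<gamma> t = (\<lambda>c. if c \<in> charts_at M (\<gamma> t)
     then vector_derivative (\<lambda>s. coord M c (\<gamma> s)) (at t within S) else 0)"

text \<open>
  The covariant derivative of a vector field \<open>X\<close> along a curve \<open>\<gamma>\<close> with parameter interval \<open>S\<close>,
  that is, the derivative by the pullback of the Levi-Civita connection along \<open>\<gamma>\<close>.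
\<close>

definition cov_deriv ::
  "('c, 'e::euclidean_space, 'a) riemannian \<Rightarrow> real set \<Rightarrow> (real \<Rightarrow> 'a) \<Rightarrow> (real \<Rightarrow> 'c \<Rightarrow> 'e)
     \<Rightarrow> real \<Rightarrow> 'c \<Rightarrow> 'e" where
  "cov_deriv M S \<gamma> X t = (\<lambda>c. if c \<in> charts_at M (\<gamma> t)
     then vector_derivative (\<lambda>s. X s c) (at t within S)
       + christoffel (metric M c) (coord M c (\<gamma> t)) (velocity M S \<gamma> t c) (X t c)
     else 0)"

definition twice_differentiable_curve ::
  "('c, 'e::euclidean_space, 'a) riemannian \<Rightarrow> real set \<Rightarrow> (real \<Rightarrow> 'a) \<Rightarrow> bool" where
  "twice_differentiable_curve M S \<gamma> \<longleftrightarrow> (\<forall>t\<in>S. charts_at M (\<gamma> t) \<noteq> {} \<and>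
     (\<forall>c\<in>charts_at M (\<gamma> t).
        (\<exists>e>0. \<forall>s\<in>S. dist s t < e \<longrightarrow>
           c \<in> charts_at M (\<gamma> s) \<and> (\<lambda>s. coord M c (\<gamma> s)) differentiable (at s within S)) \<and>
        (\<lambda>s. velocity M S \<gamma> s c) differentiable (at t within S)))"

definition geodesic ::
  "('c, 'e::euclidean_space, 'a) riemannian \<Rightarrow> real set \<Rightarrow> (real \<Rightarrow> 'a) \<Rightarrow> bool" where
  "geodesic M S \<gamma> \<longleftrightarrow> twice_differentiable_curve M S \<gamma> \<and>
     (\<forall>t\<in>S. cov_deriv M S \<gamma> (velocity M S \<gamma>) t = (\<lambda>c. 0))"

definition exp_map ::
  "('c, 'e::euclidean_space, 'a) riemannian \<Rightarrow> 'a \<Rightarrow> ('c \<Rightarrow> 'e) \<Rightarrow> 'a" where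
  "exp_map M p v = (THE q. \<exists>\<gamma>. geodesic M {0..1} \<gamma> \<and> \<gamma> 0 = p \<and>
     velocity M {0..1} \<gamma> 0 = v \<and> \<gamma> 1 = q)"

definition dexp ::
  "('c, 'e::euclidean_space, 'a) riemannian \<Rightarrow> 'a \<Rightarrow> ('c \<Rightarrow> 'e) \<Rightarrow> ('c \<Rightarrow> 'e) \<Rightarrow> 'c \<Rightarrow> 'e" where
  "dexp M p u w = velocity M UNIV (\<lambda>t. exp_map M p (\<lambda>c. u c + t *\<^sub>R w c)) 0"

definition flat_deriv ::
  "(('c \<Rightarrow> 'e::euclidean_space) \<Rightarrow> 'c \<Rightarrow> 'e) \<Rightarrow> (('c \<Rightarrow> 'e) \<Rightarrow> 'c \<Rightarrow> 'e) \<Rightarrow> ('c \<Rightarrow> 'e) \<Rightarrow> 'c \<Rightarrow> 'e" where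
  "flat_deriv W1 W2 u = (\<lambda>c. vector_derivative (\<lambda>s. W2 (\<lambda>b. u b + s *\<^sub>R W1 u b) c) (at 0))"

text \<open>
  \<open>(\<nabla> d exp\<^sub>p)(W1, W2)\<close> for vector fields \<open>W1\<close>, \<open>W2\<close> on the tangent space at \<open>p\<close>. The pullback
  connection along \<open>exp\<^sub>p\<close> in direction \<open>W1 u\<close> is the covariant derivative along the image of the
  line \<open>s \<mapsto> u + s W1 u\<close>.
\<close>

definition nabla_dexp ::
  "('c, 'e::euclidean_space, 'a) riemannian \<Rightarrow> 'a \<Rightarrow> (('c \<Rightarrow> 'e) \<Rightarrow> 'c \<Rightarrow> 'e)
     \<Rightarrow> (('c \<Rightarrow> 'e) \<Rightarrow> 'c \<Rightarrow> 'e) \<Rightarrow> ('c \<Rightarrow> 'e) \<Rightarrow> 'c \<Rightarrow> 'e" where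
  "nabla_dexp M p W1 W2 u = (\<lambda>c.
     cov_deriv M UNIV
       (\<lambda>s. exp_map M p (\<lambda>b. u b + s *\<^sub>R W1 u b))
       (\<lambda>s. dexp M p (\<lambda>b. u b + s *\<^sub>R W1 u b) (W2 (\<lambda>b. u b + s *\<^sub>R W1 u b))) 0 c
     - dexp M p u (flat_deriv W1 W2 u) c)"

text \<open>
  The expression above is tensorial in \<open>W1\<close> and \<open>W2\<close>; its value at \<open>u\<close> on two tangent vectors is
  obtained by extending them to constant fields.
\<close>

definition hessian_exp ::
  "('c, 'e::euclidean_space, 'a) riemannian \<Rightarrow> 'a \<Rightarrow> ('c \<Rightarrow> 'e) \<Rightarrow> ('c \<Rightarrow> 'e) \<Rightarrow> ('c \<Rightarrow> 'e)
     \<Rightarrow> 'c \<Rightarrow> 'e" where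
  "hessian_exp M p u w1 w2 = nabla_dexp M p (\<lambda>_. w1) (\<lambda>_. w2) u"


section \<open>The real Grassmannian\<close>

text \<open>
  With \<open>k = CARD('k)\<close> and \<open>n - k = CARD('l)\<close>, the coordinates of \<open>\<real>\<^sup>n\<close> are indexed by
  \<open>'k + 'l\<close>. Every pair \<open>0 < k < n\<close> arises in this way.
\<close>

type_synonym ('k, 'l) mat = "real ^ ('k + 'l) ^ ('k + 'l)"

definition block_diag :: "real ^ 'k ^ 'k \<Rightarrow> real ^ 'l ^ 'l \<Rightarrow> ('k::finite, 'l::finite) mat" where
  "block_diag A B = (\<chi> i j. case (i, j) of
      (Inl a, Inl b) \<Rightarrow> A $ a $ b
    | (Inr a, Inr b) \<Rightarrow> B $ a $ b
    | _ \<Rightarrow> 0)"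

definition isotropy_group :: "('k::finite, 'l::finite) mat set" where
  "isotropy_group = {block_diag A B |A B. rotation_matrix A \<and> rotation_matrix B}"

definition isotropy_algebra :: "('k::finite, 'l::finite) mat set" where
  "isotropy_algebra = {block_diag A B |A B. transpose A = - A \<and> transpose B = - B}"

definition gr_coset :: "('k::finite, 'l::finite) mat \<Rightarrow> ('k, 'l) mat set" where
  "gr_coset Q = {Q ** R |R. R \<in> isotropy_group}"

definition Gr :: "('k::finite, 'l::finite) mat set set" where
  "Gr = {gr_coset Q |Q. rotation_matrix Q}"

text \<open>
  The inner product on the Lie algebra, and the component of a skew-symmetric matrix that is
  orthogonal to the Lie algebra of the isotropy group.
\<close>

definition so_inner :: "real ^ 'n ^ 'n \<Rightarrow> real ^ 'n ^ 'n \<Rightarrow> real" where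
  "so_inner X Y = trace (transpose X ** Y) / 2"

definition horizontal :: "('k::finite, 'l::finite) mat \<Rightarrow> ('k, 'l) mat" where
  "horizontal X = (THE Y. X - Y \<in> isotropy_algebra \<and> (\<forall>Z\<in>isotropy_algebra. so_inner Y Z = 0))"

primrec Ck_on :: "nat \<Rightarrow> ('e::real_normed_vector \<Rightarrow> 'f::real_normed_vector) \<Rightarrow> 'e set \<Rightarrow> bool" where
  "Ck_on 0 f S \<longleftrightarrow> continuous_on S f"
| "Ck_on (Suc n) f S \<longleftrightarrow> (\<forall>x\<in>S. f differentiable (at x)) \<and>
     (\<forall>v. Ck_on n (\<lambda>x. frechet_derivative f (at x) v) S)"

definition smooth_on_open :: "('e::real_normed_vector \<Rightarrow> 'f::real_normed_vector) \<Rightarrow> 'e set \<Rightarrow> bool" where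
  "smooth_on_open f S \<longleftrightarrow> open S \<and> (\<forall>n. Ck_on n f S)"

text \<open>
  The charts of the quotient manifold. The smooth structure is the one for which the projection
  \<open>gr_coset\<close> is a submersion, so each local parametrization is locally \<open>x \<mapsto> gr_coset (\<sigma> x)\<close>
  with \<open>\<sigma>\<close> a smooth map to the rotation group; a chart is recorded together with such a lift.
  The function \<open>chart_form\<close> is the differential of the parametrization, read at the base coset
  after left translation by the inverse of \<open>\<sigma> x\<close>. Its injectivity says that the parametrization is an
  immersion, hence, as \<open>'k \<times> 'l\<close> matrices have the dimension of the Grassmannian, a local
  diffeomorphism.
\<close>

type_synonym ('k, 'l) gr_chart = "(real ^ 'l ^ 'k) set \<times> (real ^ 'l ^ 'k \<Rightarrow> ('k, 'l) mat)"

definition chart_form ::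
  "(real ^ 'l ^ 'k \<Rightarrow> ('k::finite, 'l::finite) mat) \<Rightarrow> real ^ 'l ^ 'k \<Rightarrow> real ^ 'l ^ 'k \<Rightarrow> ('k, 'l) mat" where
  "chart_form \<sigma> x u = horizontal (transpose (\<sigma> x) ** frechet_derivative \<sigma> (at x) u)"

definition gr_atlas :: "('k::finite, 'l::finite) gr_chart set" where
  "gr_atlas = {(D, \<sigma>). smooth_on_open \<sigma> D \<and> (\<forall>x\<in>D. rotation_matrix (\<sigma> x)) \<and>
     inj_on (\<lambda>x. gr_coset (\<sigma> x)) D \<and> (\<forall>x\<in>D. inj (chart_form \<sigma> x))}"

text \<open>
  The quotient metric: the projection from the rotation group, with its bi-invariant metric, is a
  Riemannian submersion, so tangent vectors are measured by their horizontal lifts.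
\<close>

definition grassmannian ::
  "(('k::finite, 'l::finite) gr_chart, real ^ 'l ^ 'k, ('k, 'l) mat set) riemannian" where
  "grassmannian = \<lparr>
     atlas = gr_atlas,
     chart_dom = fst,
     param = (\<lambda>c x. gr_coset (snd c x)),
     metric = (\<lambda>c x u v. so_inner (chart_form (snd c) x u) (chart_form (snd c) x v))\<rparr>"

end

theory Submission
  imports Defs
begin

text \<open>
  Sending a coset \<open>g K\<close> to the involution \<open>g I g\<^sup>T\<close> with \<open>I = diag (1, -1)\<close> immerses the Grassmannian
  into the symmetric matrices, and the Frobenius norm induces \<open>8\<close> times the quotient metric. So covariant
  derivatives are tangential parts of ambient derivatives, the exponential map at \<open>S\<close> is
  \<open>Y \<mapsto> exp (Y S) S\<close>, and its Hessian is the tangential part of the second derivative of the matrix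
  exponential at a skew-symmetric matrix \<open>A\<close>. Put \<open>V\<^sub>B (t) = exp (-tA) B exp (tA)\<close> and
  \<open>N\<^sub>B (t) = \<integral>\<^sub>0\<^sup>t V\<^sub>B\<close>. Translated by \<open>exp (-tA)\<close>, the tangential part at \<open>tA\<close> has derivative
  \<open>([V\<^sub>B, N\<^sub>C] + [V\<^sub>C, N\<^sub>B]) / 2\<close> in \<open>t\<close>. Differentiating the brackets leaves
  \<open>[V\<^sub>B', N\<^sub>C] + [V\<^sub>C', N\<^sub>B]\<close>, of Frobenius norm at most \<open>4 t \<parallel>A\<parallel> \<parallel>B\<parallel> \<parallel>C\<parallel>\<close>, because a
  skew-symmetric matrix has operator norm at most \<open>\<parallel>A\<parallel> / \<surd>2\<close>. Two integrations give
  \<open>\<parallel>A\<parallel> \<parallel>B\<parallel> \<parallel>C\<parallel> / 3\<close>; as \<open>\<parallel>A\<parallel> = r \<surd>8\<close>, this is the constant \<open>8 r / 3\<close> in the quotient metric.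
\<close>

section \<open>Matrices with the Frobenius norm\<close>

text \<open>The manifold consists of oriented planes, whereas an involution remembers only the
  plane, so \<open>reflect\<close> is two-to-one on cosets. Whenever a statement about involutions
  has to come back to cosets (coordinates near a point, uniqueness of geodesics), the lost
  orientation is recovered by continuity: it is recorded by determinants with values 1 and -1. The
  definitions refer to all charts around a point and fix \<open>exp_map\<close> as the endpoint of
  any geodesic with the given initial velocity. So geodesics need existence and uniqueness, and at
  least one chart around every point has to be exhibited; the Cayley transform provides it. The
  factor 8 is 4 times 2: differentiating \<open>g I g\<^sup>T\<close> doubles the horizontal part,
  and the inner product on the Lie algebra carries a factor 1/2.\<close>

lemma inner_matrix_trace: "A \<bullet> B = trace (transpose A ** B)"
  for A B :: "real^'n^'m"
  unfolding inner_vec_def trace_def transpose_def matrix_matrix_mult_def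
  by (simp, subst sum.swap, simp)

text \<open>Cauchy-Schwarz bounds each entry by a row norm times a column norm, and the double sum
  then factors.\<close>

lemma norm_matrix_mult: "norm (A ** B) \<le> norm A * norm B"
  for A :: "real^'n^'m" and B :: "real^'p^'n"
proof -
  have row: "(norm (A ** B))\<^sup>2 = (\<Sum>i\<in>UNIV. \<Sum>j\<in>UNIV. (row i A \<bullet> column j B)\<^sup>2)"
    unfolding power2_norm_eq_inner inner_vec_def
    by (simp add: matrix_matrix_mult_def row_def column_def inner_vec_def power2_eq_square)
  also have "\<dots> \<le> (\<Sum>i\<in>UNIV. \<Sum>j\<in>UNIV. (norm (row i A))\<^sup>2 * (norm (column j B))\<^sup>2)"
    by (intro sum_mono)
       (metis Cauchy_Schwarz_ineq2 abs_ge_zero power2_abs power_mono power_mult_distrib)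
  also have "\<dots> = (\<Sum>i\<in>UNIV. (norm (row i A))\<^sup>2) * (\<Sum>j\<in>UNIV. (norm (column j B))\<^sup>2)"
    by (simp add: sum_product)
  also have "(\<Sum>i\<in>UNIV. (norm (row i A))\<^sup>2) = (norm A)\<^sup>2"
    by (simp add: power2_norm_eq_inner inner_vec_def row_def)
  also have "(\<Sum>j\<in>UNIV. (norm (column j B))\<^sup>2) = (norm B)\<^sup>2"
    unfolding power2_norm_eq_inner inner_vec_def column_def
    by (simp, subst sum.swap, simp)
  finally show ?thesis
    by (metis norm_ge_zero power2_le_imp_le power_mult_distrib zero_le_mult_iff)
qed

lemma bounded_bilinear_matrix_mult:
  "bounded_bilinear ((**) :: real^'n^'m \<Rightarrow> real^'p^'n \<Rightarrow> real^'p^'m)"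
proof
  show "\<exists>K. \<forall>A B. norm (A ** B :: real^'p^'m) \<le> norm (A :: real^'n^'m) * norm (B :: real^'p^'n) * K"
    by (rule exI[of _ 1]) (simp add: norm_matrix_mult)
qed (simp_all add: vec_eq_iff matrix_matrix_mult_def sum.distrib algebra_simps sum_distrib_left)

interpretation matmul: bounded_bilinear "(**) :: real^'n^'m \<Rightarrow> real^'p^'n \<Rightarrow> real^'p^'m"
  by (rule bounded_bilinear_matrix_mult)

lemma bounded_linear_transpose: "bounded_linear (transpose :: real^'n^'m \<Rightarrow> real^'m^'n)"
  by (intro linear_conv_bounded_linear[THEN iffD1] linearI)
     (simp_all add: transpose_def vec_eq_iff)

lemmas transp_simps =
  linear_add[OF bounded_linear.linear[OF bounded_linear_transpose]]
  linear_diff[OF bounded_linear.linear[OF bounded_linear_transpose]]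
  linear_neg[OF bounded_linear.linear[OF bounded_linear_transpose]]
  linear_cmul[OF bounded_linear.linear[OF bounded_linear_transpose]]
  linear_0[OF bounded_linear.linear[OF bounded_linear_transpose]]

lemmas matrix_ring_simps =
  matmul.add_left matmul.add_right matmul.diff_left matmul.diff_right
  matmul.minus_left matmul.minus_right matmul.scaleR_left matmul.scaleR_right
  matmul.zero_left matmul.zero_right
  transp_simps matrix_transpose_mul

lemma orthogonal_cancel:
  fixes Q :: "real^'n^'n" and X :: "real^'m^'n" and Y :: "real^'n^'p"
  assumes "orthogonal_matrix Q"
  shows "transpose Q ** Q = mat 1" "Q ** transpose Q = mat 1"
    "transpose Q ** (Q ** X) = X" "Q ** (transpose Q ** X) = X"
    "(Y ** Q) ** transpose Q = Y" "(Y ** transpose Q) ** Q = Y"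
  using assms unfolding orthogonal_matrix_def
  by (simp_all add: matrix_mul_assoc) (simp_all flip: matrix_mul_assoc)

lemma norm_transpose: "norm (transpose A) = norm A" for A :: "real^'n^'m"
  unfolding norm_eq_sqrt_inner inner_vec_def transpose_def
  by (simp, subst sum.swap, simp)

lemma norm_orthogonal_mult_left: "orthogonal_matrix Q \<Longrightarrow> norm (Q ** X) = norm X"
  for Q :: "real^'n^'n" and X :: "real^'m^'n"
  unfolding norm_eq_sqrt_inner inner_matrix_trace
  by (simp add: matrix_transpose_mul orthogonal_cancel flip: matrix_mul_assoc)

lemma norm_orthogonal_mult_right: "orthogonal_matrix Q \<Longrightarrow> norm (X ** Q) = norm X"
  for Q :: "real^'n^'n" and X :: "real^'n^'m"
  by (metis matrix_transpose_mul norm_orthogonal_mult_left norm_transpose orthogonal_matrix_transpose)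

section \<open>Norm bounds for skew-symmetric matrices\<close>

lemma norm_matrix_vector_sq: "(norm A)\<^sup>2 = (\<Sum>j\<in>UNIV. (norm (column j A))\<^sup>2)"
  for A :: "real^'n^'m"
  unfolding power2_norm_eq_inner inner_vec_def column_def
  by (simp, subst sum.swap, simp)

text \<open>Bessel's inequality for two vectors; applied to the rows of a matrix, it bounds the sum
  of two squared stretch factors by the squared Frobenius norm.\<close>

lemma inner_orthonormal_pair:
  fixes z :: "'a::real_inner"
  assumes "norm x = 1" "norm y = 1" "x \<bullet> y = 0"
  shows "(z \<bullet> x)\<^sup>2 + (z \<bullet> y)\<^sup>2 \<le> (norm z)\<^sup>2"
proof -
  have xx: "x \<bullet> x = 1" "y \<bullet> y = 1" using assms by (simp_all add: norm_eq_1)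
  have "0 \<le> (z - (z \<bullet> x) *\<^sub>R x - (z \<bullet> y) *\<^sub>R y) \<bullet> (z - (z \<bullet> x) *\<^sub>R x - (z \<bullet> y) *\<^sub>R y)" by simp
  also have "\<dots> = (norm z)\<^sup>2 - (z \<bullet> x)\<^sup>2 - (z \<bullet> y)\<^sup>2"
    using assms(3) xx
    by (simp add: inner_diff_left inner_diff_right inner_commute power2_norm_eq_inner)
       (simp add: power2_eq_square)
  finally show ?thesis by simp
qed

text \<open>The nonzero singular values of a skew-symmetric matrix come in equal pairs: a unit vector \<open>z\<close>
  and the direction of \<open>A *v z\<close> are orthonormal, and \<open>A\<close> stretches the second at least as much.\<close>

lemma skew_matrix_vector_bound:
  fixes A :: "real^'n^'n" and z :: "real^'n"
  assumes skew: "transpose A = - A"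
  shows "2 * (norm (A *v z))\<^sup>2 \<le> (norm A)\<^sup>2 * (norm z)\<^sup>2"
proof (cases "A *v z = 0")
  case False
  define y where "y = A *v z"
  have y0: "y \<noteq> 0" and z0: "z \<noteq> 0" using False by (auto simp: y_def)
  have adj: "(A *v a) \<bullet> b = - (a \<bullet> (A *v b))" for a b
  proof -
    have "(A *v a) \<bullet> b = (b v* A) \<bullet> a"
      by (subst dot_lmul_matrix) (rule inner_commute)
    also have "\<dots> = a \<bullet> (transpose A *v b)"
      by (subst transpose_matrix_vector) (rule inner_commute)
    also have "\<dots> = - (a \<bullet> (A *v b))" unfolding skew
      using matrix_vector_mult_diff_rdistrib[of 0 A b] by simp
    finally show ?thesis .
  qed
  have zy: "z \<bullet> y = 0" using adj[of z z] by (simp add: y_def inner_commute)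
  let ?x = "z /\<^sub>R norm z" and ?y = "y /\<^sub>R norm y"
  have "(norm (A *v ?x))\<^sup>2 + (norm (A *v ?y))\<^sup>2 = (\<Sum>i\<in>UNIV. (row i A \<bullet> ?x)\<^sup>2 + (row i A \<bullet> ?y)\<^sup>2)"
    unfolding power2_norm_eq_inner[of "A *v _"] inner_vec_def[of "A *v _"]
    by (simp add: matrix_mult_dot row_def sum.distrib power2_eq_square vec_nth_inverse)
  also have "\<dots> \<le> (\<Sum>i\<in>UNIV. (norm (row i A))\<^sup>2)"
    using z0 y0 zy by (intro sum_mono inner_orthonormal_pair) auto
  also have "\<dots> = (norm A)\<^sup>2"
    by (simp add: power2_norm_eq_inner inner_vec_def row_def)
  finally have le: "(norm (A *v ?x))\<^sup>2 + (norm (A *v ?y))\<^sup>2 \<le> (norm A)\<^sup>2" .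
  have nx: "norm (A *v ?x) = norm y / norm z"
    by (simp add: matrix_vector_mult_scaleR y_def divide_inverse)
  \<comment> \<open>Skewness moves \<open>A\<close> across the inner product, so the component of
    \<open>A *v ?y\<close> along \<open>?x\<close> already has the length of
    \<open>A *v ?x\<close>.\<close>
  have "norm y / norm z = \<bar>(A *v ?y) \<bullet> ?x\<bar>"
  proof -
    have "(A *v ?y) \<bullet> ?x = - (y \<bullet> y) / (norm y * norm z)"
      using adj[of y z] by (simp add: matrix_vector_mult_scaleR y_def field_simps)
    then show ?thesis using y0 by (simp add: dot_square_norm power2_eq_square)
  qed
  also have "\<dots> \<le> norm (A *v ?y) * norm ?x" by (rule Cauchy_Schwarz_ineq2)
  also have "\<dots> = norm (A *v ?y)" using z0 by simp
  finally have "(norm y / norm z)\<^sup>2 \<le> (norm (A *v ?y))\<^sup>2" by (intro power_mono) auto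
  with le have "2 * (norm y / norm z)\<^sup>2 \<le> (norm A)\<^sup>2" unfolding nx by linarith
  then show ?thesis using z0 by (simp add: y_def power_divide field_simps)
qed simp

text \<open>Apply the vector bound to each column of \<open>X\<close>; squared Frobenius norms add
  up over columns.\<close>

lemma norm_skew_mult_left:
  fixes A :: "real^'n^'n" and X :: "real^'m^'n"
  assumes "transpose A = - A"
  shows "sqrt 2 * norm (A ** X) \<le> norm A * norm X"
proof -
  have col: "column j (A ** X) = A *v column j X" for j
    by (simp add: column_def matrix_matrix_mult_def matrix_vector_mult_def vec_eq_iff)
  have "2 * (norm (A ** X))\<^sup>2 = (\<Sum>j\<in>UNIV. 2 * (norm (A *v column j X))\<^sup>2)"
    by (simp add: norm_matrix_vector_sq col sum_distrib_left)
  also have "\<dots> \<le> (\<Sum>j\<in>UNIV. (norm A)\<^sup>2 * (norm (column j X))\<^sup>2)"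
    by (intro sum_mono skew_matrix_vector_bound assms)
  also have "\<dots> = (norm A * norm X)\<^sup>2"
    by (simp add: norm_matrix_vector_sq[of X] sum_distrib_left power_mult_distrib)
  finally have "(sqrt 2 * norm (A ** X))\<^sup>2 \<le> (norm A * norm X)\<^sup>2" by (simp add: power_mult_distrib)
  then show ?thesis by (rule power2_le_imp_le) simp
qed

lemma norm_skew_mult_right:
  fixes A :: "real^'n^'n" and X :: "real^'n^'m"
  assumes "transpose A = - A"
  shows "sqrt 2 * norm (X ** A) \<le> norm X * norm A"
  using norm_skew_mult_left[OF assms, of "transpose X"] norm_transpose[of "X ** A"]
  by (simp add: assms matrix_ring_simps norm_transpose mult.commute)

section \<open>The exponential of a skew-symmetric matrix\<close>

primrec mpow :: "real^'n^'n \<Rightarrow> nat \<Rightarrow> real^'n^'n" where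
  "mpow A 0 = mat 1"
| "mpow A (Suc n) = A ** mpow A n"

text \<open>The series is summed entry by entry, so that differentiation along a line through 0
  becomes termwise differentiation of real power series.\<close>

definition mexp :: "real^'n^'n \<Rightarrow> real^'n^'n" where
  "mexp A = (\<chi> i j. \<Sum>n. mpow A n $ i $ j / fact n)"

lemma mpow_scaleR: "mpow (t *\<^sub>R A) n = t ^ n *\<^sub>R mpow A n"
  by (induction n) (simp_all add: matrix_ring_simps)

lemma norm_mpow: "norm (mpow A n) \<le> norm (mat 1 :: real^'n^'n) * norm A ^ n"
  for A :: "real^'n^'n"
proof (induction n)
  case (Suc n)
  show ?case
    using order_trans[OF norm_matrix_mult[of A "mpow A n"] mult_left_mono[OF Suc norm_ge_zero]]
    by (simp add: mult_ac)
qed simp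

lemma summable_mpow:
  fixes A :: "real^'n^'n"
  shows "summable (\<lambda>n. mpow A n $ i $ j / fact n * y ^ n)"
proof (rule summable_comparison_test[OF exI[of _ 0]], intro allI impI)
  show "summable (\<lambda>n. norm (mat 1 :: real^'n^'n) * (inverse (fact n) * (norm A * \<bar>y\<bar>) ^ n))"
    by (intro summable_mult summable_exp)
  fix n
  have "\<bar>mpow A n $ i $ j\<bar> \<le> norm (mat 1 :: real^'n^'n) * norm A ^ n"
    using component_le_norm_cart[of "mpow A n $ i" j] Finite_Cartesian_Product.norm_nth_le[of "mpow A n" i] norm_mpow[of A n]
    by linarith
  then have "\<bar>mpow A n $ i $ j\<bar> * (\<bar>y\<bar> ^ n / fact n) \<le> norm (mat 1 :: real^'n^'n) * norm A ^ n * (\<bar>y\<bar> ^ n / fact n)"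
    by (intro mult_right_mono) auto
  then show "norm (mpow A n $ i $ j / fact n * y ^ n)
      \<le> norm (mat 1 :: real^'n^'n) * (inverse (fact n) * (norm A * \<bar>y\<bar>) ^ n)"
    by (simp add: abs_mult power_abs power_mult_distrib field_simps)
qed

lemma mexp_0 [simp]: "mexp (0::real^'n^'n) = mat 1"
proof -
  have "(\<Sum>n. mpow (0::real^'n^'n) n $ i $ j / fact n) = mat 1 $ i $ j" for i j
  proof -
    have "(\<lambda>n. mpow (0::real^'n^'n) n $ i $ j / fact n) = (\<lambda>n. if n = 0 then mat 1 $ i $ j else 0)"
      by (rule ext, case_tac n) auto
    then show ?thesis using sums_If_finite[of "\<lambda>n. n = 0" "\<lambda>_. mat 1 $ i $ j :: real"]
      by (simp add: sums_iff)
  qed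
  then show ?thesis by (simp add: mexp_def vec_eq_iff)
qed

lemma has_vector_derivative_vec_nth:
  fixes f :: "real \<Rightarrow> 'a::real_normed_vector ^ 'n"
  assumes "\<And>i. ((\<lambda>t. f t $ i) has_vector_derivative f' $ i) (at x within S)"
  shows "(f has_vector_derivative f') (at x within S)"
  using assms unfolding has_vector_derivative_def has_derivative_def
  by (auto intro!: vec_tendstoI simp: bounded_linear_scaleR_left)

lemma has_vector_derivative_mexp:
  "((\<lambda>t. mexp (t *\<^sub>R A)) has_vector_derivative A ** mexp (t *\<^sub>R A)) (at t within S)"
proof (intro has_vector_derivative_vec_nth)
  fix i j
  define c where "c i j n = mpow A n $ i $ j / fact n" for i j n
  have mexp_c: "mexp (t *\<^sub>R A) $ i $ j = (\<Sum>n. c i j n * t ^ n)" for i j t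
    by (simp add: mexp_def c_def mpow_scaleR mult_ac)
  have summ: "summable (\<lambda>n. c i j n * y ^ n)" for i j y
    unfolding c_def by (rule summable_mpow)
  have "((\<lambda>t. \<Sum>n. c i j n * t ^ n) has_field_derivative (\<Sum>n. diffs (c i j) n * t ^ n)) (at t within S)"
    by (rule has_field_derivative_at_within[OF termdiffs_strong_converges_everywhere[OF summ]])
  moreover have "(\<Sum>n. diffs (c i j) n * t ^ n) = (A ** mexp (t *\<^sub>R A)) $ i $ j"
  proof -
    have "diffs (c i j) n * t ^ n = (\<Sum>k\<in>UNIV. A $ i $ k * (c k j n * t ^ n))" for n
    proof -
      have "diffs (c i j) n = (A ** mpow A n) $ i $ j / fact n"
        by (simp add: diffs_def c_def divide_simps del: of_nat_Suc)
      then show ?thesis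
        by (simp add: matrix_matrix_mult_def c_def sum_divide_distrib sum_distrib_right mult.assoc)
    qed
    then have "(\<Sum>n. diffs (c i j) n * t ^ n) = (\<Sum>n. \<Sum>k\<in>UNIV. A $ i $ k * (c k j n * t ^ n))" by simp
    also have "\<dots> = (\<Sum>k\<in>UNIV. A $ i $ k * (\<Sum>n. c k j n * t ^ n))"
      by (subst suminf_sum) (auto intro!: summable_mult summ simp: suminf_mult[OF summ])
    finally show ?thesis by (simp add: matrix_matrix_mult_def mexp_c)
  qed
  ultimately show "((\<lambda>t. mexp (t *\<^sub>R A) $ i $ j) has_vector_derivative (A ** mexp (t *\<^sub>R A)) $ i $ j) (at t within S)"
    by (simp add: has_real_derivative_iff_has_vector_derivative mexp_c)
qed

lemma has_vector_derivative_matrix_mult [derivative_intros]: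
  fixes f :: "real \<Rightarrow> real^'n^'m" and g :: "real \<Rightarrow> real^'p^'n"
  assumes "(f has_vector_derivative f') (at x within S)" "(g has_vector_derivative g') (at x within S)"
  shows "((\<lambda>t. f t ** g t) has_vector_derivative (f x ** g' + f' ** g x)) (at x within S)"
  by (rule matmul.has_vector_derivative[OF assms])

lemma has_vector_derivative_transpose [derivative_intros]:
  "(f has_vector_derivative f') F \<Longrightarrow> ((\<lambda>t. transpose (f t)) has_vector_derivative transpose f') F"
  for f :: "real \<Rightarrow> real^'n^'m"
  by (rule bounded_linear.has_vector_derivative[OF bounded_linear_transpose])

lemma zero_vector_derivative_eq:
  fixes f :: "real \<Rightarrow> 'a::real_normed_vector"
  assumes "\<And>t. (f has_vector_derivative 0) (at t)"
  shows "f s = f t"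
  using has_vector_derivative_zero_constant[of UNIV f] assms by (metis UNIV_I convex_UNIV)

text \<open>Skewness makes the derivative of \<open>transpose E ** E\<close> along the one-parameter
  group vanish, so the value at time 0 persists. The later identities for \<open>mexp\<close> use
  the same constancy argument.\<close>

lemma orthogonal_mexp:
  fixes A :: "real^'n^'n"
  assumes skew: "transpose A = - A"
  shows "orthogonal_matrix (mexp A)"
proof -
  let ?E = "\<lambda>t. mexp (t *\<^sub>R A)"
  have "((\<lambda>t. transpose (?E t) ** ?E t) has_vector_derivative 0) (at t within UNIV)" for t
    by (rule derivative_eq_intros has_vector_derivative_mexp refl)+
       (simp add: matrix_ring_simps skew matrix_mul_assoc)
  then have "transpose (?E 1) ** ?E 1 = transpose (?E 0) ** ?E 0"
    by (rule zero_vector_derivative_eq)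
  then show ?thesis by (simp add: orthogonal_matrix)
qed

lemma orthogonal_mexp_scaleR:
  fixes A :: "real^'n^'n"
  assumes "transpose A = - A"
  shows "orthogonal_matrix (mexp (t *\<^sub>R A))"
  by (intro orthogonal_mexp) (simp add: matrix_ring_simps assms)

lemma mexp_commute:
  fixes A :: "real^'n^'n"
  assumes skew: "transpose A = - A"
  shows "mexp (t *\<^sub>R A) ** A = A ** mexp (t *\<^sub>R A)"
proof -
  let ?E = "\<lambda>t. mexp (t *\<^sub>R A)"
  have "((\<lambda>t. transpose (?E t) ** A ** ?E t) has_vector_derivative 0) (at t within UNIV)" for t
    by (rule derivative_eq_intros has_vector_derivative_mexp refl)+
       (simp add: matrix_ring_simps skew matrix_mul_assoc)
  then have "transpose (?E 0) ** A ** ?E 0 = transpose (?E t) ** A ** ?E t"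
    by (rule zero_vector_derivative_eq)
  then have "A = transpose (?E t) ** (A ** ?E t)" by (simp add: matrix_mul_assoc)
  then have "?E t ** A = ?E t ** (transpose (?E t) ** (A ** ?E t))" by simp
  then show ?thesis by (simp add: orthogonal_cancel orthogonal_mexp_scaleR skew)
qed

section \<open>Determinants along continuous families\<close>

lemma tendsto_det:
  fixes f :: "'a \<Rightarrow> real^'n^'n"
  assumes "(f \<longlongrightarrow> A) F"
  shows "((\<lambda>x. det (f x)) \<longlongrightarrow> det A) F"
  unfolding det_def by (intro tendsto_intros assms)

lemma continuous_mexp_scaleR: "continuous_on S (\<lambda>t. mexp (t *\<^sub>R A))"
  by (auto intro!: continuous_on_vector_derivative has_vector_derivative_mexp)

text \<open>The values 1 and -1 are at distance 2, so convergence forces eventual equality with the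
  limit. Applied to determinants, this is how orientations are tracked.\<close>

lemma eventually_sign_eq:
  fixes f :: "'a \<Rightarrow> real"
  assumes "(f \<longlongrightarrow> l) F" "\<forall>\<^sub>F x in F. f x = 1 \<or> f x = - 1" "l = 1 \<or> l = - 1"
  shows "\<forall>\<^sub>F x in F. f x = l"
proof -
  have "\<forall>\<^sub>F x in F. dist (f x) l < 1" by (rule tendstoD[OF assms(1)]) simp
  with assms(2) show ?thesis
    by eventually_elim (use assms(3) in \<open>auto simp: dist_real_def\<close>)
qed

text \<open>Along \<open>t *\<^sub>R A\<close> the determinant is continuous with values 1 and -1,
  so on the connected line it keeps its value at time 0.\<close>

lemma rotation_mexp:
  fixes A :: "real^'n^'n"
  assumes skew: "transpose A = - A"
  shows "rotation_matrix (mexp A)"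
proof -
  let ?d = "\<lambda>t. det (mexp (t *\<^sub>R A))"
  have "?d 0 = ?d 1"
  proof (rule connected_local_const[where f = ?d and A = UNIV])
    show "\<forall>a\<in>UNIV. \<forall>\<^sub>F b in at a. ?d a = ?d b"
    proof
      fix a :: real
      have "((\<lambda>t. mexp (t *\<^sub>R A)) \<longlongrightarrow> mexp (a *\<^sub>R A)) (at a)"
        using continuous_mexp_scaleR[of UNIV A] by (simp add: continuous_on_def)
      then have "\<forall>\<^sub>F b in at a. ?d b = ?d a"
        by (intro eventually_sign_eq tendsto_det always_eventually allI det_orthogonal_matrix
              orthogonal_mexp_scaleR skew)
      then show "\<forall>\<^sub>F b in at a. ?d a = ?d b" by eventually_elim simp
    qed
  qed auto
  then show ?thesis
    using orthogonal_mexp[OF skew] by (simp add: rotation_matrix_def)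
qed

section \<open>Comparison bounds for linear differential equations\<close>

lemma norm_le_of_vector_derivative_le:
  fixes f :: "real \<Rightarrow> 'a::real_normed_vector"
  assumes f: "\<And>s. s \<in> {0..1} \<Longrightarrow> (f has_vector_derivative f' s) (at s within {0..1})"
    and g: "\<And>s. s \<in> {0..1} \<Longrightarrow> (\<phi> has_vector_derivative \<phi>' s) (at s within {0..1})"
    and le: "\<And>s. s \<in> {0..1} \<Longrightarrow> norm (f' s) \<le> \<phi>' s"
    and t: "t \<in> {0..1}"
  shows "norm (f t - f 0) \<le> \<phi> t - \<phi> 0"
proof (cases "t = 0")
  case False
  have cont: "continuous_on {0..t} f" "continuous_on {0..t} \<phi>"
    using t by (auto intro!: continuous_on_vector_derivative has_vector_derivative_within_subset[OF f]
        has_vector_derivative_within_subset[OF g])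
  have at: "at s within {0..1} = at s" if "0 < s" "s < t" for s :: real
    using that t by (intro at_within_Icc_at) auto
  show ?thesis
    using t False f g le
    by (intro differentiable_bound_general[OF _ cont, where f' = f' and \<phi>' = \<phi>'])
       (auto simp flip: at)
qed simp

text \<open>Variation of constants: multiplying by the transpose of
  \<open>mexp (t *\<^sub>R A)\<close> removes the homogeneous term. That factor is an isometry, so
  the bound shows no exponential growth. With \<open>K = 0\<close> this is a uniqueness
  statement.\<close>

lemma mexp_ode_bound:
  fixes A :: "real^'n^'n" and R F :: "real \<Rightarrow> real^'m^'n"
  assumes skew: "transpose A = - A"
    and R: "\<And>t. t \<in> {0..1} \<Longrightarrow> (R has_vector_derivative (A ** R t + F t)) (at t within {0..1})"
    and R0: "R 0 = 0"
    and F: "\<And>t. t \<in> {0..1} \<Longrightarrow> norm (F t) \<le> K"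
    and t: "t \<in> {0..1}"
  shows "norm (R t) \<le> K * t"
proof -
  let ?G = "\<lambda>t. transpose (mexp (t *\<^sub>R A)) ** R t"
  have "norm (?G t - ?G 0) \<le> K * t - K * 0"
  proof (rule norm_le_of_vector_derivative_le[OF _ _ _ t])
    fix s :: real assume s: "s \<in> {0..1}"
    show "(?G has_vector_derivative transpose (mexp (s *\<^sub>R A)) ** F s) (at s within {0..1})"
      by (rule derivative_eq_intros has_vector_derivative_mexp R s refl)+
         (simp add: matrix_ring_simps skew matrix_mul_assoc)
    show "((\<lambda>t. K * t) has_vector_derivative K) (at s within {0..1})"
      by (auto intro!: derivative_eq_intros)
    show "norm (transpose (mexp (s *\<^sub>R A)) ** F s) \<le> K"
      using F[OF s] by (simp add: norm_orthogonal_mult_left orthogonal_mexp_scaleR skew)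
  qed
  then show ?thesis
    by (simp add: R0 norm_orthogonal_mult_left orthogonal_mexp_scaleR skew)
qed

section \<open>First and second variation of the exponential\<close>

definition mexp_conj :: "real^'n^'n \<Rightarrow> real^'n^'n \<Rightarrow> real \<Rightarrow> real^'n^'n" where
  "mexp_conj A B t = transpose (mexp (t *\<^sub>R A)) ** B ** mexp (t *\<^sub>R A)"

definition dmexp_frame :: "real^'n^'n \<Rightarrow> real^'n^'n \<Rightarrow> real \<Rightarrow> real^'n^'n" where
  "dmexp_frame A B t = integral {0..t} (mexp_conj A B)"

definition d2mexp_frame :: "real^'n^'n \<Rightarrow> real^'n^'n \<Rightarrow> real^'n^'n \<Rightarrow> real \<Rightarrow> real^'n^'n" where
  "d2mexp_frame A B C t =
     integral {0..t} (\<lambda>s. mexp_conj A B s ** dmexp_frame A C s + mexp_conj A C s ** dmexp_frame A B s)"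

text \<open>Differentiating \<open>X' = A ** X\<close> formally with respect to \<open>A\<close>, in
  directions \<open>B\<close> and \<open>C\<close>, yields linear inhomogeneous equations, and
  variation of constants solves them by \<open>dmexp\<close> and \<open>d2mexp\<close>. Here
  \<open>mexp_conj A B\<close> is \<open>V\<^sub>B\<close> and \<open>dmexp_frame A B\<close> is
  \<open>N\<^sub>B\<close>. That these are true derivatives follows from the remainder bounds
  below.\<close>

definition dmexp :: "real^'n^'n \<Rightarrow> real^'n^'n \<Rightarrow> real \<Rightarrow> real^'n^'n" where
  "dmexp A B t = mexp (t *\<^sub>R A) ** dmexp_frame A B t"

definition d2mexp :: "real^'n^'n \<Rightarrow> real^'n^'n \<Rightarrow> real^'n^'n \<Rightarrow> real \<Rightarrow> real^'n^'n" where
  "d2mexp A B C t = mexp (t *\<^sub>R A) ** d2mexp_frame A B C t"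

lemma has_vector_derivative_mexp_conj:
  fixes A :: "real^'n^'n"
  assumes "transpose A = - A"
  shows "(mexp_conj A B has_vector_derivative mexp_conj A (B ** A - A ** B) t) (at t within S)"
  unfolding mexp_conj_def[abs_def]
  by (rule derivative_eq_intros has_vector_derivative_mexp refl)+
     (simp add: matrix_ring_simps assms matrix_mul_assoc)

lemma has_vector_derivative_dmexp_frame:
  fixes A :: "real^'n^'n"
  assumes "transpose A = - A" "t \<in> {0..1}"
  shows "(dmexp_frame A B has_vector_derivative mexp_conj A B t) (at t within {0..1})"
  unfolding dmexp_frame_def[abs_def]
  by (rule integral_has_vector_derivative[OF continuous_on_vector_derivative assms(2)])
     (rule has_vector_derivative_mexp_conj[OF assms(1)])

lemma has_vector_derivative_d2mexp_frame:
  fixes A :: "real^'n^'n"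
  assumes "transpose A = - A" "t \<in> {0..1}"
  shows "(d2mexp_frame A B C has_vector_derivative
      mexp_conj A B t ** dmexp_frame A C t + mexp_conj A C t ** dmexp_frame A B t) (at t within {0..1})"
  unfolding d2mexp_frame_def[abs_def]
  by (rule integral_has_vector_derivative[OF continuous_on_vector_derivative assms(2)])
     (rule derivative_eq_intros has_vector_derivative_mexp_conj has_vector_derivative_dmexp_frame
        assms refl | assumption)+

lemma dmexp_frame_0 [simp]: "dmexp_frame A B 0 = 0"
  and d2mexp_frame_0 [simp]: "d2mexp_frame A B C 0 = 0"
  and dmexp_0 [simp]: "dmexp A B 0 = 0"
  and d2mexp_0 [simp]: "d2mexp A B C 0 = 0"
  by (simp_all add: dmexp_frame_def d2mexp_frame_def dmexp_def d2mexp_def)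

lemma has_vector_derivative_dmexp:
  fixes A :: "real^'n^'n"
  assumes "transpose A = - A" "t \<in> {0..1}"
  shows "(dmexp A B has_vector_derivative A ** dmexp A B t + B ** mexp (t *\<^sub>R A)) (at t within {0..1})"
  unfolding dmexp_def[abs_def]
  by (rule derivative_eq_intros has_vector_derivative_mexp has_vector_derivative_dmexp_frame assms refl)+
     (simp add: mexp_conj_def orthogonal_cancel orthogonal_mexp_scaleR assms flip: matrix_mul_assoc)

lemma has_vector_derivative_d2mexp:
  fixes A :: "real^'n^'n"
  assumes "transpose A = - A" "t \<in> {0..1}"
  shows "(d2mexp A B C has_vector_derivative A ** d2mexp A B C t + (B ** dmexp A C t + C ** dmexp A B t))
    (at t within {0..1})"
  unfolding d2mexp_def[abs_def] dmexp_def
  by (rule derivative_eq_intros has_vector_derivative_mexp has_vector_derivative_d2mexp_frame assms refl)+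
     (simp add: mexp_conj_def orthogonal_cancel orthogonal_mexp_scaleR assms matmul.add_right
        flip: matrix_mul_assoc)

lemma mexp_conj_scaleR: "mexp_conj A (s *\<^sub>R B) t = s *\<^sub>R mexp_conj A B t"
  by (simp add: mexp_conj_def matrix_ring_simps)

lemma dmexp_frame_scaleR: "dmexp_frame A (s *\<^sub>R B) t = s *\<^sub>R dmexp_frame A B t"
  by (simp add: dmexp_frame_def mexp_conj_scaleR[abs_def])

lemma d2mexp_frame_scaleR: "d2mexp_frame A (s *\<^sub>R B) C t = s *\<^sub>R d2mexp_frame A B C t"
  unfolding d2mexp_frame_def integral_cmul[symmetric]
  by (simp add: mexp_conj_scaleR dmexp_frame_scaleR matrix_ring_simps scaleR_add_right)

text \<open>This and the next four estimates are instances of \<open>mexp_ode_bound\<close>: each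
  quantity vanishes at time 0 and solves the equation with a forcing term that is controlled by
  orthogonality or by an earlier estimate of the group.\<close>

lemma norm_dmexp_le:
  fixes A B :: "real^'n^'n"
  assumes skew: "transpose A = - A" and t: "t \<in> {0..1}"
  shows "norm (dmexp A B t) \<le> norm B * t"
  by (rule mexp_ode_bound[OF skew has_vector_derivative_dmexp[OF skew] _ _ t])
     (simp_all add: norm_orthogonal_mult_right orthogonal_mexp_scaleR skew)

lemma norm_mexp_diff_le:
  fixes A B :: "real^'n^'n"
  assumes skew: "transpose A = - A" "transpose B = - B" and t: "t \<in> {0..1}"
  shows "norm (mexp (t *\<^sub>R (A + B)) - mexp (t *\<^sub>R A)) \<le> norm B * t"
proof (rule mexp_ode_bound[OF skew(1) _ _ _ t, where F = "\<lambda>t. B ** mexp (t *\<^sub>R (A + B))"])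
  show "((\<lambda>t. mexp (t *\<^sub>R (A + B)) - mexp (t *\<^sub>R A)) has_vector_derivative
        A ** (mexp (s *\<^sub>R (A + B)) - mexp (s *\<^sub>R A)) + B ** mexp (s *\<^sub>R (A + B))) (at s within {0..1})" for s
    by (rule derivative_eq_intros has_vector_derivative_mexp refl)+ (simp add: matrix_ring_simps)
  show "norm (B ** mexp (s *\<^sub>R (A + B))) \<le> norm B" for s
    by (subst norm_orthogonal_mult_right) (auto intro!: orthogonal_mexp_scaleR simp: transp_simps skew)
qed simp

lemma norm_mexp_taylor_le:
  fixes A B :: "real^'n^'n"
  assumes skew: "transpose A = - A" "transpose B = - B" and t: "t \<in> {0..1}"
  shows "norm (mexp (t *\<^sub>R (A + B)) - mexp (t *\<^sub>R A) - dmexp A B t) \<le> (norm B)\<^sup>2 * t"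
proof (rule mexp_ode_bound[OF skew(1) _ _ _ t,
      where F = "\<lambda>t. B ** (mexp (t *\<^sub>R (A + B)) - mexp (t *\<^sub>R A))"])
  fix s :: real assume s: "s \<in> {0..1}"
  show "((\<lambda>t. mexp (t *\<^sub>R (A + B)) - mexp (t *\<^sub>R A) - dmexp A B t) has_vector_derivative
        A ** (mexp (s *\<^sub>R (A + B)) - mexp (s *\<^sub>R A) - dmexp A B s)
        + B ** (mexp (s *\<^sub>R (A + B)) - mexp (s *\<^sub>R A))) (at s within {0..1})"
    by (rule derivative_eq_intros has_vector_derivative_mexp has_vector_derivative_dmexp skew s refl)+
       (simp add: matrix_ring_simps)
  have "norm (B ** (mexp (s *\<^sub>R (A + B)) - mexp (s *\<^sub>R A))) \<le> norm B * (norm B * s)"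
    by (rule order_trans[OF norm_matrix_mult mult_left_mono[OF norm_mexp_diff_le]]) (use skew s in auto)
  also have "\<dots> \<le> norm B * (norm B * 1)" using s by (intro mult_left_mono) auto
  finally show "norm (B ** (mexp (s *\<^sub>R (A + B)) - mexp (s *\<^sub>R A))) \<le> (norm B)\<^sup>2"
    by (simp add: power2_eq_square)
qed simp

text \<open>The constant 2 counts the two forcing terms: \<open>A\<close> enters both the
  homogeneous part and the source \<open>C ** mexp (t *\<^sub>R A)\<close> of the equation for
  \<open>dmexp\<close>.\<close>

lemma norm_dmexp_diff_le:
  fixes A B C :: "real^'n^'n"
  assumes skew: "transpose A = - A" "transpose B = - B" "transpose C = - C" and t: "t \<in> {0..1}"
  shows "norm (dmexp (A + B) C t - dmexp A C t) \<le> (2 * norm B * norm C) * t"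
proof (rule mexp_ode_bound[OF skew(1) _ _ _ t,
      where F = "\<lambda>t. B ** dmexp (A + B) C t + C ** (mexp (t *\<^sub>R (A + B)) - mexp (t *\<^sub>R A))"])
  have skew': "transpose (A + B) = - (A + B)" by (simp add: transp_simps skew)
  fix s :: real assume s: "s \<in> {0..1}"
  show "((\<lambda>t. dmexp (A + B) C t - dmexp A C t) has_vector_derivative
        A ** (dmexp (A + B) C s - dmexp A C s)
        + (B ** dmexp (A + B) C s + C ** (mexp (s *\<^sub>R (A + B)) - mexp (s *\<^sub>R A)))) (at s within {0..1})"
    by (rule derivative_eq_intros has_vector_derivative_dmexp skew skew' s refl)+
       (simp add: matrix_ring_simps)
  have "norm (B ** dmexp (A + B) C s) \<le> norm B * (norm C * s)"
    by (rule order_trans[OF norm_matrix_mult mult_left_mono[OF norm_dmexp_le]]) (use skew skew' s in auto)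
  moreover have "norm (C ** (mexp (s *\<^sub>R (A + B)) - mexp (s *\<^sub>R A))) \<le> norm C * (norm B * s)"
    by (rule order_trans[OF norm_matrix_mult mult_left_mono[OF norm_mexp_diff_le]]) (use skew s in auto)
  moreover have "norm B * (norm C * s) \<le> norm B * (norm C * 1)" using s by (intro mult_left_mono) auto
  ultimately show "norm (B ** dmexp (A + B) C s + C ** (mexp (s *\<^sub>R (A + B)) - mexp (s *\<^sub>R A)))
      \<le> 2 * norm B * norm C"
    by (intro norm_triangle_le) (simp add: mult_ac)
qed simp

text \<open>The constant 3 is 2 from \<open>norm_dmexp_diff_le\<close> plus 1 from
  \<open>norm_mexp_taylor_le\<close>, one for each forcing term.\<close>

lemma norm_dmexp_taylor_le:
  fixes A B C :: "real^'n^'n"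
  assumes skew: "transpose A = - A" "transpose B = - B" "transpose C = - C" and t: "t \<in> {0..1}"
  shows "norm (dmexp (A + B) C t - dmexp A C t - d2mexp A B C t) \<le> (3 * (norm B)\<^sup>2 * norm C) * t"
proof (rule mexp_ode_bound[OF skew(1) _ _ _ t,
      where F = "\<lambda>t. B ** (dmexp (A + B) C t - dmexp A C t)
        + C ** (mexp (t *\<^sub>R (A + B)) - mexp (t *\<^sub>R A) - dmexp A B t)"])
  have skew': "transpose (A + B) = - (A + B)" by (simp add: transp_simps skew)
  fix s :: real assume s: "s \<in> {0..1}"
  show "((\<lambda>t. dmexp (A + B) C t - dmexp A C t - d2mexp A B C t) has_vector_derivative
        A ** (dmexp (A + B) C s - dmexp A C s - d2mexp A B C s)
        + (B ** (dmexp (A + B) C s - dmexp A C s)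
           + C ** (mexp (s *\<^sub>R (A + B)) - mexp (s *\<^sub>R A) - dmexp A B s))) (at s within {0..1})"
    by (rule derivative_eq_intros has_vector_derivative_dmexp has_vector_derivative_d2mexp skew skew' s refl)+
       (simp add: matrix_ring_simps)
  have "norm (B ** (dmexp (A + B) C s - dmexp A C s)) \<le> norm B * ((2 * norm B * norm C) * s)"
    by (rule order_trans[OF norm_matrix_mult mult_left_mono[OF norm_dmexp_diff_le]]) (use skew s in auto)
  moreover have "norm (C ** (mexp (s *\<^sub>R (A + B)) - mexp (s *\<^sub>R A) - dmexp A B s)) \<le> norm C * ((norm B)\<^sup>2 * s)"
    by (rule order_trans[OF norm_matrix_mult mult_left_mono[OF norm_mexp_taylor_le]]) (use skew s in auto)
  moreover have "norm B * norm B * norm C * s \<le> norm B * norm B * norm C * 1"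
    using s by (intro mult_left_mono) auto
  ultimately show "norm (B ** (dmexp (A + B) C s - dmexp A C s)
      + C ** (mexp (s *\<^sub>R (A + B)) - mexp (s *\<^sub>R A) - dmexp A B s)) \<le> 3 * (norm B)\<^sup>2 * norm C"
    by (intro norm_triangle_le) (simp add: mult_ac power2_eq_square)
qed simp

lemma has_vector_derivative_quadratic_error:
  fixes f :: "real \<Rightarrow> 'a::real_normed_vector"
  assumes "\<And>s. norm (f s - f 0 - s *\<^sub>R v) \<le> K * s\<^sup>2"
  shows "(f has_vector_derivative v) (at 0)"
  unfolding has_vector_derivative_def has_derivative_iff_norm
proof (intro conjI bounded_linear_scaleR_left)
  have lim: "((\<lambda>s. K * \<bar>s\<bar>) \<longlongrightarrow> 0) (at 0)"
    using tendsto_mult[OF tendsto_const[of K] tendsto_rabs[OF tendsto_ident_at[of 0 UNIV]]] by simp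
  show "((\<lambda>s. norm (f s - f 0 - (s - 0) *\<^sub>R v) / norm (s - 0)) \<longlongrightarrow> 0) (at 0)"
  proof (rule Lim_null_comparison[OF always_eventually lim], rule allI)
    fix s :: real
    have "norm (f s - f 0 - s *\<^sub>R v) \<le> K * \<bar>s\<bar> * \<bar>s\<bar>"
      using assms[of s] by (simp add: power2_eq_square mult.assoc)
    then show "norm (norm (f s - f 0 - (s - 0) *\<^sub>R v) / norm (s - 0)) \<le> K * \<bar>s\<bar>"
      using assms[of 1] by (cases "s = 0") (auto simp: divide_le_eq)
  qed
qed

text \<open>Take the Taylor bound at time 1 with \<open>s *\<^sub>R B\<close> in place of
  \<open>B\<close>: \<open>dmexp\<close> is homogeneous in its direction, and the remainder is
  quadratic in \<open>s\<close>.\<close>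

lemma has_vector_derivative_mexp_line:
  fixes A B :: "real^'n^'n"
  assumes skew: "transpose A = - A" "transpose B = - B"
  shows "((\<lambda>s. mexp (A + s *\<^sub>R B)) has_vector_derivative dmexp A B 1) (at 0)"
proof (rule has_vector_derivative_quadratic_error)
  fix s
  have "transpose (s *\<^sub>R B) = - (s *\<^sub>R B)" by (simp add: transp_simps skew)
  from norm_mexp_taylor_le[OF skew(1) this, of 1]
  show "norm (mexp (A + s *\<^sub>R B) - mexp (A + 0 *\<^sub>R B) - s *\<^sub>R dmexp A B 1) \<le> (norm B)\<^sup>2 * s\<^sup>2"
    by (simp add: dmexp_def dmexp_frame_scaleR matmul.scaleR_right power_mult_distrib mult.commute)
qed

lemma has_vector_derivative_dmexp_line:
  fixes A B C :: "real^'n^'n"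
  assumes skew: "transpose A = - A" "transpose B = - B" "transpose C = - C"
  shows "((\<lambda>s. dmexp (A + s *\<^sub>R B) C 1) has_vector_derivative d2mexp A B C 1) (at 0)"
proof (rule has_vector_derivative_quadratic_error)
  fix s
  have "transpose (s *\<^sub>R B) = - (s *\<^sub>R B)" by (simp add: transp_simps skew)
  from norm_dmexp_taylor_le[OF skew(1) this skew(3), of 1]
  show "norm (dmexp (A + s *\<^sub>R B) C 1 - dmexp (A + 0 *\<^sub>R B) C 1 - s *\<^sub>R d2mexp A B C 1)
      \<le> (3 * (norm B)\<^sup>2 * norm C) * s\<^sup>2"
    by (simp add: d2mexp_def d2mexp_frame_scaleR matmul.scaleR_right power_mult_distrib mult_ac)
qed

section \<open>The skew part of the second variation\<close>

lemma transpose_mexp_conj: "transpose B = - B \<Longrightarrow> transpose (mexp_conj A B t) = - mexp_conj A B t"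
  by (simp add: mexp_conj_def matrix_ring_simps matrix_mul_assoc)

lemma transpose_dmexp_frame:
  fixes A B :: "real^'n^'n"
  assumes "transpose A = - A" "transpose B = - B" "t \<in> {0..1}"
  shows "transpose (dmexp_frame A B t) = - dmexp_frame A B t"
proof -
  have "mexp_conj A B integrable_on {0..t}"
    by (rule integrable_continuous_interval[OF continuous_on_vector_derivative])
       (rule has_vector_derivative_mexp_conj[OF assms(1)])
  then have "integral {0..t} (transpose \<circ> mexp_conj A B) = transpose (dmexp_frame A B t)"
    unfolding dmexp_frame_def by (rule integral_linear) (rule bounded_linear_transpose)
  moreover have "transpose \<circ> mexp_conj A B = (\<lambda>s. - mexp_conj A B s)"
    using assms by (auto simp: transpose_mexp_conj)
  ultimately show ?thesis by (simp add: dmexp_frame_def)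
qed

text \<open>Each of the two skew factors saves \<open>sqrt 2\<close> over
  submultiplicativity.\<close>

lemma norm_skew_skew_mult:
  fixes A B X Y :: "real^'n^'n"
  assumes "transpose A = - A" "transpose B = - B"
  shows "norm (A ** (B ** X)) \<le> norm A * norm B * norm X / 2"
    and "norm ((Y ** A) ** B) \<le> norm A * norm B * norm Y / 2"
proof -
  have two: "sqrt 2 * (sqrt 2 * x) = 2 * x" for x by (simp flip: mult.assoc)
  have "sqrt 2 * (sqrt 2 * norm (A ** (B ** X))) \<le> sqrt 2 * (norm A * norm (B ** X))"
    using assms by (intro mult_left_mono norm_skew_mult_left) auto
  also have "\<dots> = norm A * (sqrt 2 * norm (B ** X))" by simp
  also have "\<dots> \<le> norm A * (norm B * norm X)"
    using assms by (intro mult_left_mono norm_skew_mult_left) auto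
  finally show "norm (A ** (B ** X)) \<le> norm A * norm B * norm X / 2"
    unfolding two by (simp add: mult_ac)
  have "sqrt 2 * (sqrt 2 * norm ((Y ** A) ** B)) \<le> sqrt 2 * (norm (Y ** A) * norm B)"
    using assms by (intro mult_left_mono norm_skew_mult_right) auto
  also have "\<dots> = (sqrt 2 * norm (Y ** A)) * norm B" by simp
  also have "\<dots> \<le> (norm Y * norm A) * norm B"
    using assms by (intro mult_right_mono norm_skew_mult_right) auto
  finally show "norm ((Y ** A) ** B) \<le> norm A * norm B * norm Y / 2"
    unfolding two by (simp add: mult_ac)
qed

text \<open>\<open>Z\<close> is the derivative of \<open>mexp_conj A B\<close>. The commutator
  expands into four products in which \<open>A\<close> and \<open>B\<close> stand next to each
  other; each is at most half of \<open>norm A * norm B * norm N\<close>, so 2 replaces the 4 of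
  submultiplicativity.\<close>

lemma norm_commutator_mexp_conj:
  fixes A B N :: "real^'n^'n" and t :: real
  assumes skew: "transpose A = - A" "transpose B = - B"
  defines "Z \<equiv> mexp_conj A (B ** A - A ** B) t"
  shows "norm (Z ** N - N ** Z) \<le> 2 * norm A * norm B * norm N"
proof -
  let ?E = "mexp (t *\<^sub>R A)"
  have orth: "orthogonal_matrix ?E" "orthogonal_matrix (transpose ?E)"
    using orthogonal_mexp_scaleR[OF skew(1)] by simp_all
  \<comment> \<open>The orthogonal factor inside is grouped with \<open>N\<close>, so that the pair
    of skew matrices acts on a matrix with the norm of \<open>N\<close>.\<close>
  have left: "Z ** N = transpose ?E ** (B ** (A ** (?E ** N))) - transpose ?E ** (A ** (B ** (?E ** N)))"
    by (simp add: Z_def mexp_conj_def matrix_ring_simps matrix_mul_assoc)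
  have right: "N ** Z = ((N ** transpose ?E) ** B) ** A ** ?E - ((N ** transpose ?E) ** A) ** B ** ?E"
    by (simp add: Z_def mexp_conj_def matrix_ring_simps matrix_mul_assoc)
  have "norm (Z ** N) \<le> norm A * norm B * norm N"
    unfolding left
    using norm_skew_skew_mult(1)[OF skew(2) skew(1), of "?E ** N"] norm_skew_skew_mult(1)[OF skew, of "?E ** N"]
    by (intro norm_triangle_le_diff) (simp add: norm_orthogonal_mult_left orth mult_ac)
  moreover have "norm (N ** Z) \<le> norm A * norm B * norm N"
    unfolding right
    using norm_skew_skew_mult(2)[OF skew(2) skew(1), of "N ** transpose ?E"]
      norm_skew_skew_mult(2)[OF skew, of "N ** transpose ?E"]
    by (intro norm_triangle_le_diff) (simp add: norm_orthogonal_mult_right orth mult_ac)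
  ultimately show ?thesis by (intro norm_triangle_le_diff) simp
qed

text \<open>In the frame transported along \<open>t \<mapsto> exp (t A)\<close> the Hessian of the exponential map is the
  skew part of the second derivative. Its derivative is the sum \<open>K\<close> of two commutators below; the
  derivative of \<open>K\<close> loses the terms without \<open>A\<close>, which leaves curvature terms of size \<open>O(t)\<close>.\<close>

lemma norm_skew_part_d2mexp_frame_le:
  fixes A B C :: "real^'n^'n"
  assumes skew: "transpose A = - A" "transpose B = - B" "transpose C = - C"
  shows "norm (d2mexp_frame A B C 1 - transpose (d2mexp_frame A B C 1)) \<le> 2 / 3 * norm A * norm B * norm C"
proof -
  let ?V = "mexp_conj A" and ?N = "dmexp_frame A"
  let ?Z = "\<lambda>B. mexp_conj A (B ** A - A ** B)"
  define M where "M = norm A * norm B * norm C"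
  define K where "K t = (?V B t ** ?N C t - ?N C t ** ?V B t) + (?V C t ** ?N B t - ?N B t ** ?V C t)" for t
  note hvd = derivative_eq_intros has_vector_derivative_mexp_conj has_vector_derivative_dmexp_frame
    has_vector_derivative_d2mexp_frame skew
  have N: "norm (?N B t) \<le> norm B * t" if "t \<in> {0..1}" for B t
    using norm_dmexp_le[OF skew(1) that, of B]
    by (simp add: dmexp_def norm_orthogonal_mult_left orthogonal_mexp_scaleR skew)
  have K: "norm (K t) \<le> 2 * M * t\<^sup>2" if t: "t \<in> {0..1}" for t
  proof -
    have "norm (K t - K 0) \<le> 2 * M * t\<^sup>2 - 2 * M * 0\<^sup>2"
    proof (rule norm_le_of_vector_derivative_le[OF _ _ _ t])
      fix s :: real assume s: "s \<in> {0..1}"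
      \<comment> \<open>The products of \<open>?V B s\<close> with \<open>?V C s\<close> cancel
        between the two commutators; only terms containing a derivative \<open>?Z\<close>
        survive.\<close>
      show "(K has_vector_derivative (?Z B s ** ?N C s - ?N C s ** ?Z B s) + (?Z C s ** ?N B s - ?N B s ** ?Z C s))
          (at s within {0..1})"
        unfolding K_def[abs_def]
        by (rule hvd s refl)+ simp
      show "((\<lambda>t. 2 * M * t\<^sup>2) has_vector_derivative 4 * M * s) (at s within {0..1})"
        unfolding has_real_derivative_iff_has_vector_derivative[symmetric]
        by (auto intro!: derivative_eq_intros)
      have "norm (?Z B s ** ?N C s - ?N C s ** ?Z B s) \<le> 2 * norm A * norm B * (norm C * s)"
        by (rule order_trans[OF norm_commutator_mexp_conj[OF skew(1,2)] mult_left_mono[OF N[OF s]]]) simp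
      moreover have "norm (?Z C s ** ?N B s - ?N B s ** ?Z C s) \<le> 2 * norm A * norm C * (norm B * s)"
        by (rule order_trans[OF norm_commutator_mexp_conj[OF skew(1,3)] mult_left_mono[OF N[OF s]]]) simp
      ultimately show "norm ((?Z B s ** ?N C s - ?N C s ** ?Z B s) + (?Z C s ** ?N B s - ?N B s ** ?Z C s)) \<le> 4 * M * s"
        by (intro norm_triangle_le) (simp add: M_def mult_ac)
    qed
    then show ?thesis by (simp add: K_def)
  qed
  let ?D = "\<lambda>t. d2mexp_frame A B C t - transpose (d2mexp_frame A B C t)"
  have "norm (?D 1 - ?D 0) \<le> 2 / 3 * M * 1 ^ 3 - 2 / 3 * M * 0 ^ 3"
  proof (rule norm_le_of_vector_derivative_le)
    fix s :: real assume s: "s \<in> {0..1}"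
    \<comment> \<open>Both factors of \<open>V\<^sub>B N\<^sub>C\<close> are skew, so its transpose
      is \<open>N\<^sub>C V\<^sub>B\<close>, and subtracting transposes turns products into
      commutators.\<close>
    show "(?D has_vector_derivative K s) (at s within {0..1})"
      by (rule hvd s refl)+
         (use s in \<open>simp add: K_def matrix_ring_simps transpose_mexp_conj transpose_dmexp_frame skew\<close>)
    show "((\<lambda>t. 2 / 3 * M * t ^ 3) has_vector_derivative 2 * M * s\<^sup>2) (at s within {0..1})"
      unfolding has_real_derivative_iff_has_vector_derivative[symmetric]
      by (auto intro!: derivative_eq_intros simp: power2_eq_square)
  qed (use K in auto)
  then show ?thesis by (simp add: transp_simps M_def mult_ac)
qed

section \<open>The embedding of the Grassmannian into the symmetric involutions\<close>

definition block_sign :: "'k + 'l \<Rightarrow> real" where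
  "block_sign i = (case i of Inl _ \<Rightarrow> 1 | Inr _ \<Rightarrow> - 1)"

definition refl0 :: "('k::finite, 'l::finite) mat" where
  "refl0 = (\<chi> i j. if i = j then block_sign i else 0)"

definition reflect :: "('k::finite, 'l::finite) mat \<Rightarrow> ('k, 'l) mat" where
  "reflect g = g ** refl0 ** transpose g"

definition blockl :: "('k::finite, 'l::finite) mat \<Rightarrow> real^'k^'k" where
  "blockl X = (\<chi> a b. X $ Inl a $ Inl b)"

definition blockr :: "('k::finite, 'l::finite) mat \<Rightarrow> real^'l^'l" where
  "blockr X = (\<chi> a b. X $ Inr a $ Inr b)"

lemma block_sign_simps [simp]: "block_sign (Inl a) = 1" "block_sign (Inr b) = - 1"
  "block_sign i * block_sign i = 1"
  by (auto simp: block_sign_def split: sum.split)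

lemma sum_UNIV_Plus: "(\<Sum>i\<in>UNIV. f i) = (\<Sum>a\<in>UNIV. f (Inl a)) + (\<Sum>b\<in>UNIV. f (Inr b))"
  for f :: "'k::finite + 'l::finite \<Rightarrow> 'a::comm_monoid_add"
  by (subst UNIV_Plus_UNIV[symmetric], subst sum.Plus) simp_all

lemma all_Plus: "(\<forall>i. P i) \<longleftrightarrow> (\<forall>a. P (Inl a)) \<and> (\<forall>b. P (Inr b))"
  by (metis sum.exhaust)

lemma refl0_nth: "refl0 $ i $ j = (if i = j then block_sign i else 0)"
  by (simp add: refl0_def)

lemma refl0_mult_nth: "(refl0 ** X) $ i $ j = block_sign i * X $ i $ j"
  by (simp add: refl0_def matrix_matrix_mult_def if_distrib[of "\<lambda>x. x * _"] sum.delta cong: if_cong)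

lemma mult_refl0_nth: "(X ** refl0) $ i $ j = X $ i $ j * block_sign j"
  by (simp add: refl0_def matrix_matrix_mult_def if_distrib[of "\<lambda>x. _ * x"] sum.delta cong: if_cong)

lemma refl0_refl0: "refl0 ** refl0 = mat 1"
  by (auto simp: vec_eq_iff refl0_mult_nth refl0_nth mat_def)

lemma refl0_cancel: "refl0 ** (refl0 ** X) = X" "(X ** refl0) ** refl0 = X"
  by (simp_all add: matrix_mul_assoc refl0_refl0) (simp add: refl0_refl0 flip: matrix_mul_assoc)

lemma transpose_refl0: "transpose refl0 = refl0"
  by (auto simp: vec_eq_iff refl0_def transpose_def)

lemma block_diag_mult: "block_diag A B ** block_diag C D = block_diag (A ** C) (B ** D)"
  by (simp add: vec_eq_iff all_Plus block_diag_def matrix_matrix_mult_def sum_UNIV_Plus)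

lemma transpose_block_diag: "transpose (block_diag A B) = block_diag (transpose A) (transpose B)"
  by (simp add: vec_eq_iff all_Plus block_diag_def transpose_def)

lemma block_diag_mat_1: "block_diag (mat 1) (mat 1) = mat 1"
  by (simp add: vec_eq_iff all_Plus block_diag_def mat_def)

lemma blocks_block_diag [simp]: "blockl (block_diag A B) = A" "blockr (block_diag A B) = B"
  by (simp_all add: vec_eq_iff block_diag_def blockl_def blockr_def)

lemma block_diag_eq_iff: "block_diag A B = block_diag C D \<longleftrightarrow> A = C \<and> B = D"
  by (metis blocks_block_diag)

lemma refl0_conj_block_diag: "refl0 ** block_diag A B ** refl0 = block_diag A B"
  by (simp add: vec_eq_iff all_Plus refl0_mult_nth mult_refl0_nth block_diag_def)

text \<open>Conjugation by \<open>refl0\<close> changes the sign of the off-diagonal entries, so an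
  invariant matrix has none.\<close>

lemma block_diag_blocks:
  assumes "refl0 ** X ** refl0 = X"
  shows "block_diag (blockl X) (blockr X) = X"
proof -
  have "block_sign i * X $ i $ j * block_sign j = X $ i $ j" for i j
    using assms by (simp add: vec_eq_iff refl0_mult_nth mult_refl0_nth)
  then have "X $ Inl a $ Inr b = 0" "X $ Inr b $ Inl a = 0" for a b
    by (metis block_sign_simps(1,2) mult.right_neutral mult_1 mult_minus1 mult_minus1_right
        neg_equal_zero)+
  then show ?thesis
    by (simp add: vec_eq_iff all_Plus block_diag_def blockl_def blockr_def)
qed

lemma orthogonal_block_diag:
  "orthogonal_matrix (block_diag A B) \<longleftrightarrow> orthogonal_matrix A \<and> orthogonal_matrix B"
  by (simp add: orthogonal_matrix transpose_block_diag block_diag_mult block_diag_eq_iff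
      flip: block_diag_mat_1)

section \<open>The isotropy group and its cosets\<close>

lemma rotation_matrix_mult: "rotation_matrix A \<Longrightarrow> rotation_matrix B \<Longrightarrow> rotation_matrix (A ** B)"
  for A B :: "real^'n^'n"
  by (simp add: rotation_matrix_def orthogonal_matrix_mul det_mul)

lemma rotation_matrix_transpose: "rotation_matrix (transpose A) \<longleftrightarrow> rotation_matrix A"
  for A :: "real^'n^'n"
  by (simp add: rotation_matrix_def det_transpose)

lemma mat_1_in_isotropy_group: "mat 1 \<in> isotropy_group"
  unfolding isotropy_group_def
  by (auto intro!: exI[of _ "mat 1"] simp: block_diag_mat_1 rotation_matrix_def orthogonal_matrix_id)

lemma isotropy_group_mult: "R \<in> isotropy_group \<Longrightarrow> S \<in> isotropy_group \<Longrightarrow> R ** S \<in> isotropy_group"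
  unfolding isotropy_group_def by (auto simp: block_diag_mult block_diag_eq_iff intro!: rotation_matrix_mult)

lemma isotropy_group_transpose: "R \<in> isotropy_group \<Longrightarrow> transpose R \<in> isotropy_group"
  unfolding isotropy_group_def
  by (auto simp: transpose_block_diag block_diag_eq_iff rotation_matrix_transpose)

text \<open>Separates what an involution can see, commutation with \<open>refl0\<close>, from the
  two determinant conditions, which carry the orientation.\<close>

lemma isotropy_group_iff:
  "R \<in> isotropy_group \<longleftrightarrow>
     orthogonal_matrix R \<and> refl0 ** R ** refl0 = R \<and> det (blockl R) = 1 \<and> det (blockr R) = 1"
proof
  assume "R \<in> isotropy_group"
  then show "orthogonal_matrix R \<and> refl0 ** R ** refl0 = R \<and> det (blockl R) = 1 \<and> det (blockr R) = 1"
    by (auto simp: isotropy_group_def rotation_matrix_def orthogonal_block_diag refl0_conj_block_diag)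
next
  assume R: "orthogonal_matrix R \<and> refl0 ** R ** refl0 = R \<and> det (blockl R) = 1 \<and> det (blockr R) = 1"
  have "R = block_diag (blockl R) (blockr R)" using block_diag_blocks R by metis
  moreover from this have "orthogonal_matrix (blockl R) \<and> orthogonal_matrix (blockr R)"
    using R by (metis orthogonal_block_diag)
  ultimately show "R \<in> isotropy_group"
    using R unfolding isotropy_group_def rotation_matrix_def by blast
qed

lemma orthogonal_isotropy_group: "R \<in> isotropy_group \<Longrightarrow> orthogonal_matrix R"
  by (simp add: isotropy_group_iff)

lemma self_in_gr_coset: "g \<in> gr_coset g"
  unfolding gr_coset_def using mat_1_in_isotropy_group by (auto intro!: exI[of _ "mat 1"])

lemma gr_coset_mult:
  assumes "R \<in> isotropy_group"
  shows "gr_coset (g ** R) = gr_coset g"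
proof -
  have sub: "gr_coset (g ** R) \<subseteq> gr_coset g" if "R \<in> isotropy_group" for g R :: "('a, 'b) mat"
    using that isotropy_group_mult by (fastforce simp: gr_coset_def simp flip: matrix_mul_assoc)
  have "gr_coset ((g ** R) ** transpose R) \<subseteq> gr_coset (g ** R)"
    by (rule sub[OF isotropy_group_transpose[OF assms]])
  then show ?thesis
    using sub[OF assms, of g] assms by (simp add: orthogonal_cancel orthogonal_isotropy_group)
qed

lemma gr_coset_eq_iff:
  assumes "orthogonal_matrix g"
  shows "gr_coset g = gr_coset h \<longleftrightarrow> transpose g ** h \<in> isotropy_group"
proof
  assume "gr_coset g = gr_coset h"
  then have "h \<in> gr_coset g" using self_in_gr_coset by simp
  then show "transpose g ** h \<in> isotropy_group"
    using assms by (auto simp: gr_coset_def orthogonal_cancel)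
next
  assume "transpose g ** h \<in> isotropy_group"
  then have "gr_coset (g ** (transpose g ** h)) = gr_coset g" by (rule gr_coset_mult)
  then show "gr_coset g = gr_coset h" using assms by (simp add: orthogonal_cancel)
qed

section \<open>The involution attached to a coset\<close>

lemma transpose_reflect: "transpose (reflect g) = reflect g"
  by (simp add: reflect_def matrix_transpose_mul transpose_refl0 matrix_mul_assoc)

lemma reflect_mult: "reflect (g ** h) = g ** reflect h ** transpose g"
  by (simp add: reflect_def matrix_transpose_mul matrix_mul_assoc)

lemma reflect_reflect: "orthogonal_matrix g \<Longrightarrow> reflect g ** reflect g = mat 1"
  by (simp add: reflect_def orthogonal_cancel refl0_cancel flip: matrix_mul_assoc)

lemma orthogonal_reflect: "orthogonal_matrix g \<Longrightarrow> orthogonal_matrix (reflect g)"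
  by (simp add: orthogonal_matrix transpose_reflect reflect_reflect)

lemma reflect_isotropy_group:
  assumes R: "R \<in> isotropy_group"
  shows "reflect R = refl0"
proof -
  have "refl0 ** (refl0 ** R ** refl0) ** transpose R = refl0 ** R ** transpose R"
    using R by (simp add: isotropy_group_iff)
  then show ?thesis
    by (simp add: reflect_def matrix_mul_assoc refl0_refl0)
       (simp add: orthogonal_cancel orthogonal_isotropy_group[OF R] flip: matrix_mul_assoc)
qed

lemma reflect_cong_gr_coset:
  assumes "orthogonal_matrix g" "gr_coset g = gr_coset h"
  shows "reflect g = reflect h"
proof -
  have "reflect (g ** (transpose g ** h)) = g ** refl0 ** transpose g"
    using assms by (simp add: reflect_mult[of g] reflect_isotropy_group gr_coset_eq_iff)
  then show ?thesis using assms(1) by (simp add: orthogonal_cancel reflect_def)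
qed

text \<open>A partial converse to \<open>reflect_cong_gr_coset\<close>: equal involutions make the
  quotient block-diagonal, while the signs of the determinants of its blocks stay open.\<close>

lemma refl0_conj_of_reflect_eq:
  assumes "orthogonal_matrix g" "orthogonal_matrix h" "reflect g = reflect h"
  shows "refl0 ** (transpose g ** h) ** refl0 = transpose g ** h"
proof -
  have "transpose g ** (g ** refl0 ** transpose g) ** (h ** refl0)
      = transpose g ** (h ** refl0 ** transpose h) ** (h ** refl0)"
    using assms(3) by (simp add: reflect_def)
  then show ?thesis
    using assms(1,2) by (simp add: orthogonal_cancel refl0_cancel refl0_refl0 flip: matrix_mul_assoc)
qed

text \<open>Two cosets with the same reflection differ by a block-diagonal orthogonal matrix, so they
  agree if and only if two determinants, which can only take the values \<open>1\<close> and \<open>-1\<close>, are \<open>1\<close>.\<close>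

lemma eventually_gr_coset_eq_iff:
  fixes g h :: "'c \<Rightarrow> ('k::finite, 'l::finite) mat"
  assumes lim: "(g \<longlongrightarrow> a) F" "(h \<longlongrightarrow> b) F"
    and orth: "orthogonal_matrix a" "orthogonal_matrix b" "reflect a = reflect b"
    and ev: "\<forall>\<^sub>F x in F. orthogonal_matrix (g x) \<and> orthogonal_matrix (h x) \<and> reflect (g x) = reflect (h x)"
  shows "\<forall>\<^sub>F x in F. gr_coset (g x) = gr_coset (h x) \<longleftrightarrow> gr_coset a = gr_coset b"
proof -
  define T where "T x = transpose (g x) ** h x" for x
  define T0 where "T0 = transpose a ** b"
  have blocks: "orthogonal_matrix S \<and> refl0 ** S ** refl0 = S \<and>
      (det (blockl S) = 1 \<or> det (blockl S) = - 1) \<and> (det (blockr S) = 1 \<or> det (blockr S) = - 1)"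
    if "orthogonal_matrix g" "orthogonal_matrix h" "reflect g = reflect h" and S: "S = transpose g ** h"
    for g h S :: "('k, 'l) mat"
  proof -
    have o: "orthogonal_matrix S" "refl0 ** S ** refl0 = S"
      using that by (simp_all add: orthogonal_matrix_mul refl0_conj_of_reflect_eq)
    then have "orthogonal_matrix (blockl S) \<and> orthogonal_matrix (blockr S)"
      by (metis orthogonal_block_diag block_diag_blocks)
    with o show ?thesis by (simp add: det_orthogonal_matrix)
  qed
  have T: "(T \<longlongrightarrow> T0) F"
    unfolding T_def T0_def
    by (intro matmul.tendsto bounded_linear.tendsto[OF bounded_linear_transpose] lim)
  have evT: "\<forall>\<^sub>F x in F. orthogonal_matrix (T x) \<and> refl0 ** T x ** refl0 = T x \<and>
      (det (blockl (T x)) = 1 \<or> det (blockl (T x)) = - 1) \<and> (det (blockr (T x)) = 1 \<or> det (blockr (T x)) = - 1)"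
    using ev by (rule eventually_mono) (rule blocks, auto simp: T_def)
  have T0: "orthogonal_matrix T0 \<and> refl0 ** T0 ** refl0 = T0 \<and>
      (det (blockl T0) = 1 \<or> det (blockl T0) = - 1) \<and> (det (blockr T0) = 1 \<or> det (blockr T0) = - 1)"
    by (rule blocks[OF orth T0_def])
  have "\<forall>\<^sub>F x in F. det (blockl (T x)) = det (blockl T0)"
  proof (rule eventually_sign_eq)
    show "((\<lambda>x. det (blockl (T x))) \<longlongrightarrow> det (blockl T0)) F"
      unfolding blockl_def by (intro tendsto_det vec_tendstoI) (auto intro!: tendsto_vec_nth T)
    show "\<forall>\<^sub>F x in F. det (blockl (T x)) = 1 \<or> det (blockl (T x)) = - 1"
      using evT by eventually_elim simp
  qed (use T0 in simp)
  moreover have "\<forall>\<^sub>F x in F. det (blockr (T x)) = det (blockr T0)"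
  proof (rule eventually_sign_eq)
    show "((\<lambda>x. det (blockr (T x))) \<longlongrightarrow> det (blockr T0)) F"
      unfolding blockr_def by (intro tendsto_det vec_tendstoI) (auto intro!: tendsto_vec_nth T)
    show "\<forall>\<^sub>F x in F. det (blockr (T x)) = 1 \<or> det (blockr (T x)) = - 1"
      using evT by eventually_elim simp
  qed (use T0 in simp)
  ultimately show ?thesis
    using ev evT
  proof eventually_elim
    case (elim x)
    then show ?case
      using T0 orth by (simp add: gr_coset_eq_iff isotropy_group_iff flip: T_def T0_def)
  qed
qed

section \<open>Horizontal matrices\<close>

lemma so_inner_eq: "so_inner X Y = (X \<bullet> Y) / 2"
  by (simp add: so_inner_def inner_matrix_trace)

lemma isotropy_algebra_iff: "Z \<in> isotropy_algebra \<longleftrightarrow> transpose Z = - Z \<and> refl0 ** Z ** refl0 = Z"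
proof
  have "- block_diag A B = block_diag (- A) (- B)" for A :: "real^'a^'a" and B :: "real^'b^'b"
    by (simp add: vec_eq_iff all_Plus block_diag_def)
  then have *: "transpose (block_diag A B) = - block_diag A B \<longleftrightarrow> transpose A = - A \<and> transpose B = - B"
    for A :: "real^'a^'a" and B :: "real^'b^'b"
    by (simp add: transpose_block_diag block_diag_eq_iff)
  show "Z \<in> isotropy_algebra \<Longrightarrow> transpose Z = - Z \<and> refl0 ** Z ** refl0 = Z"
    by (auto simp: isotropy_algebra_def * refl0_conj_block_diag)
  assume Z: "transpose Z = - Z \<and> refl0 ** Z ** refl0 = Z"
  then obtain A B where "Z = block_diag A B" by (metis block_diag_blocks)
  with Z show "Z \<in> isotropy_algebra" unfolding isotropy_algebra_def using * by blast
qed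

lemma inner_refl0_conj: "(refl0 ** X ** refl0) \<bullet> Y = X \<bullet> (refl0 ** Y ** refl0)"
  unfolding inner_vec_def
  by (simp add: refl0_mult_nth mult_refl0_nth mult_ac)

text \<open>Conjugation by \<open>refl0\<close> is the Cartan involution. It is self-adjoint, and
  the isotropy algebra is its fixed space among skew matrices, so the orthogonal complement is the
  eigenspace of -1.\<close>

lemma horizontal_eq:
  assumes skew: "transpose X = - X"
  shows "horizontal X = (1/2) *\<^sub>R (X - refl0 ** X ** refl0)"
  unfolding horizontal_def
proof (rule the_equality)
  let ?Y = "(1/2) *\<^sub>R (X - refl0 ** X ** refl0)"
  have c: "refl0 ** (refl0 ** X ** refl0) ** refl0 = X"
    by (simp add: matrix_mul_assoc refl0_refl0) (simp add: refl0_refl0 flip: matrix_mul_assoc)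
  have d: "X - ?Y = (1/2) *\<^sub>R (X + refl0 ** X ** refl0)"
    by (simp add: vec_eq_iff field_simps)
  have in_alg: "X - ?Y \<in> isotropy_algebra"
    unfolding d isotropy_algebra_iff
  proof
    have t: "transpose (refl0 ** X ** refl0) = - (refl0 ** X ** refl0)"
      by (simp only: matrix_transpose_mul transpose_refl0 skew matmul.minus_left matmul.minus_right matrix_mul_assoc)
    show "transpose ((1/2) *\<^sub>R (X + refl0 ** X ** refl0)) = - ((1/2) *\<^sub>R (X + refl0 ** X ** refl0))"
      by (simp only: transp_simps t skew minus_add_distrib scaleR_minus_right flip: minus_add_distrib)
    show "refl0 ** ((1/2) *\<^sub>R (X + refl0 ** X ** refl0)) ** refl0 = (1/2) *\<^sub>R (X + refl0 ** X ** refl0)"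
      by (simp only: matmul.scaleR_right matmul.scaleR_left matmul.add_right matmul.add_left c add.commute)
  qed
  moreover have orth: "so_inner ?Y Z = 0" if "Z \<in> isotropy_algebra" for Z
    using that by (simp add: so_inner_eq inner_diff_left inner_refl0_conj isotropy_algebra_iff)
  ultimately show "X - ?Y \<in> isotropy_algebra \<and> (\<forall>Z\<in>isotropy_algebra. so_inner ?Y Z = 0)" by blast
  fix Y assume Y: "X - Y \<in> isotropy_algebra \<and> (\<forall>Z\<in>isotropy_algebra. so_inner Y Z = 0)"
  \<comment> \<open>Two candidates differ by an element of the isotropy algebra that is orthogonal
    to that algebra, hence to itself.\<close>
  have "(X - Y) - (X - ?Y) \<in> isotropy_algebra"
    using Y in_alg unfolding isotropy_algebra_iff
    by (simp only: transp_simps matmul.diff_right[of refl0] matmul.diff_left[of _ _ refl0]) simp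
  then have "?Y - Y \<in> isotropy_algebra" by simp
  then have "?Y \<bullet> (?Y - Y) = 0" "Y \<bullet> (?Y - Y) = 0" using Y orth by (auto simp: so_inner_eq)
  then have "(?Y - Y) \<bullet> (?Y - Y) = 0" by (simp only: inner_diff_left)
  then show "Y = ?Y" by simp
qed

text \<open>Identifies the model space of the charts with the horizontal matrices. It supplies the
  dimension count in \<open>demb_surj\<close> and the coordinates of the Cayley charts.\<close>

definition hat :: "real^'l^'k \<Rightarrow> ('k::finite, 'l::finite) mat" where
  "hat x = (\<chi> i j. case (i, j) of (Inl a, Inr b) \<Rightarrow> x $ a $ b | (Inr b, Inl a) \<Rightarrow> - x $ a $ b | _ \<Rightarrow> 0)"

definition unhat :: "('k::finite, 'l::finite) mat \<Rightarrow> real^'l^'k" where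
  "unhat X = (\<chi> a b. X $ Inl a $ Inr b)"

lemma hat_nth [simp]:
  "hat x $ Inl a $ Inr b = x $ a $ b" "hat x $ Inr b $ Inl a = - x $ a $ b"
  "hat x $ Inl a $ Inl a' = 0" "hat x $ Inr b $ Inr b' = 0"
  by (simp_all add: hat_def)

lemma unhat_hat [simp]: "unhat (hat x) = x"
  by (simp add: vec_eq_iff unhat_def)

lemma linear_hat: "linear hat"
  by (rule linearI) (simp_all add: vec_eq_iff all_Plus)

lemma linear_unhat: "linear unhat"
  by (rule linearI) (simp_all add: vec_eq_iff unhat_def)

lemma transpose_hat: "transpose (hat x) = - hat x"
  by (simp add: vec_eq_iff all_Plus transpose_def)

lemma refl0_conj_hat: "refl0 ** hat x ** refl0 = - hat x"
proof -
  have "(refl0 ** hat x ** refl0) $ i $ j = (- hat x) $ i $ j" for i j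
    by (cases i; cases j) (simp_all add: mult_refl0_nth refl0_mult_nth)
  then show ?thesis by (simp add: vec_eq_iff)
qed

lemma hat_unhat:
  assumes "transpose X = - X" "refl0 ** X ** refl0 = - X"
  shows "hat (unhat X) = X"
proof -
  have s: "X $ Inr b $ Inl a = - X $ Inl a $ Inr b" for a b
    using arg_cong[OF assms(1), of "\<lambda>M. M $ Inl a $ Inr b"] by (simp add: transpose_def)
  have d: "block_sign i * X $ i $ j * block_sign j = - X $ i $ j" for i j
    using arg_cong[OF assms(2), of "\<lambda>M. M $ i $ j"] by (simp add: refl0_mult_nth mult_refl0_nth)
  have "X $ Inl a $ Inl a' = 0" "X $ Inr b $ Inr b' = 0" for a a' b b'
    using d[of "Inl a" "Inl a'"] d[of "Inr b" "Inr b'"] by simp_all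
  with s show ?thesis by (simp add: vec_eq_iff all_Plus unhat_def)
qed

section \<open>Calculus of \<open>C\<^sup>k\<close> maps\<close>

lemma frechet_derivative_cong_open:
  assumes "open S" "x \<in> S" "\<And>y. y \<in> S \<Longrightarrow> f y = g y"
  shows "frechet_derivative f (at x) = frechet_derivative g (at x)"
proof -
  have "(f has_derivative D) (at x) \<longleftrightarrow> (g has_derivative D) (at x)" for D
    using has_derivative_transform_within_open[OF _ assms(1,2), of f D UNIV g]
      has_derivative_transform_within_open[OF _ assms(1,2), of g D UNIV f] assms(3) by metis
  then show ?thesis by (simp add: frechet_derivative_def)
qed

lemma differentiable_cong_open:
  assumes "open S" "x \<in> S" "\<And>y. y \<in> S \<Longrightarrow> f y = g y" "f differentiable (at x)"
  shows "g differentiable (at x)"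
  using assms has_derivative_transform_within_open[OF _ assms(1,2), of f _ UNIV g]
  unfolding differentiable_def by metis

lemma Ck_on_cong:
  assumes "open S" "\<And>y. y \<in> S \<Longrightarrow> f y = g y" "Ck_on n f S"
  shows "Ck_on n g S"
  using assms(2,3)
proof (induction n arbitrary: f g)
  case 0
  then show ?case by (auto cong: continuous_on_cong)
next
  case (Suc n)
  have "Ck_on n (\<lambda>x. frechet_derivative g (at x) v) S" for v
  proof (rule Suc.IH)
    show "Ck_on n (\<lambda>x. frechet_derivative f (at x) v) S" using Suc.prems(2) by simp
  qed (simp add: frechet_derivative_cong_open[OF assms(1) _ Suc.prems(1)])
  moreover have "g differentiable (at x)" if "x \<in> S" for x
    using differentiable_cong_open[OF assms(1) that Suc.prems(1)] Suc.prems(2) that by simp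
  ultimately show ?case by simp
qed

lemma Ck_on_Suc_imp: "Ck_on (Suc n) f S \<Longrightarrow> Ck_on n f S"
proof (induction n arbitrary: f)
  case 0
  then show ?case
    by (auto intro!: continuous_at_imp_continuous_on differentiable_imp_continuous_within)
next
  case (Suc n)
  then show ?case by (metis Ck_on.simps(2))
qed

text \<open>Openness allows any known derivative formula to stand in for
  \<open>frechet_derivative\<close> on all of \<open>S\<close>.\<close>

lemma Ck_on_SucI:
  assumes "open S"
    and f: "\<And>x. x \<in> S \<Longrightarrow> (f has_derivative f' x) (at x)"
    and f': "\<And>v. Ck_on n (\<lambda>x. f' x v) S"
  shows "Ck_on (Suc n) f S"
proof -
  have "Ck_on n (\<lambda>x. frechet_derivative f (at x) v) S" for v
    by (rule Ck_on_cong[OF assms(1) _ f']) (simp add: frechet_derivative_at[OF f])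
  then show ?thesis using f by (auto simp: differentiable_def)
qed

lemma Ck_on_const: "open S \<Longrightarrow> Ck_on n (\<lambda>x. c) S"
proof (induction n arbitrary: c)
  case (Suc n)
  show ?case by (rule Ck_on_SucI[OF Suc.prems has_derivative_const Suc.IH[OF Suc.prems]])
qed simp

lemma Ck_on_has_derivative:
  "Ck_on (Suc n) f S \<Longrightarrow> x \<in> S \<Longrightarrow> (f has_derivative frechet_derivative f (at x)) (at x)"
  by (simp flip: frechet_derivative_works)

lemma Ck_on_derivative: "Ck_on (Suc n) f S \<Longrightarrow> Ck_on n (\<lambda>x. frechet_derivative f (at x) v) S"
  by simp

lemma Ck_on_add: "open S \<Longrightarrow> Ck_on n f S \<Longrightarrow> Ck_on n g S \<Longrightarrow> Ck_on n (\<lambda>x. f x + g x) S"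
proof (induction n arbitrary: f g)
  case 0
  then show ?case by (auto intro: continuous_intros)
next
  case (Suc n)
  note prems = Suc.prems(2,3)
  show ?case
    by (rule Ck_on_SucI[OF Suc.prems(1) has_derivative_add[OF prems[THEN Ck_on_has_derivative]]])
       (auto intro: Suc.IH[OF Suc.prems(1) prems[THEN Ck_on_derivative]])
qed

lemma Ck_on_bounded_linear:
  assumes "bounded_linear L"
  shows "open S \<Longrightarrow> Ck_on n f S \<Longrightarrow> Ck_on n (\<lambda>x. L (f x)) S"
proof (induction n arbitrary: f)
  case 0
  then show ?case by (auto intro: bounded_linear.continuous_on[OF assms])
next
  case (Suc n)
  note prems = Suc.prems(2)
  show ?case
    by (rule Ck_on_SucI[OF Suc.prems(1) bounded_linear.has_derivative[OF assms Ck_on_has_derivative[OF prems]]])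
       (auto intro: Suc.IH[OF Suc.prems(1) Ck_on_derivative[OF prems]])
qed

text \<open>The product rule leaves one factor undifferentiated in each term, which is why the
  induction also calls on \<open>Ck_on_Suc_imp\<close>.\<close>

lemma Ck_on_bilinear:
  assumes "bounded_bilinear b"
  shows "open S \<Longrightarrow> Ck_on n f S \<Longrightarrow> Ck_on n g S \<Longrightarrow> Ck_on n (\<lambda>x. b (f x) (g x)) S"
proof (induction n arbitrary: f g)
  case 0
  then show ?case by (auto intro: bounded_bilinear.continuous_on[OF assms])
next
  case (Suc n)
  note prems = Suc.prems(2,3)
  show ?case
    by (rule Ck_on_SucI[OF Suc.prems(1) bounded_bilinear.FDERIV[OF assms prems[THEN Ck_on_has_derivative]]])
       (auto intro!: Ck_on_add Suc.IH Suc.prems prems[THEN Ck_on_Suc_imp] prems[THEN Ck_on_derivative])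
qed

text \<open>The mean value theorem is used twice, first along \<open>u\<close> for the increment in
  direction \<open>v\<close>, then along \<open>v\<close> for the derivative in direction
  \<open>u\<close>. The second difference is symmetric in \<open>u\<close> and \<open>v\<close>,
  whence the symmetry of second derivatives.\<close>

lemma second_difference_mean_value:
  fixes f :: "'e::real_normed_vector \<Rightarrow> real"
  assumes h: "0 < h" "h * (norm u + norm v) < \<delta>" and sub: "ball x \<delta> \<subseteq> S"
    and f: "\<And>y. y \<in> S \<Longrightarrow> (f has_derivative df y) (at y)"
    and a: "\<And>y. y \<in> S \<Longrightarrow> ((\<lambda>z. df z u) has_derivative a y) (at y)"
  shows "\<exists>p\<in>ball x \<delta>. f (x + h *\<^sub>R u + h *\<^sub>R v) - f (x + h *\<^sub>R u) - f (x + h *\<^sub>R v) + f x = h * h * a p v"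
proof -
  have inS: "x + s *\<^sub>R u + t *\<^sub>R v \<in> ball x \<delta>" if "0 \<le> s" "s \<le> h" "0 \<le> t" "t \<le> h" for s t
  proof -
    have "norm (s *\<^sub>R u + t *\<^sub>R v) \<le> s * norm u + t * norm v"
      using norm_triangle_ineq[of "s *\<^sub>R u" "t *\<^sub>R v"] that by simp
    also have "\<dots> \<le> h * norm u + h * norm v" using that by (intro add_mono mult_right_mono) auto
    also have "\<dots> < \<delta>" using h by (simp add: distrib_left)
    finally show ?thesis using norm_minus_cancel[of "s *\<^sub>R u + t *\<^sub>R v"]
      by (simp add: dist_norm add.assoc del: norm_minus_cancel)
  qed
  have line: "((\<lambda>s. f (y + s *\<^sub>R w)) has_derivative (\<lambda>d. d * df (y + s *\<^sub>R w) w)) (at s within T)"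
    if "y + s *\<^sub>R w \<in> ball x \<delta>" for y w s T
  proof -
    have d: "((\<lambda>s. y + s *\<^sub>R w) has_derivative (\<lambda>d. d *\<^sub>R w)) (at s within T)"
      by (auto intro!: derivative_eq_intros)
    have fy: "(f has_derivative df (y + s *\<^sub>R w)) (at (y + s *\<^sub>R w))" using f that sub by auto
    show ?thesis
      using has_derivative_compose[OF d fy] linear_cmul[OF has_derivative_linear[OF fy]] by simp
  qed
  let ?\<phi> = "\<lambda>s. f ((x + h *\<^sub>R v) + s *\<^sub>R u) - f (x + s *\<^sub>R u)"
  have "\<exists>s\<in>{0<..<h}. ?\<phi> h - ?\<phi> 0 = (h - 0) * df ((x + h *\<^sub>R v) + s *\<^sub>R u) u - (h - 0) * df (x + s *\<^sub>R u) u"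
  proof (rule mvt_simple[OF h(1), where f = ?\<phi> and
        f' = "\<lambda>s d. d * df ((x + h *\<^sub>R v) + s *\<^sub>R u) u - d * df (x + s *\<^sub>R u) u"])
    fix s assume "0 \<le> s" "s \<le> h" note s = this
    show "(?\<phi> has_derivative (\<lambda>d. d * df ((x + h *\<^sub>R v) + s *\<^sub>R u) u - d * df (x + s *\<^sub>R u) u)) (at s within {0..h})"
      using inS[of s h] inS[of s 0] s h by (intro has_derivative_diff line) (auto simp: algebra_simps)
  qed
  then obtain s where s: "0 < s" "s < h"
    and \<phi>: "?\<phi> h - ?\<phi> 0 = h * (df ((x + s *\<^sub>R u) + h *\<^sub>R v) u - df ((x + s *\<^sub>R u) + 0 *\<^sub>R v) u)"
    by (auto simp: algebra_simps)
  let ?\<psi> = "\<lambda>t. df ((x + s *\<^sub>R u) + t *\<^sub>R v) u"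
  have "\<exists>t\<in>{0<..<h}. ?\<psi> h - ?\<psi> 0 = a ((x + s *\<^sub>R u) + t *\<^sub>R v) ((h - 0) *\<^sub>R v)"
  proof (rule mvt_simple[OF h(1), where f = ?\<psi> and f' = "\<lambda>t d. a ((x + s *\<^sub>R u) + t *\<^sub>R v) (d *\<^sub>R v)"])
    fix t assume "0 \<le> t" "t \<le> h" note t = this
    have d: "((\<lambda>t. (x + s *\<^sub>R u) + t *\<^sub>R v) has_derivative (\<lambda>d. d *\<^sub>R v)) (at t within {0..h})"
      by (auto intro!: derivative_eq_intros)
    show "(?\<psi> has_derivative (\<lambda>d. a ((x + s *\<^sub>R u) + t *\<^sub>R v) (d *\<^sub>R v))) (at t within {0..h})"
      using inS[of s t] s t sub by (intro has_derivative_compose[OF d a]) auto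
  qed
  then obtain t where t: "0 < t" "t < h" and \<psi>: "?\<psi> h - ?\<psi> 0 = a (x + s *\<^sub>R u + t *\<^sub>R v) (h *\<^sub>R v)"
    by auto
  have "x + s *\<^sub>R u + t *\<^sub>R v \<in> ball x \<delta>" using s t by (intro inS) auto
  moreover from this have "a (x + s *\<^sub>R u + t *\<^sub>R v) (h *\<^sub>R v) = h * a (x + s *\<^sub>R u + t *\<^sub>R v) v"
    using linear_cmul[OF has_derivative_linear[OF a]] sub by auto
  ultimately show ?thesis
    using \<phi> \<psi> by (intro bexI[of _ "x + s *\<^sub>R u + t *\<^sub>R v"]) (simp_all add: algebra_simps)
qed

lemma second_derivative_symmetric_real:
  fixes f :: "'e::real_normed_vector \<Rightarrow> real"
  assumes "open S" "x \<in> S"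
    and f: "\<And>y. y \<in> S \<Longrightarrow> (f has_derivative df y) (at y)"
    and a: "\<And>y. y \<in> S \<Longrightarrow> ((\<lambda>z. df z u) has_derivative a y) (at y)"
    and b: "\<And>y. y \<in> S \<Longrightarrow> ((\<lambda>z. df z v) has_derivative b y) (at y)"
    and ca: "continuous_on S (\<lambda>y. a y v)" and cb: "continuous_on S (\<lambda>y. b y u)"
  shows "a x v = b x u"
proof (rule ccontr)
  assume ne: "a x v \<noteq> b x u"
  \<comment> \<open>Half the gap: the common value \<open>a p v = b q u\<close> would lie strictly
    within \<open>e\<close> of both numbers.\<close>
  define e where "e = \<bar>a x v - b x u\<bar> / 2"
  have e: "e > 0" using ne by (simp add: e_def)
  have "isCont (\<lambda>y. a y v) x" "isCont (\<lambda>y. b y u) x"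
    using ca cb assms(1,2) by (simp_all add: continuous_on_eq_continuous_at)
  with e obtain d1 d2 where d: "d1 > 0" "d2 > 0"
    and d1: "\<And>y. dist y x < d1 \<Longrightarrow> dist (a y v) (a x v) < e"
    and d2: "\<And>y. dist y x < d2 \<Longrightarrow> dist (b y u) (b x u) < e"
    unfolding continuous_at_eps_delta by metis
  obtain d3 where d3: "d3 > 0" "ball x d3 \<subseteq> S" using assms(1,2) openE by blast
  define \<delta> where "\<delta> = min d1 (min d2 d3)"
  have \<delta>: "\<delta> > 0" "ball x \<delta> \<subseteq> S" using d d3 by (auto simp: \<delta>_def)
  define h where "h = \<delta> / (norm u + norm v + 1)"
  have den: "norm u + norm v + 1 > 0" by (simp add: add_nonneg_pos)
  then have h0: "h > 0" using \<delta> by (simp add: h_def)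
  have "h * (norm u + norm v) < h * (norm u + norm v + 1)" using h0 by simp
  also have "\<dots> = \<delta>" using den by (simp add: h_def)
  finally have h: "h * (norm u + norm v) < \<delta>" .
  from second_difference_mean_value[OF h0 h \<delta>(2) f a] obtain p where p: "p \<in> ball x \<delta>"
    "f (x + h *\<^sub>R u + h *\<^sub>R v) - f (x + h *\<^sub>R u) - f (x + h *\<^sub>R v) + f x = h * h * a p v" by auto
  from h have h': "h * (norm v + norm u) < \<delta>" by (simp add: add.commute)
  from second_difference_mean_value[OF h0 h' \<delta>(2) f b] obtain q where q: "q \<in> ball x \<delta>"
    "f (x + h *\<^sub>R v + h *\<^sub>R u) - f (x + h *\<^sub>R v) - f (x + h *\<^sub>R u) + f x = h * h * b q u" by auto
  have "h * h * a p v = h * h * b q u"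
    unfolding p(2)[symmetric] q(2)[symmetric] by (simp add: add.commute add.left_commute)
  then have "a p v = b q u" using h0 by simp
  moreover have "dist (a p v) (a x v) < e" "dist (b q u) (b x u) < e"
    using p(1) q(1) by (auto intro!: d1 d2 simp: \<delta>_def dist_commute)
  ultimately show False by (simp add: e_def dist_real_def abs_if split: if_splits)
qed

text \<open>Inner products with a fixed \<open>z\<close> reduce this to real-valued maps; then
  \<open>z\<close> is taken to be the difference of the two sides.\<close>

lemma second_derivative_symmetric:
  fixes f :: "'e::real_normed_vector \<Rightarrow> 'f::real_inner"
  assumes "open S" "x \<in> S" and f: "Ck_on 2 f S"
  shows "frechet_derivative (\<lambda>y. frechet_derivative f (at y) u) (at x) v
    = frechet_derivative (\<lambda>y. frechet_derivative f (at y) v) (at x) u" (is "?a x = ?b x")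
proof -
  have f2: "Ck_on (Suc (Suc 0)) f S" using f by (simp only: numeral_2_eq_2)
  have "?a x \<bullet> z = ?b x \<bullet> z" for z
  proof (rule second_derivative_symmetric_real[OF assms(1,2),
        where f = "\<lambda>y. f y \<bullet> z" and df = "\<lambda>y v. frechet_derivative f (at y) v \<bullet> z"])
    fix y assume y: "y \<in> S"
    show "((\<lambda>y. f y \<bullet> z) has_derivative (\<lambda>v. frechet_derivative f (at y) v \<bullet> z)) (at y)"
      by (intro has_derivative_inner_left Ck_on_has_derivative[OF f2 y])
    have D: "((\<lambda>x. frechet_derivative f (at x) w \<bullet> z) has_derivative
      (\<lambda>v. frechet_derivative (\<lambda>y. frechet_derivative f (at y) w) (at y) v \<bullet> z)) (at y)" for w
      by (intro has_derivative_inner_left Ck_on_has_derivative[OF _ y, of 0]) (use f2 in auto)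
    show "((\<lambda>x. frechet_derivative f (at x) u \<bullet> z) has_derivative
      (\<lambda>v. frechet_derivative (\<lambda>y. frechet_derivative f (at y) u) (at y) v \<bullet> z)) (at y)" by (rule D)
    show "((\<lambda>x. frechet_derivative f (at x) v \<bullet> z) has_derivative
      (\<lambda>w. frechet_derivative (\<lambda>y. frechet_derivative f (at y) v) (at y) w \<bullet> z)) (at y)" by (rule D)
  next
    show "continuous_on S (\<lambda>y. ?a y \<bullet> z)" "continuous_on S (\<lambda>y. ?b y \<bullet> z)"
      using f2 by (auto intro!: continuous_intros)
  qed
  from this[of "?a x - ?b x"] have "(?a x - ?b x) \<bullet> (?a x - ?b x) = 0"
    by (simp only: inner_diff_left)
  then show ?thesis by simp
qed

section \<open>The charts of the Grassmannian\<close>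

definition emb :: "('k::finite, 'l::finite) gr_chart \<Rightarrow> real^'l^'k \<Rightarrow> ('k, 'l) mat" where
  "emb c x = reflect (snd c x)"

definition demb :: "('k::finite, 'l::finite) gr_chart \<Rightarrow> real^'l^'k \<Rightarrow> real^'l^'k \<Rightarrow> ('k, 'l) mat" where
  "demb c x u = frechet_derivative (emb c) (at x) u"

definition d2emb ::
  "('k::finite, 'l::finite) gr_chart \<Rightarrow> real^'l^'k \<Rightarrow> real^'l^'k \<Rightarrow> real^'l^'k \<Rightarrow> ('k, 'l) mat" where
  "d2emb c x u v = frechet_derivative (\<lambda>y. demb c y v) (at x) u"

text \<open>For an involution \<open>S\<close>, conjugation by \<open>S\<close> squares to the
  identity, and this is the projection onto its eigenspace of -1, the matrices anticommuting with
  \<open>S\<close>. The symmetric ones among them form the tangent space at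
  \<open>S\<close>.\<close>

definition tangent_proj :: "real^'n^'n \<Rightarrow> real^'n^'n \<Rightarrow> real^'n^'n" where
  "tangent_proj S Y = (1/2) *\<^sub>R (Y - S ** Y ** S)"

lemma linear_tangent_proj: "linear (tangent_proj S)"
  by (rule linearI) (simp_all add: tangent_proj_def matrix_ring_simps algebra_simps)

lemma transpose_emb: "transpose (emb c x) = emb c x"
  by (simp add: emb_def transpose_reflect)

lemma has_derivative_eq_at:
  "(f has_derivative f') (at x) \<Longrightarrow> (f has_derivative f'') (at x) \<Longrightarrow> f' u = f'' u"
  by (auto dest: has_derivative_unique)

context
  fixes c :: "('k::finite, 'l::finite) gr_chart"
  assumes c: "c \<in> gr_atlas"
begin

lemma chart_open: "open (fst c)"
  and chart_Ck: "Ck_on n (snd c) (fst c)"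
  and chart_orthogonal: "x \<in> fst c \<Longrightarrow> orthogonal_matrix (snd c x)"
  and chart_inj: "inj_on (\<lambda>x. gr_coset (snd c x)) (fst c)"
  and chart_form_inj: "x \<in> fst c \<Longrightarrow> inj (chart_form (snd c) x)"
  using c by (auto simp: gr_atlas_def smooth_on_open_def rotation_matrix_def)

lemma chart_has_derivative:
  "x \<in> fst c \<Longrightarrow> (snd c has_derivative frechet_derivative (snd c) (at x)) (at x)"
  by (rule Ck_on_has_derivative[OF chart_Ck[of "Suc 0"]])

lemma Ck_on_emb: "Ck_on n (emb c) (fst c)"
  unfolding emb_def[abs_def] reflect_def
  by (intro Ck_on_bilinear[OF bounded_bilinear_matrix_mult] Ck_on_bounded_linear[OF bounded_linear_transpose]
      Ck_on_const chart_open chart_Ck)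

lemma has_derivative_emb: "x \<in> fst c \<Longrightarrow> (emb c has_derivative demb c x) (at x)"
  unfolding demb_def[abs_def] by (rule Ck_on_has_derivative[OF Ck_on_emb[of "Suc 0"]])

lemma Ck_on_demb: "Ck_on n (\<lambda>x. demb c x v) (fst c)"
  unfolding demb_def[abs_def] by (rule Ck_on_derivative[OF Ck_on_emb])

lemma has_derivative_demb:
  "x \<in> fst c \<Longrightarrow> ((\<lambda>y. demb c y v) has_derivative (\<lambda>u. d2emb c x u v)) (at x)"
  unfolding d2emb_def[abs_def] by (rule Ck_on_has_derivative[OF Ck_on_demb[of "Suc 0"]])

lemma d2emb_commute: "x \<in> fst c \<Longrightarrow> d2emb c x u v = d2emb c x v u"
  unfolding d2emb_def demb_def
  by (rule second_derivative_symmetric[OF chart_open _ Ck_on_emb])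

lemma linear_demb: "x \<in> fst c \<Longrightarrow> linear (demb c x)"
  by (rule has_derivative_linear[OF has_derivative_emb])

lemma linear_d2emb: "x \<in> fst c \<Longrightarrow> linear (\<lambda>u. d2emb c x u v)"
  by (rule has_derivative_linear[OF has_derivative_demb])

text \<open>Differentiate the identity \<open>transpose g ** g = mat 1\<close> for the lift
  \<open>g\<close>.\<close>

lemma chart_maurer_cartan_skew:
  assumes x: "x \<in> fst c"
  shows "transpose (transpose (snd c x) ** frechet_derivative (snd c) (at x) u)
    = - (transpose (snd c x) ** frechet_derivative (snd c) (at x) u)"
proof -
  let ?d = "frechet_derivative (snd c) (at x)"
  have "((\<lambda>y. transpose (snd c y) ** snd c y) has_derivative
      (\<lambda>u. transpose (snd c x) ** ?d u + transpose (?d u) ** snd c x)) (at x)"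
    by (intro matmul.FDERIV bounded_linear.has_derivative[OF bounded_linear_transpose] chart_has_derivative x)
  moreover have "((\<lambda>y. transpose (snd c y) ** snd c y) has_derivative (\<lambda>u. 0)) (at x)"
    by (rule has_derivative_transform_within_open[OF has_derivative_const[of "mat 1"] chart_open x])
       (simp add: orthogonal_cancel chart_orthogonal)
  ultimately have "transpose (snd c x) ** ?d u + transpose (?d u) ** snd c x = 0"
    by (rule has_derivative_eq_at[where u = u])
  then show ?thesis
    by (simp add: matrix_transpose_mul add_eq_0_iff)
qed

lemma chart_form_eq:
  assumes x: "x \<in> fst c"
  shows "chart_form (snd c) x u = (1/2) *\<^sub>R (transpose (snd c x) ** frechet_derivative (snd c) (at x) u
    - refl0 ** (transpose (snd c x) ** frechet_derivative (snd c) (at x) u) ** refl0)"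
  unfolding chart_form_def by (rule horizontal_eq[OF chart_maurer_cartan_skew[OF x]])

lemma linear_chart_form:
  assumes x: "x \<in> fst c"
  shows "linear (chart_form (snd c) x)"
proof -
  note lin = has_derivative_linear[OF chart_has_derivative[OF x]]
  show ?thesis
    by (rule linearI)
       (simp_all only: chart_form_eq[OF x] linear_add[OF lin] linear_cmul[OF lin] matmul.add_right matmul.add_left
          matmul.scaleR_left matmul.scaleR_right add_diff_add scaleR_add_right scaleR_left_commute[of "1/2"]
          flip: scaleR_diff_right)
qed

lemma transpose_chart_form: "x \<in> fst c \<Longrightarrow> transpose (chart_form (snd c) x u) = - chart_form (snd c) x u"
  using chart_maurer_cartan_skew[of x u]
  by (simp add: chart_form_eq transp_simps matrix_transpose_mul[of _ refl0] matrix_transpose_mul[of refl0]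
      transpose_refl0 matmul.minus_left matmul.minus_right matrix_mul_assoc[of refl0 _ refl0]
      flip: scaleR_minus_right)

lemma refl0_conj_chart_form:
  assumes "x \<in> fst c"
  shows "refl0 ** chart_form (snd c) x u ** refl0 = - chart_form (snd c) x u"
proof -
  have c: "refl0 ** (refl0 ** X ** refl0) ** refl0 = X" for X :: "('k, 'l) mat"
    by (simp add: matrix_mul_assoc refl0_refl0) (simp add: refl0_refl0 flip: matrix_mul_assoc)
  show ?thesis
    by (simp only: chart_form_eq[OF assms] matmul.scaleR_right matmul.scaleR_left matmul.diff_right
        matmul.diff_left c minus_diff_eq flip: scaleR_minus_right)
qed

text \<open>With \<open>m = g\<^sup>T dg\<close>, the derivative of \<open>g I g\<^sup>T\<close> is
  the commutator of \<open>m\<close> and \<open>I\<close>, conjugated by \<open>g\<close>. The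
  commutator sees only the part of \<open>m\<close> that anticommutes with \<open>I\<close>, the
  horizontal part, and doubles it.\<close>

lemma demb_eq:
  assumes x: "x \<in> fst c"
  shows "demb c x u = 2 *\<^sub>R (snd c x ** (chart_form (snd c) x u ** refl0) ** transpose (snd c x))"
proof -
  let ?g = "snd c x" and ?d = "frechet_derivative (snd c) (at x)"
  define m where "m = transpose ?g ** ?d u"
  have gm: "?g ** m = ?d u" by (simp add: m_def orthogonal_cancel chart_orthogonal x)
  have tm: "transpose (?d u) = - m ** transpose ?g"
    using chart_maurer_cartan_skew[OF x, of u] by (metis m_def gm matrix_transpose_mul)
  have "(emb c has_derivative (\<lambda>u. (?g ** refl0) ** transpose (?d u) + (?g ** 0 + ?d u ** refl0) ** transpose ?g)) (at x)"
    unfolding emb_def[abs_def] reflect_def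
    by (intro matmul.FDERIV bounded_linear.has_derivative[OF bounded_linear_transpose]
        chart_has_derivative x has_derivative_const)
  then have "demb c x u = (?g ** refl0) ** transpose (?d u) + (?g ** 0 + ?d u ** refl0) ** transpose ?g"
    by (rule has_derivative_eq_at[OF has_derivative_emb[OF x], where u = u])
  also have "\<dots> = ?g ** (m ** refl0 - refl0 ** m) ** transpose ?g"
    by (simp add: tm matrix_ring_simps matrix_mul_assoc gm)
  also have "m ** refl0 - refl0 ** m = 2 *\<^sub>R (chart_form (snd c) x u ** refl0)"
    by (simp add: chart_form_eq[OF x] matrix_ring_simps refl0_cancel flip: m_def)
  finally show ?thesis by (simp add: matrix_ring_simps)
qed

text \<open>The scale 8 is the square of the factor 2 in \<open>demb_eq\<close> times the 2 from the
  half in \<open>so_inner\<close>.\<close>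

lemma metric_eq_emb:
  assumes x: "x \<in> fst c"
  shows "metric grassmannian c x u v = (demb c x u \<bullet> demb c x v) / 8"
proof -
  have conj: "(Q ** X ** transpose Q) \<bullet> (Q ** Y ** transpose Q) = X \<bullet> Y"
    if "orthogonal_matrix Q" for Q X Y :: "('k, 'l) mat"
  proof -
    \<comment> \<open>Polarization: invariance of the norm gives invariance of the inner
      product.\<close>
    have "(norm (Q ** (X + Y) ** transpose Q))\<^sup>2 = (norm (X + Y))\<^sup>2"
      "(norm (Q ** (X - Y) ** transpose Q))\<^sup>2 = (norm (X - Y))\<^sup>2"
      using that by (simp_all add: norm_orthogonal_mult_left norm_orthogonal_mult_right)
    then show ?thesis
      by (simp add: matrix_ring_simps power2_norm_eq_inner inner_add_left inner_add_right
          inner_diff_left inner_diff_right inner_commute)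
  qed
  have right: "(X ** refl0) \<bullet> (Y ** refl0) = X \<bullet> Y" for X Y :: "('k, 'l) mat"
  proof -
    have sign: "(x * block_sign j) * (y * block_sign j) = x * y" for x y :: real and j :: "'k + 'l"
      by (cases j) simp_all
    show ?thesis unfolding inner_vec_def by (simp add: mult_refl0_nth sign)
  qed
  show ?thesis
    by (simp add: grassmannian_def so_inner_eq demb_eq x conj chart_orthogonal right)
qed

text \<open>A kernel vector has metric length zero, so its \<open>chart_form\<close> vanishes, and
  the atlas demands that this form be injective.\<close>

lemma demb_inj: "x \<in> fst c \<Longrightarrow> inj (demb c x)"
proof (rule linear_injective_0[THEN iffD2, OF linear_demb], assumption, intro allI impI)
  fix u assume x: "x \<in> fst c" and "demb c x u = 0"
  then have "metric grassmannian c x u u = 0" by (simp add: metric_eq_emb)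
  then have "chart_form (snd c) x u = chart_form (snd c) x 0"
    using linear_0[OF linear_chart_form[OF x]] by (simp add: grassmannian_def so_inner_eq)
  then show "u = 0" using chart_form_inj[OF x] by (simp add: inj_eq)
qed

lemma emb_emb: "x \<in> fst c \<Longrightarrow> emb c x ** emb c x = mat 1"
  by (simp add: emb_def reflect_reflect chart_orthogonal)

lemma transpose_demb:
  assumes x: "x \<in> fst c"
  shows "transpose (demb c x u) = demb c x u"
proof -
  have "((\<lambda>x. transpose (emb c x)) has_derivative (\<lambda>u. transpose (demb c x u))) (at x)"
    by (rule bounded_linear.has_derivative[OF bounded_linear_transpose has_derivative_emb[OF x]])
  then show ?thesis unfolding transpose_emb
    by (rule has_derivative_eq_at[OF _ has_derivative_emb[OF x], where u = u])
qed

lemma transpose_d2emb: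
  assumes x: "x \<in> fst c"
  shows "transpose (d2emb c x u v) = d2emb c x u v"
proof -
  have "((\<lambda>y. transpose (demb c y v)) has_derivative (\<lambda>u. transpose (d2emb c x u v))) (at x)"
    by (rule bounded_linear.has_derivative[OF bounded_linear_transpose has_derivative_demb[OF x]])
  then have "((\<lambda>y. demb c y v) has_derivative (\<lambda>u. transpose (d2emb c x u v))) (at x)"
    by (rule has_derivative_transform_within_open[OF _ chart_open x]) (simp add: transpose_demb)
  then show ?thesis
    by (rule has_derivative_eq_at[OF _ has_derivative_demb[OF x], where u = u])
qed

text \<open>Differentiate \<open>S ** S = mat 1\<close> for the involution \<open>S\<close>.\<close>

lemma emb_demb:
  assumes x: "x \<in> fst c"
  shows "emb c x ** demb c x u = - (demb c x u ** emb c x)"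
proof -
  have "((\<lambda>x. emb c x ** emb c x) has_derivative (\<lambda>u. emb c x ** demb c x u + demb c x u ** emb c x)) (at x)"
    by (rule matmul.FDERIV[OF has_derivative_emb[OF x] has_derivative_emb[OF x]])
  moreover have "((\<lambda>x. emb c x ** emb c x) has_derivative (\<lambda>u. 0)) (at x)"
    by (rule has_derivative_transform_within_open[OF has_derivative_const[of "mat 1"] chart_open x])
       (simp add: emb_emb)
  ultimately have "emb c x ** demb c x u + demb c x u ** emb c x = 0"
    by (rule has_derivative_eq_at[where u = u])
  then show ?thesis by (simp add: add_eq_0_iff2)
qed

text \<open>By dimension, the differential of the embedding reaches every symmetric matrix that
  anticommutes with the involution.\<close>

lemma demb_surj:
  assumes x: "x \<in> fst c" and Y: "transpose Y = Y" "emb c x ** Y = - (Y ** emb c x)"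
  shows "\<exists>u. demb c x u = Y"
proof -
  let ?g = "snd c x"
  \<comment> \<open>Obtained by solving \<open>demb_eq\<close> for the chart form that would produce
    \<open>Y\<close>.\<close>
  define Z where "Z = (1/2) *\<^sub>R (transpose ?g ** Y ** ?g ** refl0)"
  note o = orthogonal_cancel[OF chart_orthogonal[OF x]]
  have anti: "refl0 ** (transpose ?g ** Y ** ?g) = - (transpose ?g ** Y ** ?g ** refl0)"
  proof -
    have "transpose ?g ** (emb c x ** Y) ** ?g = - (transpose ?g ** (Y ** emb c x) ** ?g)"
      by (simp only: Y(2) matmul.minus_left matmul.minus_right)
    then show ?thesis by (simp add: emb_def reflect_def o flip: matrix_mul_assoc)
  qed
  have Zt: "transpose Z = - Z"
  proof -
    have "transpose Z = (1/2) *\<^sub>R (refl0 ** (transpose ?g ** Y ** ?g))"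
      by (simp add: Z_def transp_simps matrix_transpose_mul transpose_refl0 Y matrix_mul_assoc)
    then show ?thesis by (simp add: anti Z_def)
  qed
  have Zc: "refl0 ** Z ** refl0 = - Z"
  proof -
    have "refl0 ** (W ** refl0) ** refl0 = refl0 ** W" for W :: "('k, 'l) mat"
      by (simp add: refl0_refl0 flip: matrix_mul_assoc)
    then show ?thesis
      by (simp only: Z_def matmul.scaleR_left matmul.scaleR_right anti scaleR_minus_right)
  qed
  let ?b = "\<lambda>u. unhat (chart_form (snd c) x u)"
  have hat: "hat (?b u) = chart_form (snd c) x u" for u
    by (rule hat_unhat[OF transpose_chart_form[OF x] refl0_conj_chart_form[OF x]])
  have "linear ?b"
    using linear_compose[OF linear_chart_form[OF x] linear_unhat] by (simp add: o_def)
  moreover have "inj ?b"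
    using chart_form_inj[OF x] hat by (metis (no_types, lifting) injD injI)
  ultimately have "surj ?b" by (rule linear_injective_imp_surjective) simp
  then obtain u where "unhat Z = ?b u" by (metis surjE)
  then have "chart_form (snd c) x u = Z" using hat hat_unhat[OF Zt Zc] by metis
  then have "demb c x u = Y"
    by (simp add: demb_eq x Z_def matrix_ring_simps refl0_cancel o)
       (simp add: o flip: matrix_mul_assoc)
  then show ?thesis ..
qed

lemma tangent_proj_demb: "x \<in> fst c \<Longrightarrow> tangent_proj (emb c x) (demb c x u) = demb c x u"
  unfolding tangent_proj_def
  by (simp add: emb_demb matmul.minus_left)
     (simp add: emb_emb flip: matrix_mul_assoc scaleR_2)

text \<open>Conjugation by the symmetric matrix \<open>S\<close> is self-adjoint and sends tangent
  vectors to their negatives.\<close>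

lemma inner_tangent_proj:
  assumes x: "x \<in> fst c"
  shows "tangent_proj (emb c x) Y \<bullet> demb c x u = Y \<bullet> demb c x u"
proof -
  let ?S = "emb c x"
  have "(?S ** Y ** ?S) \<bullet> demb c x u = Y \<bullet> (?S ** demb c x u ** ?S)"
  proof -
    have "(?S ** Y ** ?S) \<bullet> demb c x u = trace (?S ** (transpose Y ** ?S ** demb c x u))"
      by (simp add: inner_matrix_trace matrix_transpose_mul transpose_emb matrix_mul_assoc)
    also have "\<dots> = trace ((transpose Y ** ?S ** demb c x u) ** ?S)" by (rule trace_mul_sym)
    finally show ?thesis by (simp add: inner_matrix_trace matrix_mul_assoc)
  qed
  also have "?S ** demb c x u ** ?S = - demb c x u"
    by (simp add: emb_demb x matmul.minus_left) (simp add: emb_emb x flip: matrix_mul_assoc)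
  finally show ?thesis by (simp add: tangent_proj_def inner_diff_left)
qed

lemma tangent_proj_in_range:
  assumes x: "x \<in> fst c" and Y: "transpose Y = Y"
  shows "\<exists>u. demb c x u = tangent_proj (emb c x) Y"
proof (rule demb_surj[OF x])
  show "transpose (tangent_proj (emb c x) Y) = tangent_proj (emb c x) Y"
    by (simp add: tangent_proj_def transp_simps matrix_transpose_mul transpose_emb Y matrix_mul_assoc)
  have "emb c x ** (emb c x ** Y ** emb c x) = Y ** emb c x"
    by (simp add: matrix_mul_assoc emb_emb x)
  moreover have "emb c x ** Y ** emb c x ** emb c x = emb c x ** Y"
    by (simp add: emb_emb x flip: matrix_mul_assoc)
  ultimately show "emb c x ** tangent_proj (emb c x) Y = - (tangent_proj (emb c x) Y ** emb c x)"
    by (simp add: tangent_proj_def matmul.scaleR_left matmul.scaleR_right matmul.diff_left matmul.diff_right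
        flip: scaleR_minus_right)
qed

lemma frechet_derivative_metric:
  assumes x: "x \<in> fst c"
  shows "frechet_derivative (\<lambda>y. metric grassmannian c y v w) (at x) u
    = (d2emb c x u v \<bullet> demb c x w + demb c x v \<bullet> d2emb c x u w) / 8"
proof -
  have "((\<lambda>y. (demb c y v \<bullet> demb c y w) / 8) has_derivative
      (\<lambda>u. (demb c x v \<bullet> d2emb c x u w + d2emb c x u v \<bullet> demb c x w) / 8)) (at x)"
    by (intro bounded_linear.has_derivative[OF bounded_linear_divide] has_derivative_inner has_derivative_demb x)
  then have "((\<lambda>y. metric grassmannian c y v w) has_derivative
      (\<lambda>u. (demb c x v \<bullet> d2emb c x u w + d2emb c x u v \<bullet> demb c x w) / 8)) (at x)"
    by (rule has_derivative_transform_within_open[OF _ chart_open x]) (simp add: metric_eq_emb)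
  from frechet_derivative_at[OF this, symmetric] show ?thesis by (simp add: add.commute)
qed

text \<open>The metric is induced by the embedding, so its Levi-Civita connection is the tangential part
  of the ambient derivative.\<close>

lemma demb_christoffel:
  assumes x: "x \<in> fst c"
  shows "demb c x (christoffel (metric grassmannian c) x u v) = tangent_proj (emb c x) (d2emb c x u v)"
proof -
  obtain z where z: "demb c x z = tangent_proj (emb c x) (d2emb c x u v)"
    using tangent_proj_in_range[OF x transpose_d2emb[OF x]] by blast
  \<comment> \<open>By symmetry of \<open>d2emb\<close> all terms cancel except twice the inner
    product of \<open>d2emb c x u v\<close> with \<open>demb c x w\<close>, which sees only the
    tangential part.\<close>
  have koszul: "frechet_derivative (\<lambda>y. metric grassmannian c y v w) (at x) u
      + frechet_derivative (\<lambda>y. metric grassmannian c y u w) (at x) v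
      - frechet_derivative (\<lambda>y. metric grassmannian c y u v) (at x) w
    = 2 * metric grassmannian c x z w" for w
    using d2emb_commute[OF x, of v u] d2emb_commute[OF x, of w u] d2emb_commute[OF x, of w v]
    by (simp add: frechet_derivative_metric x metric_eq_emb z inner_tangent_proj)
       (simp add: inner_commute field_simps)
  have "christoffel (metric grassmannian c) x u v = z"
    unfolding christoffel_def koszul
  proof (rule the_equality)
    fix z' assume "\<forall>w. 2 * metric grassmannian c x z' w = 2 * metric grassmannian c x z w"
    then have "demb c x z' \<bullet> demb c x (z' - z) = demb c x z \<bullet> demb c x (z' - z)"
      by (simp add: metric_eq_emb x)
    then have "demb c x (z' - z) \<bullet> demb c x (z' - z) = 0"
      by (simp add: linear_diff[OF linear_demb[OF x]] inner_diff_left)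
    then have "demb c x z' = demb c x z" by (simp add: linear_diff[OF linear_demb[OF x]])
    then show "z' = z" using demb_inj[OF x] by (simp add: inj_eq)
  qed simp
  then show ?thesis using z by simp
qed

end

section \<open>Coordinates of curves and covariant derivatives\<close>

abbreviation gr_charts :: "('k::finite, 'l::finite) mat set \<Rightarrow> ('k, 'l) gr_chart set" where
  "gr_charts \<equiv> charts_at grassmannian"

abbreviation gr_coord :: "('k::finite, 'l::finite) gr_chart \<Rightarrow> ('k, 'l) mat set \<Rightarrow> real^'l^'k" where
  "gr_coord \<equiv> coord grassmannian"

lemma charts_at_iff:
  "c \<in> gr_charts p \<longleftrightarrow> c \<in> gr_atlas \<and> (\<exists>x\<in>fst c. p = gr_coset (snd c x))"
  by (auto simp: charts_at_def grassmannian_def)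

lemma coord_eq:
  "c \<in> gr_atlas \<Longrightarrow> x \<in> fst c \<Longrightarrow> gr_coord c (gr_coset (snd c x)) = x"
  using inv_into_f_f[OF chart_inj] by (simp add: coord_def grassmannian_def)

lemma charts_atE:
  assumes "c \<in> gr_charts p"
  obtains "c \<in> gr_atlas" "gr_coord c p \<in> fst c" "gr_coset (snd c (gr_coord c p)) = p"
  using assms coord_eq unfolding charts_at_iff by metis

text \<open>With \<open>d = S\<^sub>1 - S\<^sub>2\<close> and \<open>e = S\<^sub>1 + S\<^sub>2\<close> one has \<open>d e + e d = 0\<close>. As \<open>e\<close> is close to \<open>2 S\<^sub>0\<close>
  and \<open>d\<close> commutes with \<open>S\<^sub>0\<close>, this forces \<open>d = 0\<close>.\<close>

lemma square_root_unique_near: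
  fixes S0 S1 S2 :: "real^'n^'n"
  assumes sq: "S1 ** S1 = S2 ** S2" and orth: "orthogonal_matrix S0"
    and comm: "S0 ** (S1 - S2) = (S1 - S2) ** S0"
    and near: "norm (S1 + S2 - 2 *\<^sub>R S0) < 2"
  shows "S1 = S2"
proof (rule ccontr)
  assume ne: "S1 \<noteq> S2"
  define d where "d = S1 - S2"
  define e where "e = S1 + S2 - 2 *\<^sub>R S0"
  have comm: "S0 ** d = d ** S0" using comm by (simp add: d_def)
  have "d ** (S1 + S2) + (S1 + S2) ** d = 0"
    by (simp add: d_def matrix_ring_simps sq)
  moreover have "S1 + S2 = e + 2 *\<^sub>R S0" by (simp add: e_def)
  ultimately have "d ** e + e ** d + 4 *\<^sub>R (d ** S0) = 0"
    by (simp add: matrix_ring_simps comm vec_eq_iff algebra_simps)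
  then have "4 *\<^sub>R (d ** S0) = - (d ** e + e ** d)" by (simp add: add_eq_0_iff)
  moreover have "norm (4 *\<^sub>R (d ** S0)) = 4 * norm d"
    by (simp add: norm_orthogonal_mult_right orth)
  ultimately have "4 * norm d = norm (d ** e + e ** d)" by (metis norm_minus_cancel)
  also have "\<dots> \<le> norm d * norm e + norm e * norm d"
    by (rule norm_triangle_le[OF add_mono[OF norm_matrix_mult norm_matrix_mult]])
  also have "\<dots> = norm d * (2 * norm e)" by simp
  also have "\<dots> < norm d * 4" using near ne by (intro mult_strict_left_mono) (auto simp: e_def d_def)
  finally show False by simp
qed

text \<open>The kernel of \<open>tangent_proj S0\<close> consists of the matrices commuting with
  \<open>S0\<close>, which puts \<open>square_root_unique_near\<close> in force. So near
  \<open>S0\<close> an involution is determined by its tangential component.\<close>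

lemma involution_eq_of_tangent_proj:
  fixes S0 S1 S2 :: "real^'n^'n"
  assumes inv: "S0 ** S0 = mat 1" "S1 ** S1 = mat 1" "S2 ** S2 = mat 1"
    and sym: "transpose S0 = S0"
    and proj: "tangent_proj S0 (S1 - S2) = 0"
    and near: "norm (S1 + S2 - 2 *\<^sub>R S0) < 2"
  shows "S1 = S2"
proof (rule square_root_unique_near[OF _ _ _ near])
  have "S0 ** (S1 - S2) ** S0 = S1 - S2" using proj by (simp add: tangent_proj_def)
  then have "S0 ** (S1 - S2) ** S0 ** S0 = (S1 - S2) ** S0" by simp
  then show "S0 ** (S1 - S2) = (S1 - S2) ** S0" by (simp add: inv flip: matrix_mul_assoc)
qed (simp_all add: inv sym orthogonal_matrix)

lemma tendsto_reflect: "(g \<longlongrightarrow> a) F \<Longrightarrow> ((\<lambda>x. reflect (g x)) \<longlongrightarrow> reflect a) F"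
  unfolding reflect_def
  by (intro matmul.tendsto tendsto_const bounded_linear.tendsto[OF bounded_linear_transpose])

text \<open>Coordinates near a point become a differentiable function \<open>\<psi>\<close> of the
  ambient involution, so curves of cosets can be differentiated through their involutions. The
  inverse function theorem gives only equality of tangential components. From this
  \<open>involution_eq_of_tangent_proj\<close> recovers the involution, and the orientation argument
  recovers the coset.\<close>

lemma chart_coordinates:
  fixes c :: "('k::finite, 'l::finite) gr_chart"
  assumes c: "c \<in> gr_atlas" and x0: "x0 \<in> fst c"
    and g0: "orthogonal_matrix g0" "gr_coset g0 = gr_coset (snd c x0)"
  obtains \<psi> \<psi>' where "(\<psi> has_derivative \<psi>') (at (reflect g0))"
    "\<forall>\<^sub>F g in nhds g0. orthogonal_matrix g \<longrightarrow>
       \<psi> (reflect g) \<in> fst c \<and> gr_coset (snd c (\<psi> (reflect g))) = gr_coset g"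
proof -
  define S0 where "S0 = reflect g0"
  have S0: "S0 = emb c x0"
    unfolding S0_def emb_def by (rule reflect_cong_gr_coset[OF g0])
  obtain linv where linv: "linear linv" "linv \<circ> demb c x0 = id"
    using linear_injective_left_inverse[OF linear_demb[OF c x0] demb_inj[OF c x0]] by blast
  \<comment> \<open>Projecting to the tangent space first makes \<open>L\<close> a map on all
    matrices whose kernel, among symmetric ones, is the normal space.\<close>
  define L where "L = linv \<circ> tangent_proj S0"
  have L: "bounded_linear L"
    unfolding L_def by (intro linear_conv_bounded_linear[THEN iffD1] linear_compose linear_tangent_proj linv)
  have L_demb: "L (demb c x0 u) = u" for u
    using fun_cong[OF linv(2), of u] by (simp add: L_def S0 tangent_proj_demb c x0)
  have L_0: "tangent_proj S0 Y = 0" if Y: "L Y = 0" "transpose Y = Y" for Y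
  proof -
    obtain u where u: "demb c x0 u = tangent_proj S0 Y"
      using tangent_proj_in_range[OF c x0 Y(2)] S0 by metis
    then have "u = 0" using Y(1) fun_cong[OF linv(2), of u] by (simp add: L_def)
    then show ?thesis using u linear_0[OF linear_demb[OF c x0]] by simp
  qed
  define \<phi>' where "\<phi>' x = Blinfun (\<lambda>u. L (demb c x u))" for x
  have \<phi>'_apply: "blinfun_apply (\<phi>' x) = (\<lambda>u. L (demb c x u))" if "x \<in> fst c" for x
    unfolding \<phi>'_def
    by (rule bounded_linear_Blinfun_apply)
       (intro bounded_linear_compose[OF L] has_derivative_bounded_linear[OF has_derivative_emb[OF c that]])
  have deriv: "((\<lambda>x. L (emb c x)) has_derivative blinfun_apply (\<phi>' x)) (at x)" if "x \<in> fst c" for x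
    unfolding \<phi>'_apply[OF that]
    by (rule bounded_linear.has_derivative[OF L has_derivative_emb[OF c that]])
  have cont: "continuous_on (fst c) \<phi>'"
  proof (rule continuous_on_blinfun_componentwise)
    fix i :: "real^'l^'k" assume "i \<in> Basis"
    have "continuous_on (fst c) (\<lambda>x. L (demb c x i))"
      using Ck_on_demb[OF c, of 0 i] by (auto intro: bounded_linear.continuous_on[OF L])
    then show "continuous_on (fst c) (\<lambda>x. blinfun_apply (\<phi>' x) i)"
      by (rule continuous_on_eq) (simp add: \<phi>'_apply)
  qed
  have inv: "id_blinfun o\<^sub>L \<phi>' x0 = id_blinfun"
    by (rule blinfun_eqI) (simp add: \<phi>'_apply x0 L_demb)
  obtain U V h h' where U: "open U" "U \<subseteq> fst c" "x0 \<in> U" and V: "open V" "L (emb c x0) \<in> V"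
    and hom: "homeomorphism U V (\<lambda>x. L (emb c x)) h"
    and h: "\<And>y. y \<in> V \<Longrightarrow> (h has_derivative (h' y)) (at y)"
    by (rule inverse_function_theorem[OF chart_open[OF c] deriv cont x0 inv]) blast+
  define \<psi> where "\<psi> S = h (L S)" for S
  have \<psi>: "(\<psi> has_derivative (\<lambda>Y. h' (L S0) (L Y))) (at S0)"
    unfolding \<psi>_def
    by (rule has_derivative_compose[OF bounded_linear_imp_has_derivative[OF L] h]) (use V S0 in simp)
  have \<psi>0: "\<psi> S0 = x0" using homeomorphism_apply1[OF hom U(3)] by (simp add: \<psi>_def S0)
  \<comment> \<open>Neighbourhoods of \<open>g0\<close> among the orthogonal matrices, since
    orthogonality makes \<open>reflect g\<close> an involution.\<close>
  let ?F = "inf (nhds g0) (principal {g. orthogonal_matrix g})"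
  have g: "((\<lambda>g. g) \<longlongrightarrow> g0) ?F" by (rule tendsto_mono[OF inf_le1]) (rule filterlim_ident)
  have orth: "\<forall>\<^sub>F g in ?F. orthogonal_matrix g" by (simp add: eventually_inf_principal)
  have refl: "((\<lambda>g. reflect g) \<longlongrightarrow> S0) ?F" unfolding S0_def by (rule tendsto_reflect[OF g])
  have x: "((\<lambda>g. \<psi> (reflect g)) \<longlongrightarrow> x0) ?F"
    using isCont_tendsto_compose[OF has_derivative_continuous[OF \<psi>, unfolded continuous_within[symmetric]] refl] \<psi>0
    by simp
  have "\<forall>\<^sub>F g in ?F. L (reflect g) \<in> V"
    using topological_tendstoD[OF bounded_linear.tendsto[OF L refl] V(1)] V(2) S0 by simp
  then have sol: "\<forall>\<^sub>F g in ?F. \<psi> (reflect g) \<in> fst c \<and> L (emb c (\<psi> (reflect g))) = L (reflect g)"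
  proof eventually_elim
    case (elim g)
    then have "h (L (reflect g)) \<in> U" using hom by (auto simp: homeomorphism_def)
    then show ?case using homeomorphism_apply2[OF hom elim] U by (auto simp: \<psi>_def)
  qed
  have emb: "((\<lambda>g. emb c (\<psi> (reflect g))) \<longlongrightarrow> S0) ?F"
    unfolding S0 by (rule isCont_tendsto_compose[OF has_derivative_continuous[OF has_derivative_emb[OF c x0]] x])
  \<comment> \<open>Both involutions tend to \<open>S0\<close>, so their sum is eventually within
    distance 2 of \<open>2 *\<^sub>R S0\<close>.\<close>
  have "((\<lambda>g. norm (emb c (\<psi> (reflect g)) + reflect g - 2 *\<^sub>R S0)) \<longlongrightarrow> norm (S0 + S0 - 2 *\<^sub>R S0)) ?F"
    by (intro tendsto_intros emb refl)
  then have "\<forall>\<^sub>F g in ?F. norm (emb c (\<psi> (reflect g)) + reflect g - 2 *\<^sub>R S0) < 2"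
    by (rule order_tendstoD(2)) (simp flip: scaleR_2)
  with sol orth have eq: "\<forall>\<^sub>F g in ?F. orthogonal_matrix (snd c (\<psi> (reflect g))) \<and> orthogonal_matrix g
      \<and> reflect (snd c (\<psi> (reflect g))) = reflect g"
  proof eventually_elim
    case (elim g)
    let ?x = "\<psi> (reflect g)"
    have "L (emb c ?x - reflect g) = 0"
      using elim by (simp add: linear_diff[OF bounded_linear.linear[OF L]])
    then have proj: "tangent_proj S0 (emb c ?x - reflect g) = 0"
      by (rule L_0) (simp add: transp_simps transpose_emb transpose_reflect)
    have "S0 ** S0 = mat 1" "transpose S0 = S0"
      unfolding S0_def by (rule reflect_reflect[OF g0(1)], rule transpose_reflect)
    then have "emb c ?x = reflect g"
      by (rule involution_eq_of_tangent_proj[OF _ emb_emb[OF c conjunct1[OF elim(1)]]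
            reflect_reflect[OF elim(2)] _ proj elim(3)])
    then show ?case using elim(1,2) chart_orthogonal[OF c] by (simp only: emb_def)
  qed
  have "((\<lambda>g. snd c (\<psi> (reflect g))) \<longlongrightarrow> snd c x0) ?F"
    by (rule isCont_tendsto_compose[OF has_derivative_continuous[OF chart_has_derivative[OF c x0]] x])
  from eventually_gr_coset_eq_iff[OF this g chart_orthogonal[OF c x0] g0(1) _ eq]
  have "\<forall>\<^sub>F g in ?F. gr_coset (snd c (\<psi> (reflect g))) = gr_coset g"
    using g0(2) reflect_cong_gr_coset[OF g0] by simp
  with sol have "\<forall>\<^sub>F g in ?F. \<psi> (reflect g) \<in> fst c \<and> gr_coset (snd c (\<psi> (reflect g))) = gr_coset g"
    by eventually_elim simp
  with \<psi> that show ?thesis by (auto simp: eventually_inf_principal S0_def)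
qed

text \<open>Stated for arbitrary filters because it is applied both along curves and along the
  parametrization of another chart.\<close>

lemma coord_lift:
  assumes c: "c \<in> gr_charts (gr_coset g0)" and g0: "orthogonal_matrix g0"
  obtains \<psi> \<psi>' where "(\<psi> has_derivative \<psi>') (at (reflect g0))"
    "\<And>F g. (g \<longlongrightarrow> g0) F \<Longrightarrow> \<forall>\<^sub>F x in F. orthogonal_matrix (g x) \<Longrightarrow>
       \<forall>\<^sub>F x in F. c \<in> gr_charts (gr_coset (g x)) \<and>
         gr_coord c (gr_coset (g x)) = \<psi> (reflect (g x))"
proof -
  from c obtain cc: "c \<in> gr_atlas" "gr_coord c (gr_coset g0) \<in> fst c"
    "gr_coset (snd c (gr_coord c (gr_coset g0))) = gr_coset g0"
    by (rule charts_atE)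
  obtain \<psi> \<psi>' where \<psi>: "(\<psi> has_derivative \<psi>') (at (reflect g0))"
    and ev: "\<forall>\<^sub>F g in nhds g0. orthogonal_matrix g \<longrightarrow>
       \<psi> (reflect g) \<in> fst c \<and> gr_coset (snd c (\<psi> (reflect g))) = gr_coset g"
    by (rule chart_coordinates[OF cc(1,2) g0 cc(3)[symmetric]])
  show ?thesis
  proof (rule that[OF \<psi>])
    fix F :: "'c filter" and g assume lim: "(g \<longlongrightarrow> g0) F" and orth: "\<forall>\<^sub>F x in F. orthogonal_matrix (g x)"
    from eventually_compose_filterlim[OF ev lim] orth
    show "\<forall>\<^sub>F x in F. c \<in> gr_charts (gr_coset (g x)) \<and>
         gr_coord c (gr_coset (g x)) = \<psi> (reflect (g x))"
      by eventually_elim (metis charts_at_iff coord_eq cc(1))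
  qed
qed

section \<open>Differentiating fields along curves\<close>

lemma has_vector_derivative_transform_eventually:
  assumes "(f has_vector_derivative f') (at t within T)" "t \<in> T"
    and "\<forall>\<^sub>F s in at t within T. f s = g s" "f t = g t"
  shows "(g has_vector_derivative f') (at t within T)"
  using has_derivative_transform_eventually[OF _ assms(3,4,2)] assms(1)
  by (simp add: has_vector_derivative_def)

lemma has_vector_derivative_compose:
  assumes "(f has_vector_derivative f') (at t within T)" "(g has_derivative g') (at (f t))"
  shows "((\<lambda>s. g (f s)) has_vector_derivative g' f') (at t within T)"
  using has_derivative_compose[OF assms(1)[unfolded has_vector_derivative_def] assms(2)]
    linear_cmul[OF has_derivative_linear[OF assms(2)]]
  by (simp add: has_vector_derivative_def)

text \<open>Because \<open>g\<close> vanishes at \<open>t\<close>, continuity of \<open>f\<close> at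
  \<open>t\<close> suffices for the product rule. Below, \<open>f\<close> is a component of a field
  whose differentiability is still to be proved.\<close>

lemma has_vector_derivative_scaleR_null:
  fixes f :: "real \<Rightarrow> real" and g :: "real \<Rightarrow> 'a::real_normed_vector"
  assumes g: "(g has_vector_derivative g') (at t within T)" "g t = 0"
    and f: "(f \<longlongrightarrow> f t) (at t within T)"
  shows "((\<lambda>s. f s *\<^sub>R g s) has_vector_derivative f t *\<^sub>R g') (at t within T)"
proof -
  let ?q = "\<lambda>s. (g s - g t - (s - t) *\<^sub>R g') /\<^sub>R norm (s - t)"
  have q: "(?q \<longlongrightarrow> 0) (at t within T)"
    using g(1) by (simp add: has_vector_derivative_def has_derivative_at_within)
  have "((\<lambda>s. (f s - f t) *\<^sub>R (((s - t) / \<bar>s - t\<bar>) *\<^sub>R g')) \<longlongrightarrow> 0) (at t within T)"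
  proof (rule Lim_null_comparison[OF always_eventually], rule allI)
    show "((\<lambda>s. \<bar>f s - f t\<bar> * norm g') \<longlongrightarrow> 0) (at t within T)"
      using f by (intro tendsto_mult_left_zero tendsto_rabs_zero LIM_zero)
    show "norm ((f s - f t) *\<^sub>R (((s - t) / \<bar>s - t\<bar>) *\<^sub>R g')) \<le> \<bar>f s - f t\<bar> * norm g'" for s
      by (cases "s = t") (auto simp: abs_mult)
  qed
  from tendsto_add[OF tendsto_scaleR[OF f q] this]
  have "((\<lambda>s. f s *\<^sub>R ?q s + (f s - f t) *\<^sub>R (((s - t) / \<bar>s - t\<bar>) *\<^sub>R g')) \<longlongrightarrow> 0) (at t within T)"
    by simp
  then have "((\<lambda>s. (f s *\<^sub>R g s - f t *\<^sub>R g t - (s - t) *\<^sub>R (f t *\<^sub>R g')) /\<^sub>R norm (s - t)) \<longlongrightarrow> 0) (at t within T)"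
    by (rule Lim_transform_eventually) (auto intro!: always_eventually simp: g(2) algebra_simps divide_inverse)
  then show ?thesis
    unfolding has_vector_derivative_def has_derivative_at_within by (intro conjI bounded_linear_scaleR_left)
qed

context
  fixes c :: "('k::finite, 'l::finite) gr_chart" and x :: "real \<Rightarrow> real^'l^'k" and x' and t :: real and T
  assumes c: "c \<in> gr_atlas" and x: "(x has_vector_derivative x') (at t within T)"
    and xt: "x t \<in> fst c" and t: "t \<in> T"
begin

lemma eventually_in_chart: "\<forall>\<^sub>F s in at t within T. x s \<in> fst c"
  using has_vector_derivative_continuous[OF x] chart_open[OF c] xt
  by (auto simp: continuous_within dest: topological_tendstoD)

lemma has_vector_derivative_demb_const:
  "((\<lambda>s. demb c (x s) b) has_vector_derivative d2emb c (x t) x' b) (at t within T)"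
  by (rule has_vector_derivative_compose[OF x has_derivative_demb[OF c xt]])

lemma demb_sum_Basis: "y \<in> fst c \<Longrightarrow> demb c y u = (\<Sum>b\<in>Basis. (u \<bullet> b) *\<^sub>R demb c y b)"
  using linear_sum[OF linear_demb[OF c], of y "\<lambda>b. (u \<bullet> b) *\<^sub>R b" Basis] linear_cmul[OF linear_demb[OF c]]
  by (simp add: euclidean_representation)

text \<open>\<open>has_derivative_demb\<close> fixes the vector argument, so the field is expanded
  in the basis and the product rule is applied to each component.\<close>

lemma has_vector_derivative_demb_field:
  assumes X: "(X has_vector_derivative X') (at t within T)"
  shows "((\<lambda>s. demb c (x s) (X s)) has_vector_derivative demb c (x t) X' + d2emb c (x t) x' (X t)) (at t within T)"
proof -
  have "((\<lambda>s. X s \<bullet> b) has_vector_derivative X' \<bullet> b) (at t within T)" for b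
    by (rule bounded_linear.has_vector_derivative[OF bounded_linear_inner_left X])
  then have "((\<lambda>s. \<Sum>b\<in>Basis. (X s \<bullet> b) *\<^sub>R demb c (x s) b) has_vector_derivative
      (\<Sum>b\<in>Basis. (X t \<bullet> b) *\<^sub>R d2emb c (x t) x' b + (X' \<bullet> b) *\<^sub>R demb c (x t) b)) (at t within T)"
    by (intro has_vector_derivative_sum bounded_bilinear.has_vector_derivative[OF bounded_bilinear_scaleR]
        has_vector_derivative_demb_const)
  also have "(\<Sum>b\<in>Basis. (X t \<bullet> b) *\<^sub>R d2emb c (x t) x' b + (X' \<bullet> b) *\<^sub>R demb c (x t) b)
      = demb c (x t) X' + d2emb c (x t) x' (X t)"
  proof -
    have lin: "linear (\<lambda>v. d2emb c (x t) x' v)"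
      using linear_d2emb[OF c xt, of x'] d2emb_commute[OF c xt, of x'] by simp
    have "d2emb c (x t) x' (X t) = (\<Sum>b\<in>Basis. (X t \<bullet> b) *\<^sub>R d2emb c (x t) x' b)"
      using linear_sum[OF lin, of "\<lambda>b. (X t \<bullet> b) *\<^sub>R b" Basis] linear_cmul[OF lin]
      by (simp add: euclidean_representation)
    then show ?thesis by (simp add: demb_sum_Basis[OF xt, of X'] sum.distrib add.commute)
  qed
  finally show ?thesis
    by (rule has_vector_derivative_transform_eventually[OF _ t])
       (use eventually_in_chart demb_sum_Basis xt in \<open>auto elim!: eventually_mono\<close>)
qed

text \<open>A field along a curve is differentiable in coordinates if its image in the ambient space is:
  apply a left inverse \<open>L\<close> of the differential at the base point; the error \<open>L \<circ> demb c (x s) - id\<close>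
  vanishes there.\<close>

lemma differentiable_of_demb_field:
  assumes Y: "(Y has_vector_derivative Y') (at t within T)"
    and XY: "\<forall>\<^sub>F s in at t within T. demb c (x s) (X s) = Y s" "demb c (x t) (X t) = Y t"
  shows "X differentiable (at t within T)"
proof -
  obtain L where L: "linear L" "L \<circ> demb c (x t) = id"
    using linear_injective_left_inverse[OF linear_demb[OF c xt] demb_inj[OF c xt]] by blast
  have bl: "bounded_linear L" using L(1) by (rule linear_conv_bounded_linear[THEN iffD1])
  define B where "B b s = L (demb c (x s) b) - b" for b s
  have B: "(B b has_vector_derivative L (d2emb c (x t) x' b)) (at t within T)" for b
    unfolding B_def using bounded_linear.has_vector_derivative[OF bl has_vector_derivative_demb_const[of b]]
    by (auto intro!: derivative_eq_intros)
  have B0: "B b t = 0" for b using fun_cong[OF L(2), of b] by (simp add: B_def)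
  have LY: "((\<lambda>s. L (Y s)) has_vector_derivative L Y') (at t within T)"
    by (rule bounded_linear.has_vector_derivative[OF bl Y])
  \<comment> \<open>An implicit equation for \<open>X\<close>, whose coefficients
    \<open>B b s\<close> on the right vanish at \<open>t\<close>.\<close>
  have X_eq: "X s = L (Y s) - (\<Sum>b\<in>Basis. (X s \<bullet> b) *\<^sub>R B b s)" if "x s \<in> fst c" "demb c (x s) (X s) = Y s" for s
  proof -
    have "L (Y s) = (\<Sum>b\<in>Basis. (X s \<bullet> b) *\<^sub>R L (demb c (x s) b))"
      unfolding that(2)[symmetric]
      by (subst demb_sum_Basis[OF that(1)]) (simp add: linear_sum[OF L(1)] linear_cmul[OF L(1)])
    then show ?thesis
      by (simp add: B_def scaleR_diff_right sum_subtractf euclidean_representation)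
  qed
  have ev: "\<forall>\<^sub>F s in at t within T. X s = L (Y s) - (\<Sum>b\<in>Basis. (X s \<bullet> b) *\<^sub>R B b s)"
    using eventually_in_chart XY(1) by eventually_elim (rule X_eq)
  have XtY: "X t = L (Y t)" using X_eq[OF xt XY(2)] by (simp add: B0)
  define \<beta> where "\<beta> s = (\<Sum>b\<in>Basis. norm (B b s))" for s
  have err: "norm (\<Sum>b\<in>Basis. (X s \<bullet> b) *\<^sub>R B b s) \<le> norm (X s) * \<beta> s" for s
  proof -
    have "norm (\<Sum>b\<in>Basis. (X s \<bullet> b) *\<^sub>R B b s) \<le> (\<Sum>b\<in>Basis. norm (X s) * norm (B b s))"
      by (rule sum_norm_le) (auto intro!: mult_right_mono Basis_le_norm)
    then show ?thesis by (simp add: \<beta>_def sum_distrib_left)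
  qed
  have "((\<lambda>s. norm (B b s)) \<longlongrightarrow> norm (B b t)) (at t within T)" for b
    using has_vector_derivative_continuous[OF B[of b]] by (auto simp: continuous_within intro: tendsto_norm)
  then have \<beta>: "(\<beta> \<longlongrightarrow> 0) (at t within T)"
    unfolding \<beta>_def by (auto intro!: tendsto_null_sum simp: B0)
  have LYlim: "((\<lambda>s. L (Y s)) \<longlongrightarrow> X t) (at t within T)"
    using has_vector_derivative_continuous[OF LY] by (simp add: continuous_within XtY)
  \<comment> \<open>Once \<open>\<beta> s\<close> is below 1/2, the error term is absorbed into the
    left side, which bounds \<open>X\<close> near \<open>t\<close> before its continuity is
    known.\<close>
  have "\<forall>\<^sub>F s in at t within T. \<beta> s < 1/2" using \<beta> by (rule order_tendstoD) simp
  moreover have "\<forall>\<^sub>F s in at t within T. norm (L (Y s)) < norm (X t) + 1"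
    using tendsto_norm[OF LYlim] by (rule order_tendstoD) simp
  ultimately have bnd: "\<forall>\<^sub>F s in at t within T. norm (X s) \<le> 2 * (norm (X t) + 1)"
    using ev
  proof eventually_elim
    case (elim s)
    have "norm (X s) \<le> norm (L (Y s)) + norm (\<Sum>b\<in>Basis. (X s \<bullet> b) *\<^sub>R B b s)"
      by (subst elim(3)) (rule norm_triangle_ineq4)
    also have "\<dots> \<le> (norm (X t) + 1) + norm (X s) * \<beta> s"
      using elim(2) err[of s] by linarith
    also have "norm (X s) * \<beta> s \<le> norm (X s) * (1/2)"
      using elim(1) by (intro mult_left_mono) auto
    finally show ?case by simp
  qed
  \<comment> \<open>Boundedness of \<open>X\<close> and vanishing of \<open>\<beta>\<close> give
    continuity at \<open>t\<close>, just what \<open>has_vector_derivative_scaleR_null\<close>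
    requires.\<close>
  have "((\<lambda>s. X s - L (Y s)) \<longlongrightarrow> 0) (at t within T)"
  proof (rule Lim_null_comparison)
    show "((\<lambda>s. 2 * (norm (X t) + 1) * \<beta> s) \<longlongrightarrow> 0) (at t within T)"
      by (rule tendsto_mult_right_zero[OF \<beta>])
    show "\<forall>\<^sub>F s in at t within T. norm (X s - L (Y s)) \<le> 2 * (norm (X t) + 1) * \<beta> s"
      using bnd ev
    proof eventually_elim
      case (elim s)
      have "X s - L (Y s) = - (\<Sum>b\<in>Basis. (X s \<bullet> b) *\<^sub>R B b s)"
        using elim(2) by (simp add: algebra_simps)
      then have "norm (X s - L (Y s)) \<le> norm (X s) * \<beta> s" using err[of s] by simp
      also have "\<dots> \<le> 2 * (norm (X t) + 1) * \<beta> s"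
        using elim(1) by (intro mult_right_mono) (auto simp: \<beta>_def sum_nonneg)
      finally show ?case .
    qed
  qed
  from tendsto_add[OF this LYlim] have Xlim: "(X \<longlongrightarrow> X t) (at t within T)" by simp
  have "((\<lambda>s. L (Y s) - (\<Sum>b\<in>Basis. (X s \<bullet> b) *\<^sub>R B b s)) has_vector_derivative
      (L Y' - (\<Sum>b\<in>Basis. (X t \<bullet> b) *\<^sub>R L (d2emb c (x t) x' b)))) (at t within T)"
    by (intro has_vector_derivative_diff LY has_vector_derivative_sum has_vector_derivative_scaleR_null
        B B0 tendsto_inner Xlim tendsto_const)
  then have "(X has_vector_derivative (L Y' - (\<Sum>b\<in>Basis. (X t \<bullet> b) *\<^sub>R L (d2emb c (x t) x' b)))) (at t within T)"
    by (rule has_vector_derivative_transform_eventually[OF _ t])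
       (use ev XtY in \<open>auto elim!: eventually_mono simp: B0\<close>)
  then show ?thesis by (rule differentiableI_vector)
qed

end

text \<open>The Gauss formula: in the ambient derivative of the field, the second-derivative term
  has the Christoffel term as its tangential part, and the remaining term is already
  tangential.\<close>

lemma demb_cov_deriv:
  assumes c: "c \<in> gr_charts (\<gamma> t)" and t: "t \<in> T" "at t within T \<noteq> bot"
    and x: "(\<lambda>s. gr_coord c (\<gamma> s)) differentiable (at t within T)"
    and X: "(\<lambda>s. X s c) differentiable (at t within T)"
    and Y: "(Y has_vector_derivative Y') (at t within T)"
      "\<forall>\<^sub>F s in at t within T. demb c (gr_coord c (\<gamma> s)) (X s c) = Y s"
      "demb c (gr_coord c (\<gamma> t)) (X t c) = Y t"
  shows "demb c (gr_coord c (\<gamma> t)) (cov_deriv grassmannian T \<gamma> X t c)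
    = tangent_proj (emb c (gr_coord c (\<gamma> t))) Y'"
proof -
  let ?x = "\<lambda>s. gr_coord c (\<gamma> s)"
  define X' where "X' = vector_derivative (\<lambda>s. X s c) (at t within T)"
  define x' where "x' = vector_derivative ?x (at t within T)"
  from c obtain cc: "c \<in> gr_atlas" "?x t \<in> fst c" by (rule charts_atE)
  have "((\<lambda>s. demb c (?x s) (X s c)) has_vector_derivative demb c (?x t) X' + d2emb c (?x t) x' (X t c)) (at t within T)"
    unfolding X'_def x'_def
    by (rule has_vector_derivative_demb_field[OF cc(1) vector_derivative_works[THEN iffD1, OF x] cc(2) t(1)
          vector_derivative_works[THEN iffD1, OF X]])
  then have "(Y has_vector_derivative demb c (?x t) X' + d2emb c (?x t) x' (X t c)) (at t within T)"
    by (rule has_vector_derivative_transform_eventually[OF _ t(1) Y(2,3)])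
  then have Y': "Y' = demb c (?x t) X' + d2emb c (?x t) x' (X t c)"
    by (rule vector_derivative_unique_within[OF t(2) Y(1)])
  have "cov_deriv grassmannian T \<gamma> X t c = X' + christoffel (metric grassmannian c) (?x t) x' (X t c)"
    using c by (simp add: cov_deriv_def velocity_def X'_def x'_def)
  then show ?thesis
    by (simp add: Y' linear_add[OF linear_demb[OF cc]] linear_add[OF linear_tangent_proj]
        demb_christoffel[OF cc] tangent_proj_demb[OF cc])
qed

section \<open>Curves of cosets with a continuous lift and a differentiable involution\<close>

context
  fixes g :: "real \<Rightarrow> ('k::finite, 'l::finite) mat" and \<gamma> t T S' and c :: "('k, 'l) gr_chart"
  assumes \<gamma>: "\<And>s. \<gamma> s = gr_coset (g s)" and g: "\<And>s. s \<in> T \<Longrightarrow> orthogonal_matrix (g s)"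
    "(g \<longlongrightarrow> g t) (at t within T)"
    and S': "((\<lambda>s. reflect (g s)) has_vector_derivative S') (at t within T)"
    and t: "t \<in> T" "at t within T \<noteq> bot" and c: "c \<in> gr_charts (\<gamma> t)"
begin

lemma lift_coord_aux:
  obtains \<psi> \<psi>' where "(\<psi> has_derivative \<psi>') (at (reflect (g t)))"
    "\<forall>\<^sub>F s in at t within T. c \<in> gr_charts (\<gamma> s) \<and> gr_coord c (\<gamma> s) = \<psi> (reflect (g s))"
    "gr_coord c (\<gamma> t) = \<psi> (reflect (g t))"
proof -
  obtain \<psi> \<psi>' where \<psi>: "(\<psi> has_derivative \<psi>') (at (reflect (g t)))"
    "\<And>F h. ((h :: real \<Rightarrow> _) \<longlongrightarrow> g t) F \<Longrightarrow> \<forall>\<^sub>F x in F. orthogonal_matrix (h x) \<Longrightarrow>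
       \<forall>\<^sub>F x in F. c \<in> gr_charts (gr_coset (h x)) \<and>
         gr_coord c (gr_coset (h x)) = \<psi> (reflect (h x))"
    by (rule coord_lift[OF c[unfolded \<gamma>] g(1)[OF t(1)]]) blast
  have "\<forall>\<^sub>F s in at t within T. orthogonal_matrix (g s)"
    using g(1) by (auto simp: eventually_at_filter)
  from \<psi>(2)[OF g(2) this]
  have "\<forall>\<^sub>F s in at t within T. c \<in> gr_charts (\<gamma> s) \<and> gr_coord c (\<gamma> s) = \<psi> (reflect (g s))"
    by (simp add: \<gamma>)
  \<comment> \<open>The filter leaves out the point \<open>t\<close> itself; the constant family
    supplies the equation there.\<close>
  moreover have "\<forall>\<^sub>F s in at t within T. c \<in> gr_charts (gr_coset (g t)) \<and>
      gr_coord c (gr_coset (g t)) = \<psi> (reflect (g t))"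
    by (rule \<psi>(2)[OF tendsto_const]) (simp add: g t)
  then have "gr_coord c (\<gamma> t) = \<psi> (reflect (g t))"
    using t(2) by (simp add: eventually_const \<gamma>)
  ultimately show ?thesis using that \<psi>(1) by blast
qed

lemma lift_eventually_chart: "\<forall>\<^sub>F s in at t within T. c \<in> gr_charts (\<gamma> s)"
  by (rule lift_coord_aux) (auto elim: eventually_mono)

lemma lift_coord_differentiable: "(\<lambda>s. gr_coord c (\<gamma> s)) differentiable (at t within T)"
proof (rule lift_coord_aux)
  fix \<psi> \<psi>' assume \<psi>: "(\<psi> has_derivative \<psi>') (at (reflect (g t)))"
    "\<forall>\<^sub>F s in at t within T. c \<in> gr_charts (\<gamma> s) \<and> gr_coord c (\<gamma> s) = \<psi> (reflect (g s))"
    "gr_coord c (\<gamma> t) = \<psi> (reflect (g t))"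
  have "((\<lambda>s. gr_coord c (\<gamma> s)) has_vector_derivative \<psi>' S') (at t within T)"
    by (rule has_vector_derivative_transform_eventually[OF has_vector_derivative_compose[OF S' \<psi>(1)] t(1)])
       (use \<psi> in \<open>auto elim!: eventually_mono\<close>)
  then show ?thesis by (rule differentiableI_vector)
qed

text \<open>Near \<open>t\<close> the embedding in coordinates is \<open>reflect (g s)\<close>, so
  the chain rule and uniqueness of derivatives identify the image of the velocity.\<close>

lemma lift_demb_velocity: "demb c (gr_coord c (\<gamma> t)) (velocity grassmannian T \<gamma> t c) = S'"
proof -
  let ?x = "\<lambda>s. gr_coord c (\<gamma> s)"
  have vel: "velocity grassmannian T \<gamma> t c = vector_derivative ?x (at t within T)"
    using c by (simp add: velocity_def)
  have emb: "emb c (?x s) = reflect (g s)" if "c \<in> gr_charts (\<gamma> s)" for s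
  proof -
    from that have cs: "c \<in> gr_atlas" "?x s \<in> fst c" "gr_coset (snd c (?x s)) = \<gamma> s"
      by (auto elim: charts_atE)
    then show ?thesis
      unfolding emb_def by (intro reflect_cong_gr_coset chart_orthogonal) (simp_all add: \<gamma>)
  qed
  from c obtain cc: "c \<in> gr_atlas" "?x t \<in> fst c" by (rule charts_atE)
  have "((\<lambda>s. emb c (?x s)) has_vector_derivative demb c (?x t) (vector_derivative ?x (at t within T))) (at t within T)"
    by (rule has_vector_derivative_compose[OF
          vector_derivative_works[THEN iffD1, OF lift_coord_differentiable] has_derivative_emb[OF cc]])
  then have "((\<lambda>s. reflect (g s)) has_vector_derivative demb c (?x t) (vector_derivative ?x (at t within T))) (at t within T)"
    by (rule has_vector_derivative_transform_eventually[OF _ t(1)])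
       (use lift_eventually_chart emb c in \<open>auto elim!: eventually_mono\<close>)
  then show ?thesis unfolding vel by (rule vector_derivative_unique_within[OF t(2) _ S'])
qed

end

section \<open>Charts from the Cayley transform\<close>

definition cayley_inv :: "real^'n^'n \<Rightarrow> real^'n^'n" where
  "cayley_inv X = matrix_inv (mat 1 - X)"

text \<open>For invertible \<open>1 - X\<close> this is
  \<open>(1 + X) (1 - X)\<^sup>-\<^sup>1\<close>, written as an affine function of the inverse so
  that smoothness reduces to that of \<open>cayley_inv\<close>.\<close>

definition cayley :: "real^'n^'n \<Rightarrow> real^'n^'n" where
  "cayley X = 2 *\<^sub>R cayley_inv X - mat 1"

context
  fixes X :: "real^'n^'n"
  assumes skew: "transpose X = - X" and small: "norm X < 1/4"
begin

text \<open>A kernel vector of \<open>mat 1 - X\<close> is fixed by \<open>X\<close>, which the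
  bound for skew matrices excludes when \<open>X\<close> is small.\<close>

lemma cayley_inv_inverse: "cayley_inv X ** (mat 1 - X) = mat 1" "(mat 1 - X) ** cayley_inv X = mat 1"
proof -
  have "v = 0" if "(mat 1 - X) *v v = 0" for v
  proof (rule ccontr)
    assume v: "v \<noteq> 0"
    have "X *v v = v" using that by (simp add: matrix_vector_mult_diff_rdistrib)
    then have "2 * (norm v)\<^sup>2 \<le> (norm X)\<^sup>2 * (norm v)\<^sup>2"
      using skew_matrix_vector_bound[OF skew, of v] by simp
    then have "2 \<le> (norm X)\<^sup>2" using v by simp
    moreover have "(norm X)\<^sup>2 \<le> 1\<^sup>2" using small by (intro power_mono) auto
    ultimately show False by simp
  qed
  then have "\<exists>B. B ** (mat 1 - X) = mat 1" by (subst matrix_left_invertible_ker) blast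
  then have "invertible (mat 1 - X)" using matrix_left_right_inverse by (auto simp: invertible_def)
  then have "(mat 1 - X) ** cayley_inv X = mat 1 \<and> cayley_inv X ** (mat 1 - X) = mat 1"
    unfolding cayley_inv_def matrix_inv_def invertible_def by (rule someI_ex)
  then show "cayley_inv X ** (mat 1 - X) = mat 1" "(mat 1 - X) ** cayley_inv X = mat 1"
    by simp_all
qed

lemma transpose_cayley_inv_inverse:
  "transpose (cayley_inv X) ** (mat 1 + X) = mat 1" "(mat 1 + X) ** transpose (cayley_inv X) = mat 1"
  using arg_cong[OF cayley_inv_inverse(2), of transpose] arg_cong[OF cayley_inv_inverse(1), of transpose]
  by (simp_all add: matrix_transpose_mul transp_simps skew)

text \<open>Write 2 as \<open>(1 - X) + (1 + X)\<close> between the two inverses.\<close>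

lemma cayley_inv_transpose_mult:
  "2 *\<^sub>R (transpose (cayley_inv X) ** cayley_inv X) = transpose (cayley_inv X) + cayley_inv X"
proof -
  let ?N = "cayley_inv X" and ?M = "transpose (cayley_inv X)"
  have "?M ** ((mat 1 - X) + (mat 1 + X)) ** ?N = ?M ** ((mat 1 - X) ** ?N) + (?M ** (mat 1 + X)) ** ?N"
    by (simp only: matmul.add_left matmul.add_right matrix_mul_assoc)
  also have "\<dots> = ?M + ?N" by (simp add: cayley_inv_inverse transpose_cayley_inv_inverse)
  also have "(mat 1 - X) + (mat 1 + X) = 2 *\<^sub>R mat 1" by (simp add: vec_eq_iff)
  finally show ?thesis by (simp add: matmul.scaleR_left matmul.scaleR_right)
qed

lemma orthogonal_cayley: "orthogonal_matrix (cayley X)"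
proof -
  have "transpose (cayley X) ** cayley X = 2 *\<^sub>R (2 *\<^sub>R (transpose (cayley_inv X) ** cayley_inv X)
      - (transpose (cayley_inv X) + cayley_inv X)) + mat 1"
    by (simp add: cayley_def matrix_ring_simps vec_eq_iff algebra_simps)
  then show ?thesis by (simp add: orthogonal_matrix cayley_inv_transpose_mult)
qed

lemma cayley_mult: "cayley X ** (mat 1 - X) = mat 1 + X"
  by (simp add: cayley_def matmul.diff_left matmul.scaleR_left cayley_inv_inverse vec_eq_iff)

text \<open>\<open>mat 1 + X\<close> is the transpose of \<open>mat 1 - X\<close>, so the two have
  the same nonzero determinant and their quotient has determinant 1.\<close>

lemma rotation_cayley: "rotation_matrix (cayley X)"
proof -
  have t: "transpose (mat 1 - X) = mat 1 + X" by (simp add: transp_simps skew)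
  have "det (cayley X) * det (mat 1 - X) = det (mat 1 - X)"
    using arg_cong[OF cayley_mult, of det] det_transpose[of "mat 1 - X"] by (simp add: det_mul t)
  moreover have "det (mat 1 - X) \<noteq> 0"
    using arg_cong[OF cayley_inv_inverse(1), of det] by (auto simp: det_mul)
  ultimately show ?thesis using orthogonal_cayley by (simp add: rotation_matrix_def)
qed

lemma norm_cayley_diff: "norm (cayley X - mat 1) < 1/2"
proof -
  have "cayley X - mat 1 = cayley X ** X + X"
    using cayley_mult by (simp add: matmul.diff_right algebra_simps)
  then have "norm (cayley X - mat 1) \<le> norm X + norm X"
    using norm_triangle_ineq[of "cayley X ** X" X] by (simp add: norm_orthogonal_mult_left orthogonal_cayley)
  then show ?thesis using small by simp
qed

text \<open>The equation \<open>N = 1 + N X\<close> bounds \<open>N\<close> in terms of itself with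
  factor 1/4. The bound is uniform in \<open>X\<close>, as the remainder estimate for the derivative
  needs.\<close>

lemma norm_cayley_inv: "norm (cayley_inv X) \<le> 2 * norm (mat 1 :: real^'n^'n)"
proof -
  have "cayley_inv X = mat 1 + cayley_inv X ** X"
    using cayley_inv_inverse(1) by (simp add: matmul.diff_right algebra_simps)
  then have "norm (cayley_inv X) \<le> norm (mat 1 :: real^'n^'n) + norm (cayley_inv X ** X)"
    by (metis norm_triangle_ineq)
  also have "norm (cayley_inv X ** X) \<le> norm (cayley_inv X) * (1/4)"
    by (rule order_trans[OF norm_matrix_mult mult_left_mono]) (use small in auto)
  finally have "norm (cayley_inv X) * (3/4) \<le> norm (mat 1 :: real^'n^'n)" by simp
  then show ?thesis using norm_ge_zero[of "cayley_inv X"] by linarith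
qed

lemma transpose_cayley_mult_cayley_inv: "transpose (cayley X) ** cayley_inv X = transpose (cayley_inv X)"
  by (simp add: cayley_def matrix_ring_simps cayley_inv_transpose_mult)

end

lemma cayley_inv_diff:
  fixes X Y :: "real^'n^'n"
  assumes "transpose X = - X" "norm X < 1/4" "transpose Y = - Y" "norm Y < 1/4"
  shows "cayley_inv Y - cayley_inv X = cayley_inv Y ** (Y - X) ** cayley_inv X"
proof -
  have "cayley_inv Y ** ((mat 1 - X) - (mat 1 - Y)) ** cayley_inv X
      = cayley_inv Y ** ((mat 1 - X) ** cayley_inv X) - (cayley_inv Y ** (mat 1 - Y)) ** cayley_inv X"
    by (simp only: matmul.diff_left matmul.diff_right matrix_mul_assoc)
  also have "\<dots> = cayley_inv Y - cayley_inv X"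
    by (simp only: cayley_inv_inverse[OF assms(1,2)] cayley_inv_inverse[OF assms(3,4)]
        matrix_mul_rid matrix_mul_lid)
  finally show ?thesis by simp
qed

lemma cayley_inj:
  fixes X Y :: "real^'n^'n"
  assumes "transpose X = - X" "norm X < 1/4" "transpose Y = - Y" "norm Y < 1/4" and eq: "cayley X = cayley Y"
  shows "X = Y"
proof -
  have N: "cayley_inv X = cayley_inv Y" using eq by (simp add: cayley_def)
  have "mat 1 - X = (mat 1 - X) ** (cayley_inv Y ** (mat 1 - Y))" by (simp add: cayley_inv_inverse[OF assms(3,4)])
  also have "\<dots> = mat 1 - Y" unfolding N[symmetric] by (simp add: cayley_inv_inverse[OF assms(1,2)] matrix_mul_assoc)
  finally show ?thesis by simp
qed

text \<open>Conjugation by \<open>refl0\<close> sends \<open>X\<close> to \<open>- X\<close>, which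
  is its transpose; the inverse is carried along.\<close>

lemma refl0_conj_inverse:
  fixes X :: "('k::finite, 'l::finite) mat"
  assumes X: "transpose X = - X" "norm X < 1/4" and J: "refl0 ** X ** refl0 = - X"
  shows "refl0 ** cayley_inv X ** refl0 = transpose (cayley_inv X)"
    "refl0 ** transpose (cayley_inv X) ** refl0 = cayley_inv X"
proof -
  let ?N = "cayley_inv X"
  have J2: "refl0 ** (mat 1 - X) ** refl0 = mat 1 + X"
    by (simp add: matmul.diff_left matmul.diff_right J refl0_refl0)
  have "(refl0 ** ?N ** refl0) ** (mat 1 + X) = refl0 ** (?N ** (mat 1 - X)) ** refl0"
    unfolding J2[symmetric] by (simp add: refl0_cancel flip: matrix_mul_assoc)
  then have "(refl0 ** ?N ** refl0) ** (mat 1 + X) = mat 1"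
    by (simp add: cayley_inv_inverse[OF X] refl0_refl0)
  then have "(refl0 ** ?N ** refl0) ** ((mat 1 + X) ** transpose ?N) = transpose ?N"
    by (simp add: matrix_mul_assoc)
  then show 1: "refl0 ** ?N ** refl0 = transpose ?N"
    by (simp add: transpose_cayley_inv_inverse[OF X])
  show "refl0 ** transpose ?N ** refl0 = ?N"
    unfolding 1[symmetric] by (simp add: refl0_cancel refl0_refl0 flip: matrix_mul_assoc)
qed

text \<open>Radius 1/4 keeps \<open>cayley\<close> within 1/2 of the identity. This makes squaring
  injective on its values by \<open>square_root_unique_near\<close>, and \<open>U C + C U\<close>
  injective in \<open>U\<close>, which gives the immersion condition.\<close>

definition cayley_dom :: "(real^'l^'k) set" where
  "cayley_dom = {x. norm (hat x :: ('k::finite, 'l::finite) mat) < 1/4}"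

definition cayley_chart :: "('k::finite, 'l::finite) mat \<Rightarrow> ('k, 'l) gr_chart" where
  "cayley_chart Q = (cayley_dom, \<lambda>x. Q ** cayley (hat x))"

lemma bounded_linear_hat: "bounded_linear hat"
  using linear_hat by (rule linear_conv_bounded_linear[THEN iffD1])

lemma open_cayley_dom: "open cayley_dom"
  unfolding cayley_dom_def
  by (intro open_Collect_less continuous_intros bounded_linear.continuous_on[OF bounded_linear_hat])

text \<open>Using the resolvent identity \<open>cayley_inv_diff\<close> twice leaves a remainder
  that is quadratic in \<open>y - x\<close>.\<close>

lemma has_derivative_cayley_inv:
  fixes x :: "real^'l::finite^'k::finite"
  assumes x: "x \<in> cayley_dom"
  shows "((\<lambda>x. cayley_inv (hat x)) has_derivative (\<lambda>v. cayley_inv (hat x) ** hat v ** cayley_inv (hat x))) (at x)"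
  unfolding has_derivative_iff_norm
proof
  let ?N = "\<lambda>x. cayley_inv (hat x :: ('k, 'l) mat)"
  show "bounded_linear (\<lambda>v. ?N x ** hat v ** ?N x)"
    by (intro bounded_linear_compose[OF matmul.bounded_linear_left]
        bounded_linear_compose[OF matmul.bounded_linear_right] bounded_linear_hat)
  define K where "K = 2 * norm (mat 1 :: ('k, 'l) mat)"
  obtain H where H0: "0 \<le> H" and H: "\<And>v. norm (hat v :: ('k, 'l) mat) \<le> norm v * H"
    using bounded_linear.nonneg_bounded[OF bounded_linear_hat] by blast
  have K: "norm (?N y) \<le> K" if "y \<in> cayley_dom" for y
    using that norm_cayley_inv[OF transpose_hat] by (simp add: cayley_dom_def K_def)
  have bound: "norm (?N y - ?N x - ?N x ** hat (y - x) ** ?N x) \<le> K ^ 3 * (norm (y - x) * H)\<^sup>2"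
    if y: "y \<in> cayley_dom" for y
  proof -
    have d: "?N y - ?N x = ?N y ** hat (y - x) ** ?N x"
      using x y by (subst cayley_inv_diff) (auto simp: transpose_hat cayley_dom_def linear_diff[OF linear_hat])
    have "?N y - ?N x - ?N x ** hat (y - x) ** ?N x = (?N y - ?N x) ** hat (y - x) ** ?N x"
      by (simp only: matmul.diff_left d[symmetric])
    also have "\<dots> = ?N y ** hat (y - x) ** ?N x ** hat (y - x) ** ?N x" by (simp only: d)
    also have "norm \<dots> \<le> norm (?N y) * norm (hat (y - x) :: ('k, 'l) mat) * norm (?N x) * norm (hat (y - x) :: ('k, 'l) mat) * norm (?N x)"
      by (intro norm_matrix_mult[THEN order_trans] mult_right_mono order_refl) auto
    also have "\<dots> \<le> K * (norm (y - x) * H) * K * (norm (y - x) * H) * K"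
      by (intro mult_mono K x y H mult_nonneg_nonneg) (auto simp: K_def H0)
    finally show ?thesis by (simp add: power2_eq_square power3_eq_cube mult_ac)
  qed
  show "((\<lambda>y. norm (?N y - ?N x - ?N x ** hat (y - x) ** ?N x) / norm (y - x)) \<longlongrightarrow> 0) (at x)"
  proof (rule Lim_null_comparison)
    have "((\<lambda>y. K ^ 3 * H\<^sup>2 * norm (y - x)) \<longlongrightarrow> K ^ 3 * H\<^sup>2 * norm (x - x)) (at x)" by (intro tendsto_intros)
    then show "((\<lambda>y. K ^ 3 * H\<^sup>2 * norm (y - x)) \<longlongrightarrow> 0) (at x)" by simp
    have "\<forall>\<^sub>F y in at x. y \<in> cayley_dom"
      using x open_cayley_dom eventually_at_topological by blast
    then show "\<forall>\<^sub>F y in at x. norm (norm (?N y - ?N x - ?N x ** hat (y - x) ** ?N x) / norm (y - x)) \<le> K ^ 3 * H\<^sup>2 * norm (y - x)"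
    proof eventually_elim
      case (elim y)
      then show ?case using bound[OF elim]
        by (cases "y = x") (auto simp: divide_le_eq power2_eq_square mult_ac)
    qed
  qed
qed

text \<open>The derivative is a product of \<open>cayley_inv\<close> with constants, so regularity
  improves itself step by step.\<close>

lemma Ck_on_cayley_inv: "Ck_on n (\<lambda>x. cayley_inv (hat x)) cayley_dom"
proof (induction n)
  case 0
  then show ?case
    using has_derivative_cayley_inv by (auto intro!: continuous_at_imp_continuous_on has_derivative_continuous)
next
  case (Suc n)
  show ?case
    by (rule Ck_on_SucI[OF open_cayley_dom has_derivative_cayley_inv])
       (auto intro!: Ck_on_bilinear[OF bounded_bilinear_matrix_mult] Suc Ck_on_const open_cayley_dom)
qed

lemma cayley_chart_in_atlas:
  fixes Q :: "('k::finite, 'l::finite) mat"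
  assumes Q: "rotation_matrix Q"
  shows "cayley_chart Q \<in> gr_atlas"
proof -
  let ?C = "\<lambda>x. cayley (hat x) :: ('k, 'l) mat" and ?N = "\<lambda>x. cayley_inv (hat x) :: ('k, 'l) mat"
  have orthQ: "orthogonal_matrix Q" using Q by (simp add: rotation_matrix_def)
  have hat: "transpose (hat x) = - hat x \<and> norm (hat x :: ('k, 'l) mat) < 1/4" if "x \<in> cayley_dom" for x :: "real^'l^'k"
    using that by (simp add: transpose_hat cayley_dom_def)
  note hat1 = hat[THEN conjunct1] and hat2 = hat[THEN conjunct2]
  have orthC: "orthogonal_matrix (?C x)" if "x \<in> cayley_dom" for x
    by (rule orthogonal_cayley[OF hat1[OF that] hat2[OF that]])
  have JC: "refl0 ** ?C x ** refl0 = transpose (?C x)" if "x \<in> cayley_dom" for x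
    using refl0_conj_inverse(1)[OF hat1[OF that] hat2[OF that] refl0_conj_hat]
    by (simp add: cayley_def matrix_ring_simps refl0_refl0)
  have smooth: "smooth_on_open (\<lambda>x. Q ** ?C x) cayley_dom"
    unfolding smooth_on_open_def cayley_def diff_conv_add_uminus
    by (intro conjI allI open_cayley_dom Ck_on_bilinear[OF bounded_bilinear_matrix_mult] Ck_on_const Ck_on_add
        Ck_on_bounded_linear[OF bounded_linear_scaleR_right] Ck_on_cayley_inv)
  have inj: "inj_on (\<lambda>x. gr_coset (Q ** ?C x)) cayley_dom"
  proof (rule inj_onI)
    fix x y :: "real^'l^'k" assume x: "x \<in> cayley_dom" and y: "y \<in> cayley_dom"
      and eq: "gr_coset (Q ** ?C x) = gr_coset (Q ** ?C y)"
    \<comment> \<open>As conjugation by \<open>refl0\<close> transposes \<open>?C x\<close>, the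
      involution determines the square of \<open>?C x\<close>, and injectivity becomes uniqueness of
      square roots near the identity.\<close>
    have refl: "reflect (?C x) = ?C x ** ?C x ** refl0" if "x \<in> cayley_dom" for x
    proof -
      have "?C x ** refl0 ** (refl0 ** ?C x ** refl0) = ?C x ** ?C x ** refl0"
        by (simp add: refl0_cancel flip: matrix_mul_assoc)
      then show ?thesis by (simp add: reflect_def JC that)
    qed
    have "reflect (Q ** ?C x) = reflect (Q ** ?C y)"
      by (rule reflect_cong_gr_coset[OF orthogonal_matrix_mul[OF orthQ orthC[OF x]] eq])
    then have "transpose Q ** (Q ** reflect (?C x) ** transpose Q) ** Q
        = transpose Q ** (Q ** reflect (?C y) ** transpose Q) ** Q"
      by (simp only: reflect_mult)
    then have "reflect (?C x) = reflect (?C y)"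
      by (simp add: orthogonal_cancel orthQ flip: matrix_mul_assoc)
    then have "(?C x ** ?C x ** refl0) ** refl0 = (?C y ** ?C y ** refl0) ** refl0" by (simp only: refl x y)
    then have sq: "?C x ** ?C x = ?C y ** ?C y" by (simp only: refl0_cancel)
    have "norm ((?C x - mat 1) + (?C y - mat 1)) < 1/2 + 1/2"
      by (intro norm_triangle_lt add_strict_mono norm_cayley_diff hat1 hat2 x y)
    moreover have "?C x + ?C y - 2 *\<^sub>R mat 1 = (?C x - mat 1) + (?C y - mat 1)" by (simp add: vec_eq_iff)
    ultimately have "?C x = ?C y"
      by (intro square_root_unique_near[OF sq orthogonal_matrix_id]) simp_all
    then have "hat x = (hat y :: ('k, 'l) mat)"
      by (rule cayley_inj[OF hat1[OF x] hat2[OF x] hat1[OF y] hat2[OF y]])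
    then show "x = y" by (metis unhat_hat)
  qed
  have form: "inj (chart_form (\<lambda>x. Q ** ?C x) x)" if x: "x \<in> cayley_dom" for x
  proof -
    let ?M = "transpose (?N x)"
    have "((\<lambda>x. Q ** ?C x) has_derivative (\<lambda>v. Q ** (2 *\<^sub>R (?N x ** hat v ** ?N x)))) (at x)"
      unfolding cayley_def
      by (auto intro!: derivative_eq_intros bounded_linear.has_derivative[OF matmul.bounded_linear_right]
          has_derivative_cayley_inv x)
    note d = frechet_derivative_at[OF this, symmetric]
    have "transpose (Q ** ?C x) ** (Q ** (2 *\<^sub>R (?N x ** hat v ** ?N x))) = 2 *\<^sub>R (?M ** hat v ** ?N x)" for v
    proof -
      have "transpose (Q ** ?C x) ** (Q ** (2 *\<^sub>R (?N x ** hat v ** ?N x)))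
          = 2 *\<^sub>R ((transpose (?C x) ** ?N x) ** hat v ** ?N x)"
        by (simp add: matrix_transpose_mul matmul.scaleR_right orthogonal_cancel orthQ flip: matrix_mul_assoc)
      then show ?thesis by (simp only: transpose_cayley_mult_cayley_inv[OF hat1[OF x] hat2[OF x]])
    qed
    then have cf: "chart_form (\<lambda>x. Q ** ?C x) x v = horizontal (2 *\<^sub>R (?M ** hat v ** ?N x))" for v
      by (simp add: chart_form_def d)
    have hor: "chart_form (\<lambda>x. Q ** ?C x) x v = ?M ** hat v ** ?N x + ?N x ** hat v ** ?M" for v
    proof -
      have "transpose (2 *\<^sub>R (?M ** hat v ** ?N x)) = - (2 *\<^sub>R (?M ** hat v ** ?N x))"
        by (simp add: matrix_ring_simps transpose_hat matrix_mul_assoc)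
      moreover have "refl0 ** (?M ** hat v ** ?N x) ** refl0 = - (?N x ** hat v ** ?M)"
      proof -
        have "refl0 ** (?M ** hat v ** ?N x) ** refl0
            = (refl0 ** ?M ** refl0) ** (refl0 ** hat v ** refl0) ** (refl0 ** ?N x ** refl0)"
          by (simp add: refl0_cancel flip: matrix_mul_assoc)
        then show ?thesis
          by (simp only: refl0_conj_inverse[OF hat1[OF x] hat2[OF x] refl0_conj_hat] refl0_conj_hat
              matmul.minus_left matmul.minus_right)
      qed
      ultimately show ?thesis
        by (simp add: cf horizontal_eq matmul.scaleR_left matmul.scaleR_right scaleR_add_right)
    qed
    have "linear (chart_form (\<lambda>x. Q ** ?C x) x)"
      unfolding hor[abs_def]
      by (rule linearI)
         (simp_all add: linear_add[OF linear_hat] linear_cmul[OF linear_hat] matmul.add_left matmul.add_right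
            matmul.scaleR_left matmul.scaleR_right scaleR_add_right)
    moreover have "v = 0" if "chart_form (\<lambda>x. Q ** ?C x) x v = 0" for v
    proof -
      let ?U = "hat v :: ('k, 'l) mat"
      define E where "E = ?C x - mat 1"
      have CM: "transpose (?C x) ** ?N x = ?M"
        by (rule transpose_cayley_mult_cayley_inv[OF hat1[OF x] hat2[OF x]])
      have MC: "?M ** ?C x = ?N x"
        using arg_cong[OF CM, of transpose] by (simp add: matrix_transpose_mul)
      have CM': "?C x ** ?M = ?N x"
      proof -
        have "?C x ** ?M = ?C x ** (transpose (?C x) ** ?N x)" by (simp only: CM)
        then show ?thesis by (simp add: orthogonal_cancel orthC x)
      qed
      have "?M ** (?U ** ?C x + ?C x ** ?U) ** ?M = ?M ** ?U ** (?C x ** ?M) + (?M ** ?C x) ** ?U ** ?M"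
        by (simp add: matmul.add_left matmul.add_right matrix_mul_assoc)
      also have "\<dots> = 0" using that by (simp only: CM' MC hor)
      \<comment> \<open>\<open>mat 1 + hat x\<close> inverts \<open>?M\<close>, so multiplying on
        both sides strips the outer factors.\<close>
      finally have "(mat 1 + hat x) ** (?M ** (?U ** ?C x + ?C x ** ?U) ** ?M) ** (mat 1 + hat x) = 0"
        by (simp add: matmul.zero_left matmul.zero_right)
      moreover have "(mat 1 + hat x) ** (?M ** W ** ?M) ** (mat 1 + hat x)
          = ((mat 1 + hat x) ** ?M) ** W ** (?M ** (mat 1 + hat x))" for W
        by (simp add: matrix_mul_assoc)
      ultimately have "?U ** ?C x + ?C x ** ?U = 0"
        by (simp add: transpose_cayley_inv_inverse[OF hat1[OF x] hat2[OF x]])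
      \<comment> \<open>As \<open>norm E < 1/2\<close>, the right side has norm at most that of
        \<open>?U\<close>, which forces \<open>?U = 0\<close>.\<close>
      then have "2 *\<^sub>R ?U = - (?U ** E + E ** ?U)"
        by (simp add: E_def matrix_ring_simps vec_eq_iff algebra_simps)
      then have "2 * norm ?U = norm (?U ** E + E ** ?U)"
        using norm_minus_cancel[of "?U ** E + E ** ?U"] norm_scaleR[of 2 ?U] by simp
      also have "\<dots> \<le> norm ?U * norm E + norm E * norm ?U"
        by (rule norm_triangle_le[OF add_mono[OF norm_matrix_mult norm_matrix_mult]])
      finally have "2 * norm ?U \<le> norm ?U * (2 * norm E)" by (simp add: mult_ac)
      also have "norm ?U * (2 * norm E) \<le> norm ?U * 1"
        using norm_cayley_diff[OF hat1[OF x] hat2[OF x]] by (intro mult_left_mono) (auto simp: E_def)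
      finally have "?U = 0" by simp
      then show "v = 0" using linear_0[OF linear_unhat] by (metis unhat_hat)
    qed
    ultimately show ?thesis by (auto simp: linear_injective_0)
  qed
  show ?thesis
    using smooth inj form rotation_matrix_mult[OF Q rotation_cayley] hat
    by (simp add: gr_atlas_def cayley_chart_def)
qed

text \<open>\<open>tnorm\<close> picks a chart and admissible curves must stay inside charts, so
  both depend on this. In the Cayley chart, \<open>Q\<close> sits at coordinate 0.\<close>

lemma charts_at_nonempty:
  fixes Q :: "('k::finite, 'l::finite) mat"
  assumes Q: "rotation_matrix Q"
  shows "gr_charts (gr_coset Q) \<noteq> {}"
proof -
  have hat0: "hat 0 = (0 :: ('k, 'l) mat)" by (rule linear_0[OF linear_hat])
  have "cayley (0 :: ('k, 'l) mat) = mat 1"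
    using cayley_mult[of "0 :: ('k, 'l) mat"] by (simp add: transp_simps)
  then have "snd (cayley_chart Q) 0 = Q" "0 \<in> fst (cayley_chart Q)"
    by (simp_all add: cayley_chart_def cayley_dom_def hat0)
  then have "cayley_chart Q \<in> gr_charts (gr_coset Q)"
    using cayley_chart_in_atlas[OF Q] unfolding charts_at_iff by metis
  then show ?thesis by blast
qed

section \<open>Geodesics and the exponential map\<close>

text \<open>All chart components of a tangent vector have one common ambient image \<open>Y\<close>.
  In this form linear combinations and norms become those of matrices.\<close>

definition represents ::
  "('k::finite, 'l::finite) mat set \<Rightarrow> (('k, 'l) gr_chart \<Rightarrow> real^'l^'k) \<Rightarrow> ('k, 'l) mat \<Rightarrow> bool" where
  "represents p u Y \<longleftrightarrow> (\<forall>c\<in>gr_charts p. demb c (gr_coord c p) (u c) = Y)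
     \<and> (\<forall>c. c \<notin> gr_charts p \<longrightarrow> u c = 0)"

lemma represents_lincomb:
  assumes "represents p u Y" "represents p w Z"
  shows "represents p (\<lambda>c. a *\<^sub>R u c + b *\<^sub>R w c) (a *\<^sub>R Y + b *\<^sub>R Z)"
  unfolding represents_def
proof (intro conjI ballI allI impI)
  fix c assume c: "c \<in> gr_charts p"
  then obtain "c \<in> gr_atlas" "gr_coord c p \<in> fst c" by (rule charts_atE)
  then show "demb c (gr_coord c p) (a *\<^sub>R u c + b *\<^sub>R w c) = a *\<^sub>R Y + b *\<^sub>R Z"
    using assms c by (simp add: represents_def linear_add[OF linear_demb] linear_cmul[OF linear_demb])
qed (use assms in \<open>auto simp: represents_def\<close>)

lemma emb_coord:
  assumes "c \<in> gr_charts (gr_coset g)" "orthogonal_matrix g"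
  shows "emb c (gr_coord c (gr_coset g)) = reflect g"
  using assms(1)
proof (rule charts_atE)
  assume "c \<in> gr_atlas" "gr_coord c (gr_coset g) \<in> fst c"
    "gr_coset (snd c (gr_coord c (gr_coset g))) = gr_coset g"
  then show ?thesis unfolding emb_def by (intro reflect_cong_gr_coset chart_orthogonal)
qed

lemma represents_tangent:
  assumes "represents (gr_coset Q) u Y" "rotation_matrix Q"
  shows "transpose Y = Y" "reflect Q ** Y = - (Y ** reflect Q)"
proof -
  have o: "orthogonal_matrix Q" using assms(2) by (simp add: rotation_matrix_def)
  obtain c where c: "c \<in> gr_charts (gr_coset Q)" using charts_at_nonempty[OF assms(2)] by blast
  then obtain cc: "c \<in> gr_atlas" "gr_coord c (gr_coset Q) \<in> fst c" by (rule charts_atE)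
  have "Y = demb c (gr_coord c (gr_coset Q)) (u c)" using assms(1) c by (simp add: represents_def)
  then show "transpose Y = Y" "reflect Q ** Y = - (Y ** reflect Q)"
    using transpose_demb[OF cc] emb_demb[OF cc] emb_coord[OF c o] by simp_all
qed

text \<open>The transition map \<open>tr\<close> is differentiable because coordinates are
  differentiable functions of the involution, and it satisfies
  \<open>emb c (tr y) = emb c0 y\<close>. By the chain rule compatible components have the same
  image.\<close>

lemma tangent_space_represents:
  fixes Q :: "('k::finite, 'l::finite) mat"
  assumes Q: "rotation_matrix Q" and u: "u \<in> tangent_space grassmannian (gr_coset Q)"
  obtains Y where "represents (gr_coset Q) u Y"
proof -
  let ?p = "gr_coset Q"
  obtain c0 where c0: "c0 \<in> gr_charts ?p" using charts_at_nonempty[OF Q] by blast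
  define x0 where "x0 = gr_coord c0 ?p"
  from c0 obtain cc0: "c0 \<in> gr_atlas" "x0 \<in> fst c0" "gr_coset (snd c0 x0) = ?p"
    unfolding x0_def by (rule charts_atE)
  have "demb c (gr_coord c ?p) (u c) = demb c0 x0 (u c0)" if c: "c \<in> gr_charts ?p" for c
  proof -
    let ?tr = "\<lambda>y. gr_coord c (param grassmannian c0 y)"
    have tr: "param grassmannian c0 y = gr_coset (snd c0 y)" for y by (simp add: grassmannian_def)
    from c obtain cc: "c \<in> gr_atlas" "gr_coord c ?p \<in> fst c" by (rule charts_atE)
    obtain \<psi> \<psi>' where \<psi>: "(\<psi> has_derivative \<psi>') (at (reflect (snd c0 x0)))"
      "\<And>F h. ((h :: real^'l^'k \<Rightarrow> _) \<longlongrightarrow> snd c0 x0) F \<Longrightarrow> \<forall>\<^sub>F x in F. orthogonal_matrix (h x) \<Longrightarrow>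
         \<forall>\<^sub>F x in F. c \<in> gr_charts (gr_coset (h x)) \<and>
           gr_coord c (gr_coset (h x)) = \<psi> (reflect (h x))"
      by (rule coord_lift[OF c[folded cc0(3)] chart_orthogonal[OF cc0(1,2)]]) blast
    have near: "\<forall>\<^sub>F y in nhds x0. y \<in> fst c0" using cc0(2) chart_open[OF cc0(1)] eventually_nhds by blast
    have ev: "\<forall>\<^sub>F y in nhds x0. c \<in> gr_charts (gr_coset (snd c0 y)) \<and> ?tr y = \<psi> (emb c0 y)"
      unfolding tr emb_def
    proof (rule \<psi>(2))
      show "(snd c0 \<longlongrightarrow> snd c0 x0) (nhds x0)"
        using has_derivative_continuous[OF chart_has_derivative[OF cc0(1,2)]]
        by (simp add: continuous_at_imp_continuous_at_within continuous_at tendsto_at_iff_tendsto_nhds)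
      show "\<forall>\<^sub>F y in nhds x0. orthogonal_matrix (snd c0 y)"
        using near by eventually_elim (rule chart_orthogonal[OF cc0(1)])
    qed
    from ev near obtain W where W: "open W" "x0 \<in> W" "\<And>y. y \<in> W \<Longrightarrow> ?tr y = \<psi> (emb c0 y) \<and> y \<in> fst c0 \<and>
        c \<in> gr_charts (gr_coset (snd c0 y))"
      unfolding eventually_nhds by (metis IntE IntI open_Int)
    have "((\<lambda>y. \<psi> (emb c0 y)) has_derivative (\<lambda>v. \<psi>' (demb c0 x0 v))) (at x0)"
      by (rule has_derivative_compose[OF has_derivative_emb[OF cc0(1,2)] \<psi>(1)[folded emb_def]])
    then have D: "(?tr has_derivative (\<lambda>v. \<psi>' (demb c0 x0 v))) (at x0)"
      by (rule has_derivative_transform_within_open[OF _ W(1,2)]) (simp add: W(3))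
    have tr0: "?tr x0 = gr_coord c ?p" by (simp add: tr cc0(3))
    have uc: "u c = \<psi>' (demb c0 x0 (u c0))"
    proof -
      have "u c = frechet_derivative ?tr (at x0) (u c0)"
        using u c c0 unfolding tangent_space_def x0_def by blast
      then show ?thesis by (simp only: frechet_derivative_at[OF D, symmetric])
    qed
    have "((\<lambda>y. emb c (?tr y)) has_derivative (\<lambda>v. demb c (?tr x0) (\<psi>' (demb c0 x0 v)))) (at x0)"
      using cc by (intro has_derivative_compose[OF D] has_derivative_emb) (simp_all only: tr0)
    then have "(emb c0 has_derivative (\<lambda>v. demb c (?tr x0) (\<psi>' (demb c0 x0 v)))) (at x0)"
    proof (rule has_derivative_transform_within_open[OF _ W(1,2)])
      show "emb c (?tr y) = emb c0 y" if "y \<in> W" for y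
        unfolding tr using W(3)[OF that] by (subst emb_coord) (simp_all add: chart_orthogonal cc0 emb_def)
    qed
    then have "demb c (?tr x0) (\<psi>' (demb c0 x0 (u c0))) = demb c0 x0 (u c0)"
      by (rule has_derivative_eq_at[OF _ has_derivative_emb[OF cc0(1,2)], where u = "u c0"])
    then show ?thesis by (simp only: tr0 uc)
  qed
  then have "represents ?p u (demb c0 x0 (u c0))"
    using u unfolding represents_def tangent_space_def by blast
  then show ?thesis by (rule that)
qed

lemma tnorm_eq:
  assumes c: "gr_charts p \<noteq> {}"
    and N: "\<And>c. c \<in> gr_charts p \<Longrightarrow> norm (demb c (gr_coord c p) (\<xi> c)) = N"
  shows "tnorm grassmannian p \<xi> = N / sqrt 8"
proof -
  define c where "c = (SOME c. c \<in> gr_charts p)"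
  have c: "c \<in> gr_charts p" unfolding c_def using c by (simp add: some_in_eq)
  then obtain cc: "c \<in> gr_atlas" "gr_coord c p \<in> fst c" by (rule charts_atE)
  show ?thesis
    by (simp add: tnorm_def c_def[symmetric] metric_eq_emb[OF cc] real_sqrt_divide N[OF c] flip: norm_eq_sqrt_inner)
qed

section \<open>One-parameter groups acting on involutions\<close>

lemma mexp_double:
  fixes A :: "real^'n^'n"
  assumes skew: "transpose A = - A"
  shows "mexp A ** mexp A = mexp (2 *\<^sub>R A)"
proof -
  let ?E = "\<lambda>t. mexp (t *\<^sub>R A)" and ?F = "\<lambda>t. mexp (t *\<^sub>R (2 *\<^sub>R A))"
  have skew2: "transpose (2 *\<^sub>R A) = - (2 *\<^sub>R A)" by (simp add: transp_simps skew)
  have "((\<lambda>t. transpose (?F t) ** (?E t ** ?E t)) has_vector_derivative 0) (at t within UNIV)" for t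
  proof -
    have c: "?E t ** A = A ** ?E t" by (rule mexp_commute[OF skew])
    have EE: "?E t ** A ** ?E t + A ** ?E t ** ?E t = 2 *\<^sub>R (A ** ?E t ** ?E t)"
      by (simp only: c scaleR_2)
    show ?thesis
      by (rule derivative_eq_intros has_vector_derivative_mexp refl)+
         (simp only: EE matrix_transpose_mul transp_simps skew scaleR_minus_right matmul.minus_left matmul.minus_right
            matmul.scaleR_left matmul.scaleR_right matrix_mul_assoc add.right_inverse)
  qed
  then have "transpose (?F 1) ** (?E 1 ** ?E 1) = transpose (?F 0) ** (?E 0 ** ?E 0)"
    by (rule zero_vector_derivative_eq)
  then have "?F 1 ** (transpose (?F 1) ** (?E 1 ** ?E 1)) = ?F 1" by simp
  then show ?thesis
    using orthogonal_mexp_scaleR[OF skew2, of 1] by (simp add: orthogonal_cancel)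
qed

context
  fixes A S0 :: "real^'n^'n"
  assumes skew: "transpose A = - A" and S0: "S0 ** S0 = mat 1" and anti: "S0 ** A = - (A ** S0)"
begin

text \<open>Anticommutation makes \<open>transpose E ** S0 ** transpose E\<close> constant in time;
  in other words, conjugation by \<open>S0\<close> inverts the group.\<close>

lemma mexp_conj_involution: "S0 ** transpose (mexp A) = mexp A ** S0"
proof -
  let ?E = "\<lambda>t. mexp (t *\<^sub>R A)"
  have c: "transpose (?E t) ** A = A ** transpose (?E t)" for t
    using arg_cong[OF mexp_commute[OF skew, of t], of transpose]
    by (simp add: matrix_transpose_mul skew matmul.minus_left matmul.minus_right)
  have "((\<lambda>t. transpose (?E t) ** S0 ** transpose (?E t)) has_vector_derivative 0) (at t within UNIV)" for t
  proof -
    have "transpose (?E t) ** S0 ** transpose (A ** ?E t) + transpose (A ** ?E t) ** S0 ** transpose (?E t)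
        = - (transpose (?E t) ** (S0 ** A + A ** S0) ** transpose (?E t))"
      by (simp add: matrix_transpose_mul skew matmul.minus_left matmul.minus_right matmul.add_left matmul.add_right
          c matrix_mul_assoc)
    also have "\<dots> = 0" by (simp add: anti matmul.zero_left matmul.zero_right)
    finally have eq: "transpose (?E t) ** S0 ** transpose (A ** ?E t)
        + transpose (A ** ?E t) ** S0 ** transpose (?E t) = 0" .
    show ?thesis
      by (rule derivative_eq_intros has_vector_derivative_mexp refl)+
         (simp add: matmul.zero_right eq)
  qed
  then have "transpose (?E 1) ** S0 ** transpose (?E 1) = transpose (?E 0) ** S0 ** transpose (?E 0)"
    by (rule zero_vector_derivative_eq)
  then have "mexp A ** (transpose (mexp A) ** S0 ** transpose (mexp A)) = mexp A ** S0" by simp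
  then show ?thesis by (simp add: orthogonal_cancel orthogonal_mexp skew flip: matrix_mul_assoc)
qed

lemma mexp_involution_anticommute: "A ** (mexp (t *\<^sub>R A) ** S0) = - (mexp (t *\<^sub>R A) ** S0 ** A)"
proof -
  have "A ** (mexp (t *\<^sub>R A) ** S0) = mexp (t *\<^sub>R A) ** (A ** S0)"
    by (simp add: matrix_mul_assoc mexp_commute[OF skew])
  then show ?thesis using anti by (simp add: matmul.minus_right flip: matrix_mul_assoc)
qed

end

text \<open>Conjugation acts from both sides, and moving the right factor past the involution
  inverts it. The two halves of \<open>A\<close> therefore add up.\<close>

lemma reflect_lift:
  fixes Q A :: "('k::finite, 'l::finite) mat"
  assumes skew: "transpose A = - A" and Q: "orthogonal_matrix Q"
    and anti: "reflect Q ** A = - (A ** reflect Q)"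
  shows "reflect (mexp ((1/2) *\<^sub>R A) ** Q) = mexp A ** reflect Q"
proof -
  let ?P = "(1/2) *\<^sub>R A"
  have P: "transpose ?P = - ?P" "reflect Q ** ?P = - (?P ** reflect Q)"
    by (simp_all add: transp_simps skew matmul.scaleR_left matmul.scaleR_right anti)
  have "reflect (mexp ?P ** Q) = mexp ?P ** (reflect Q ** transpose (mexp ?P))"
    by (simp add: reflect_mult matrix_mul_assoc)
  also have "\<dots> = (mexp ?P ** mexp ?P) ** reflect Q"
    by (simp add: mexp_conj_involution[OF P(1) reflect_reflect[OF Q] P(2)] matrix_mul_assoc)
  also have "mexp ?P ** mexp ?P = mexp A"
    using mexp_double[OF P(1)] by simp
  finally show ?thesis .
qed

lemma rotation_mexp_mult:
  "transpose A = - A \<Longrightarrow> rotation_matrix Q \<Longrightarrow> rotation_matrix (mexp (t *\<^sub>R A) ** Q)" for A Q :: "real^'n^'n"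
  by (intro rotation_matrix_mult rotation_mexp) (auto simp: transp_simps)

lemma rotation_lift:
  fixes A Q :: "real^'n^'n"
  assumes "transpose A = - A" "rotation_matrix Q"
  shows "rotation_matrix (mexp (t *\<^sub>R ((1/2) *\<^sub>R A)) ** Q)"
  by (rule rotation_mexp_mult[OF _ assms(2)]) (simp add: transp_simps assms(1))

lemma reflect_lift_line:
  assumes "transpose A = - A" "rotation_matrix Q" "reflect Q ** A = - (A ** reflect Q)"
  shows "reflect (mexp (t *\<^sub>R ((1/2) *\<^sub>R A)) ** Q) = mexp (t *\<^sub>R A) ** reflect Q"
  using reflect_lift[of "t *\<^sub>R A" Q] assms
  by (simp add: transp_simps matmul.scaleR_left matmul.scaleR_right mult.commute rotation_matrix_def)

lemma tendsto_lift:
  fixes A Q :: "real^'n^'n"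
  shows "((\<lambda>t. mexp (t *\<^sub>R A) ** Q) \<longlongrightarrow> mexp (t *\<^sub>R A) ** Q) (at t within T)"
  using continuous_mexp_scaleR[of UNIV A]
  by (intro matmul.tendsto tendsto_const) (auto simp: continuous_on_def intro: tendsto_within_subset)

section \<open>Existence of geodesics\<close>

lemma at_within_unit_interval: "t \<in> {0..1} \<Longrightarrow> at t within {0..1::real} \<noteq> bot"
  by (simp add: at_within_Icc_at trivial_limit_within islimpt_Icc)

lemma geodesic_mexp:
  fixes Q A :: "('k::finite, 'l::finite) mat"
  assumes skew: "transpose A = - A" and Q: "rotation_matrix Q"
    and anti: "reflect Q ** A = - (A ** reflect Q)"
  defines "\<gamma> \<equiv> \<lambda>t. gr_coset (mexp (t *\<^sub>R ((1/2) *\<^sub>R A)) ** Q)"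
  shows "geodesic grassmannian {0..1} \<gamma>"
    and "c \<in> gr_charts (gr_coset Q) \<Longrightarrow>
      demb c (gr_coord c (gr_coset Q)) (velocity grassmannian {0..1} \<gamma> 0 c) = A ** reflect Q"
proof -
  let ?P = "(1/2) *\<^sub>R A"
  let ?T = "{0..1::real}"
  define g where "g t = mexp (t *\<^sub>R ?P) ** Q" for t
  define S where "S t = mexp (t *\<^sub>R A) ** reflect Q" for t
  have o: "orthogonal_matrix Q" using Q by (simp add: rotation_matrix_def)
  have rot: "rotation_matrix (g t)" for t unfolding g_def by (rule rotation_lift[OF skew Q])
  then have orth: "orthogonal_matrix (g t)" for t by (simp add: rotation_matrix_def)
  have \<gamma>: "\<gamma> t = gr_coset (g t)" for t by (simp add: \<gamma>_def g_def)
  have reflect_g: "reflect (g t) = S t" for t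
    unfolding g_def S_def by (rule reflect_lift_line[OF skew Q anti])
  have dS: "(S has_vector_derivative A ** S t) (at t within ?T)" for t
    unfolding S_def[abs_def]
    by (rule derivative_eq_intros has_vector_derivative_mexp refl)+ (simp add: matmul.zero_right matrix_mul_assoc)
  have dS2: "((\<lambda>t. A ** S t) has_vector_derivative A ** (A ** S t)) (at t within ?T)" for t
    by (rule derivative_eq_intros dS refl)+ (simp add: matmul.zero_left)
  have lim: "(g \<longlongrightarrow> g t) (at t within ?T)" for t
    unfolding g_def by (rule tendsto_lift)
  have dR: "((\<lambda>s. reflect (g s)) has_vector_derivative A ** S t) (at t within ?T)" for t
    unfolding reflect_g by (rule dS)
  note lift = \<gamma> orth lim dR
  have vel: "demb c (gr_coord c (\<gamma> t)) (velocity grassmannian ?T \<gamma> t c) = A ** S t"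
    if "t \<in> ?T" "c \<in> gr_charts (\<gamma> t)" for t c
    by (rule lift_demb_velocity[OF lift that(1) at_within_unit_interval[OF that(1)] that(2)])
  have ev: "\<forall>\<^sub>F s in at t within ?T. c \<in> gr_charts (\<gamma> s) \<and> s \<in> ?T"
    if "t \<in> ?T" "c \<in> gr_charts (\<gamma> t)" for t c
    using lift_eventually_chart[OF lift that(1) at_within_unit_interval[OF that(1)] that(2)]
    by (simp add: eventually_at_filter)
  have diff: "(\<lambda>s. gr_coord c (\<gamma> s)) differentiable (at t within ?T)"
    if "t \<in> ?T" "c \<in> gr_charts (\<gamma> t)" for t c
    by (rule lift_coord_differentiable[OF lift that(1) at_within_unit_interval[OF that(1)] that(2)])
  have evel: "\<forall>\<^sub>F s in at t within ?T. demb c (gr_coord c (\<gamma> s)) (velocity grassmannian ?T \<gamma> s c) = A ** S s"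
    if "t \<in> ?T" "c \<in> gr_charts (\<gamma> t)" for t c
    using ev[OF that] by (rule eventually_mono) (auto intro: vel)
  have vdiff: "(\<lambda>s. velocity grassmannian ?T \<gamma> s c) differentiable (at t within ?T)"
    if t: "t \<in> ?T" and c: "c \<in> gr_charts (\<gamma> t)" for t c
    using c
  proof (rule charts_atE)
    assume cc: "c \<in> gr_atlas" "gr_coord c (\<gamma> t) \<in> fst c"
    show ?thesis
      by (rule differentiable_of_demb_field[OF cc(1) vector_derivative_works[THEN iffD1, OF diff[OF t c]] cc(2) t
            dS2 evel[OF t c] vel[OF t c]])
  qed
  have cov: "cov_deriv grassmannian ?T \<gamma> (velocity grassmannian ?T \<gamma>) t = (\<lambda>c. 0)" if t: "t \<in> ?T" for t
  proof
    fix c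
    show "cov_deriv grassmannian ?T \<gamma> (velocity grassmannian ?T \<gamma>) t c = 0"
    proof (cases "c \<in> gr_charts (\<gamma> t)")
      case c: True
      let ?x = "gr_coord c (\<gamma> t)"
      from c obtain cc: "c \<in> gr_atlas" "?x \<in> fst c" by (rule charts_atE)
      have S: "emb c ?x = S t" using emb_coord[OF c[unfolded \<gamma>] orth] by (simp add: \<gamma> reflect_g)
      have "demb c ?x (cov_deriv grassmannian ?T \<gamma> (velocity grassmannian ?T \<gamma>) t c) = tangent_proj (emb c ?x) (A ** (A ** emb c ?x))"
        by (rule demb_cov_deriv[where Y = "\<lambda>s. A ** S s" and \<gamma> = \<gamma> and X = "velocity grassmannian ?T \<gamma>",
              OF c t at_within_unit_interval[OF t] diff[OF t c] vdiff[OF t c] dS2[of t, folded S] evel[OF t c] vel[OF t c]])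
      \<comment> \<open>The ambient acceleration \<open>A (A S)\<close> commutes with
        \<open>S\<close>, because \<open>A\<close> anticommutes with it, so it is normal.\<close>
      also have "\<dots> = 0"
        unfolding S
      proof -
        have SS: "S t ** S t = mat 1" using reflect_reflect[OF orth] by (simp add: reflect_g)
        have AS: "A ** S t = - (S t ** A)"
          unfolding S_def by (rule mexp_involution_anticommute[OF skew reflect_reflect[OF o] anti])
        have "S t ** (A ** (A ** S t)) ** S t = S t ** A ** A ** (S t ** S t)" by (simp add: matrix_mul_assoc)
        also have "\<dots> = S t ** A ** A" by (simp add: SS)
        also have "\<dots> = A ** (A ** S t)" by (simp add: AS matmul.minus_left matmul.minus_right matrix_mul_assoc)
        finally show "tangent_proj (S t) (A ** (A ** S t)) = 0" by (simp add: tangent_proj_def)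
      qed
      finally show ?thesis
        using demb_inj[OF cc] linear_0[OF linear_demb[OF cc]] by (metis injD)
    qed (simp add: cov_deriv_def)
  qed
  show "geodesic grassmannian ?T \<gamma>"
    unfolding geodesic_def twice_differentiable_curve_def
  proof (intro conjI ballI)
    fix t c assume t: "t \<in> ?T" and c: "c \<in> gr_charts (\<gamma> t)"
    show "(\<lambda>s. velocity grassmannian ?T \<gamma> s c) differentiable at t within ?T" by (rule vdiff[OF t c])
    from ev[OF t c] obtain e where "e > 0" and e: "\<And>s. s \<in> ?T \<Longrightarrow> s \<noteq> t \<Longrightarrow> dist s t < e \<Longrightarrow> c \<in> gr_charts (\<gamma> s)"
      unfolding eventually_at by blast
    then have "\<forall>s\<in>?T. dist s t < e \<longrightarrow> c \<in> gr_charts (\<gamma> s)" using c by metis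
    with \<open>e > 0\<close> show "\<exists>e>0. \<forall>s\<in>?T. dist s t < e \<longrightarrow> c \<in> gr_charts (\<gamma> s) \<and>
        (\<lambda>s. gr_coord c (\<gamma> s)) differentiable at s within ?T"
      using diff by blast
  next
    fix t show "gr_charts (\<gamma> t) \<noteq> {}" unfolding \<gamma> by (rule charts_at_nonempty[OF rot])
  next
    fix t assume "t \<in> ?T"
    then show "cov_deriv grassmannian ?T \<gamma> (velocity grassmannian ?T \<gamma>) t = (\<lambda>c. 0)" by (rule cov)
  qed
  assume "c \<in> gr_charts (gr_coset Q)"
  then show "demb c (gr_coord c (gr_coset Q)) (velocity grassmannian {0..1} \<gamma> 0 c) = A ** reflect Q"
    using vel[of 0 c] by (simp add: \<gamma> g_def S_def)
qed

text \<open>The embedding read on cosets themselves, for curves that come without a lift. The choice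
  of representative is harmless by \<open>refl_coset_eq\<close>.\<close>

definition refl_coset :: "('k::finite, 'l::finite) mat set \<Rightarrow> ('k, 'l) mat" where
  "refl_coset p = reflect (SOME g. g \<in> p)"

lemma refl_coset_eq:
  assumes "orthogonal_matrix g"
  shows "refl_coset (gr_coset g) = reflect g"
proof -
  define h where "h = (SOME h. h \<in> gr_coset g)"
  have "h \<in> gr_coset g" unfolding h_def by (rule someI, rule self_in_gr_coset)
  then obtain R where "R \<in> isotropy_group" "h = g ** R" by (auto simp: gr_coset_def)
  then have "gr_coset g = gr_coset h" by (simp add: gr_coset_mult)
  then have "reflect h = reflect g" by (rule reflect_cong_gr_coset[OF assms, symmetric])
  then show ?thesis by (simp only: refl_coset_def h_def)
qed

lemma emb_coord_eq_refl_coset: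
  assumes "c \<in> gr_charts p"
  shows "emb c (gr_coord c p) = refl_coset p"
  using assms
proof (rule charts_atE)
  assume c: "c \<in> gr_atlas" "gr_coord c p \<in> fst c" "gr_coset (snd c (gr_coord c p)) = p"
  show ?thesis using refl_coset_eq[OF chart_orthogonal[OF c(1,2)]] by (simp add: emb_def c(3))
qed

text \<open>Along a geodesic the matrix \<open>S ** S'\<close>, where \<open>S\<close> is the image of the curve in the symmetric
  involutions, is conserved; this is the moment map of the action of the rotation group. Hence \<open>S\<close>
  solves a linear equation with constant coefficients.\<close>

lemma geodesic_refl_coset:
  fixes \<gamma> :: "real \<Rightarrow> ('k::finite, 'l::finite) mat set" and A :: "('k, 'l) mat"
  assumes geo: "geodesic grassmannian {0..1} \<gamma>" and skew: "transpose A = - A"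
    and anti: "refl_coset (\<gamma> 0) ** A = - (A ** refl_coset (\<gamma> 0))"
    and vel0: "\<And>c. c \<in> gr_charts (\<gamma> 0) \<Longrightarrow>
      demb c (gr_coord c (\<gamma> 0)) (velocity grassmannian {0..1} \<gamma> 0 c) = A ** refl_coset (\<gamma> 0)"
    and t: "t \<in> {0..1}"
  shows "refl_coset (\<gamma> t) = mexp (t *\<^sub>R A) ** refl_coset (\<gamma> 0)"
proof -
  let ?T = "{0..1::real}"
  let ?x = "\<lambda>c t. gr_coord c (\<gamma> t)" and ?v = "\<lambda>c t. velocity grassmannian ?T \<gamma> t c"
  define S where "S t = refl_coset (\<gamma> t)" for t
  define V where "V t = vector_derivative S (at t within ?T)" for t
  have nonempty: "\<exists>c. c \<in> gr_charts (\<gamma> t)" if "t \<in> ?T" for t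
    using geo that unfolding geodesic_def twice_differentiable_curve_def by blast
  have near: "\<exists>e>0. \<forall>s\<in>?T. dist s t < e \<longrightarrow> c \<in> gr_charts (\<gamma> s) \<and> ?x c differentiable (at s within ?T)"
    and vdiff: "?v c differentiable (at t within ?T)"
    if "t \<in> ?T" "c \<in> gr_charts (\<gamma> t)" for t c
    using geo that unfolding geodesic_def twice_differentiable_curve_def by blast+
  have xdiff: "?x c differentiable (at t within ?T)" if "t \<in> ?T" "c \<in> gr_charts (\<gamma> t)" for t c
    using near[OF that] that(1) by force
  have ev: "\<forall>\<^sub>F s in at t within ?T. c \<in> gr_charts (\<gamma> s) \<and> s \<in> ?T"
    if "t \<in> ?T" "c \<in> gr_charts (\<gamma> t)" for t c
    using near[OF that] unfolding eventually_at by blast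
  note bot = at_within_unit_interval
  have emb: "emb c (?x c t) = S t" if "c \<in> gr_charts (\<gamma> t)" for c t
    unfolding S_def by (rule emb_coord_eq_refl_coset[OF that])
  have dS_chart: "(S has_vector_derivative demb c (?x c t) (?v c t)) (at t within ?T)"
    if t: "t \<in> ?T" and c: "c \<in> gr_charts (\<gamma> t)" for t c
    using c
  proof (rule charts_atE)
    assume cc: "c \<in> gr_atlas" "?x c t \<in> fst c"
    have "?v c t = vector_derivative (?x c) (at t within ?T)" using c by (simp add: velocity_def)
    then have "(?x c has_vector_derivative ?v c t) (at t within ?T)"
      using xdiff[OF t c] by (simp add: vector_derivative_works)
    from has_vector_derivative_compose[OF this has_derivative_emb[OF cc]]
    have "((\<lambda>s. emb c (?x c s)) has_vector_derivative demb c (?x c t) (?v c t)) (at t within ?T)" .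
    then show ?thesis
      by (rule has_vector_derivative_transform_eventually[OF _ t eventually_mono[OF ev[OF t c]]])
         (auto simp: emb c)
  qed
  have V_chart: "demb c (?x c t) (?v c t) = V t" if "t \<in> ?T" "c \<in> gr_charts (\<gamma> t)" for t c
    unfolding V_def by (rule vector_derivative_within[OF bot[OF that(1)] dS_chart[OF that], symmetric])
  have dS: "(S has_vector_derivative V t) (at t within ?T)" if "t \<in> ?T" for t
    using nonempty[OF that] dS_chart[OF that] V_chart[OF that] by metis
  have SS: "S t ** S t = mat 1" and SV: "S t ** V t = - (V t ** S t)" if t: "t \<in> ?T" for t
  proof -
    obtain c where c: "c \<in> gr_charts (\<gamma> t)" using nonempty[OF t] by blast
    then obtain cc: "c \<in> gr_atlas" "?x c t \<in> fst c" by (rule charts_atE)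
    show "S t ** S t = mat 1" using emb_emb[OF cc] by (simp add: emb[OF c])
    show "S t ** V t = - (V t ** S t)" using emb_demb[OF cc, of "?v c t"] by (simp add: emb[OF c] V_chart[OF t c])
  qed
  have dV: "\<exists>V'. (V has_vector_derivative V') (at t within ?T) \<and> tangent_proj (S t) V' = 0" if t: "t \<in> ?T" for t
  proof -
    obtain c where c: "c \<in> gr_charts (\<gamma> t)" using nonempty[OF t] by blast
    then obtain cc: "c \<in> gr_atlas" "?x c t \<in> fst c" by (rule charts_atE)
    have evV: "\<forall>\<^sub>F s in at t within ?T. demb c (?x c s) (?v c s) = V s"
      using ev[OF t c] by (rule eventually_mono) (auto intro: V_chart)
    obtain V' where "((\<lambda>s. demb c (?x c s) (?v c s)) has_vector_derivative V') (at t within ?T)"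
      using has_vector_derivative_demb_field[OF cc(1) vector_derivative_works[THEN iffD1, OF xdiff[OF t c]] cc(2) t
          vector_derivative_works[THEN iffD1, OF vdiff[OF t c]]] by blast
    then have V': "(V has_vector_derivative V') (at t within ?T)"
      by (rule has_vector_derivative_transform_eventually[OF _ t evV V_chart[OF t c]])
    have "cov_deriv grassmannian ?T \<gamma> (velocity grassmannian ?T \<gamma>) t c = 0"
      using geo t by (simp add: geodesic_def)
    then have "tangent_proj (emb c (?x c t)) V' = demb c (?x c t) 0"
      using demb_cov_deriv[where Y = V and \<gamma> = \<gamma> and X = "velocity grassmannian ?T \<gamma>",
          OF c t bot[OF t] xdiff[OF t c] vdiff[OF t c] V' evV V_chart[OF t c]] by simp
    then show ?thesis using V' linear_0[OF linear_demb[OF cc]] by (auto simp: emb[OF c])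
  qed
  have dP: "((\<lambda>s. S s ** V s) has_vector_derivative 0) (at t within ?T)" if t: "t \<in> ?T" for t
  proof -
    obtain V' where V': "(V has_vector_derivative V') (at t within ?T)" "tangent_proj (S t) V' = 0"
      using dV[OF t] by blast
    \<comment> \<open>The anticommutator of \<open>S\<close> and \<open>V\<close> is identically
      zero. Differentiating it, and using that the normal vector \<open>V'\<close> commutes with
      \<open>S\<close>, shows that the derivative of \<open>S ** V\<close> vanishes.\<close>
    have "((\<lambda>s. S s ** V s + V s ** S s) has_vector_derivative
        (S t ** V' + V t ** V t) + (V t ** V t + V' ** S t)) (at t within ?T)"
      by (intro has_vector_derivative_add has_vector_derivative_matrix_mult dS V' t)
    moreover have "((\<lambda>s. S s ** V s + V s ** S s) has_vector_derivative 0) (at t within ?T)"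
      by (rule has_vector_derivative_transform[OF t _ has_vector_derivative_const]) (simp add: SV)
    ultimately have sum0: "(S t ** V' + V t ** V t) + (V t ** V t + V' ** S t) = 0"
      by (rule vector_derivative_unique_within[OF bot[OF t]])
    have "S t ** V' ** S t = V'" using V'(2) by (simp add: tangent_proj_def)
    then have "S t ** V' ** S t ** S t = V' ** S t" by simp
    then have "V' ** S t = S t ** V'" by (simp add: SS[OF t] flip: matrix_mul_assoc)
    then have "2 *\<^sub>R (S t ** V' + V t ** V t) = 0"
      using sum0 by (simp add: scaleR_2 add_ac)
    then have "S t ** V' + V t ** V t = 0" by simp
    then show ?thesis
      using has_vector_derivative_matrix_mult[OF dS[OF t] V'(1)] by simp
  qed
  obtain P where P: "\<And>s. s \<in> ?T \<Longrightarrow> S s ** V s = P"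
    using has_vector_derivative_zero_constant[OF _ dP] by (metis convex_real_interval(5))
  have V0: "V 0 = A ** S 0"
  proof -
    obtain c where c: "c \<in> gr_charts (\<gamma> 0)" using nonempty[of 0] by auto
    then show ?thesis using V_chart[of 0 c] vel0[OF c] by (simp add: S_def)
  qed
  have "S 0 ** (A ** S 0) = S 0 ** A ** S 0" by (simp add: matrix_mul_assoc)
  also have "\<dots> = - (A ** (S 0 ** S 0))" using anti by (simp add: S_def matmul.minus_left matrix_mul_assoc)
  finally have PA: "P = - A" using P[of 0] by (simp add: V0 SS)
  have VA: "V s = A ** S s" if s: "s \<in> ?T" for s
  proof -
    have "V s ** S s = A" using SV[OF s] P[OF s] PA by simp
    then have "V s ** S s ** S s = A ** S s" by simp
    then show ?thesis by (simp add: SS[OF s] flip: matrix_mul_assoc)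
  qed
  \<comment> \<open>Uniqueness for the linear equation: with zero forcing the bound makes the
    difference vanish.\<close>
  have "norm (S t - mexp (t *\<^sub>R A) ** S 0) \<le> 0 * t"
  proof (rule mexp_ode_bound[OF skew _ _ _ t, where F = "\<lambda>_. 0"])
    fix s assume s: "s \<in> ?T"
    show "((\<lambda>t. S t - mexp (t *\<^sub>R A) ** S 0) has_vector_derivative
        A ** (S s - mexp (s *\<^sub>R A) ** S 0) + 0) (at s within ?T)"
      by (rule derivative_eq_intros dS has_vector_derivative_mexp s refl)+
         (simp add: VA[OF s] matmul.zero_right matmul.diff_right matrix_mul_assoc)
  qed simp_all
  then show ?thesis by (simp add: S_def)
qed

text \<open>The involutions of the two curves agree by \<open>geodesic_refl_coset\<close>, so only
  the orientation could differ. Whether the cosets agree is locally constant in time, and they agree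
  at time 0.\<close>

lemma geodesic_unique:
  fixes \<gamma> :: "real \<Rightarrow> ('k::finite, 'l::finite) mat set" and Q A :: "('k, 'l) mat"
  assumes geo: "geodesic grassmannian {0..1} \<gamma>" and skew: "transpose A = - A" and Q: "rotation_matrix Q"
    and anti: "reflect Q ** A = - (A ** reflect Q)" and \<gamma>0: "\<gamma> 0 = gr_coset Q"
    and vel0: "\<And>c. c \<in> gr_charts (\<gamma> 0) \<Longrightarrow>
      demb c (gr_coord c (\<gamma> 0)) (velocity grassmannian {0..1} \<gamma> 0 c) = A ** reflect Q"
    and t: "t \<in> {0..1}"
  shows "\<gamma> t = gr_coset (mexp (t *\<^sub>R ((1/2) *\<^sub>R A)) ** Q)"
proof -
  let ?T = "{0..1::real}"
  let ?P = "(1/2) *\<^sub>R A"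
  define g where "g t = mexp (t *\<^sub>R ?P) ** Q" for t
  have o: "orthogonal_matrix Q" using Q by (simp add: rotation_matrix_def)
  have orth: "orthogonal_matrix (g t)" for t
    using rotation_lift[OF skew Q, of t] by (simp add: g_def rotation_matrix_def)
  have reflect_g: "reflect (g t) = mexp (t *\<^sub>R A) ** reflect Q" for t
    unfolding g_def by (rule reflect_lift_line[OF skew Q anti])
  have rc0: "refl_coset (\<gamma> 0) = reflect Q" unfolding \<gamma>0 by (rule refl_coset_eq[OF o])
  have refl_\<gamma>: "refl_coset (\<gamma> s) = reflect (g s)" if "s \<in> ?T" for s
    using geodesic_refl_coset[OF geo skew _ _ that] anti vel0 by (simp add: rc0 reflect_g)
  have lim: "(g \<longlongrightarrow> g t) (at t within ?T)" for t
    unfolding g_def by (rule tendsto_lift)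
  define f where "f s \<longleftrightarrow> \<gamma> s = gr_coset (g s)" for s
  have "f 0 = f t"
  proof (rule connected_local_const[where A = ?T])
    show "\<forall>a\<in>?T. \<forall>\<^sub>F b in at a within ?T. f a = f b"
    proof
      fix a assume a: "a \<in> ?T"
      obtain c where c: "c \<in> gr_charts (\<gamma> a)"
        using geo a unfolding geodesic_def twice_differentiable_curve_def by blast
      then obtain cc: "c \<in> gr_atlas" "gr_coord c (\<gamma> a) \<in> fst c"
        "gr_coset (snd c (gr_coord c (\<gamma> a))) = \<gamma> a" by (rule charts_atE)
      obtain e where "e > 0" and e: "\<And>s. s \<in> ?T \<Longrightarrow> dist s a < e \<Longrightarrow> c \<in> gr_charts (\<gamma> s) \<and>
          (\<lambda>s. gr_coord c (\<gamma> s)) differentiable (at s within ?T)"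
        using geo a c unfolding geodesic_def twice_differentiable_curve_def by metis
      \<comment> \<open>The chart supplies a continuous lift of the geodesic near \<open>a\<close>,
        to be compared with \<open>g\<close>.\<close>
      define h where "h s = snd c (gr_coord c (\<gamma> s))" for s
      have "(\<lambda>s. gr_coord c (\<gamma> s)) differentiable (at a within ?T)"
        using e[OF a] \<open>e > 0\<close> by simp
      then have "((\<lambda>s. gr_coord c (\<gamma> s)) \<longlongrightarrow> gr_coord c (\<gamma> a)) (at a within ?T)"
        using differentiable_imp_continuous_within by (auto simp: continuous_within)
      then have lim_h: "(h \<longlongrightarrow> h a) (at a within ?T)"
        unfolding h_def
        by (rule isCont_tendsto_compose[OF has_derivative_continuous[OF chart_has_derivative[OF cc(1,2)]]])
      have h: "gr_coset (h s) = \<gamma> s \<and> orthogonal_matrix (h s)" if "c \<in> gr_charts (\<gamma> s)" for s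
        using that by (rule charts_atE) (simp add: h_def chart_orthogonal)
      have h_refl: "reflect (h s) = reflect (g s)" if "c \<in> gr_charts (\<gamma> s)" "s \<in> ?T" for s
        using refl_coset_eq[of "h s"] h[OF that(1)] refl_\<gamma>[OF that(2)] by simp
      have ev: "\<forall>\<^sub>F s in at a within ?T. c \<in> gr_charts (\<gamma> s) \<and> s \<in> ?T"
        using e \<open>e > 0\<close> unfolding eventually_at by blast
      then have "\<forall>\<^sub>F s in at a within ?T. orthogonal_matrix (h s) \<and> orthogonal_matrix (g s) \<and> reflect (h s) = reflect (g s)"
        by (rule eventually_mono) (use h h_refl orth in blast)
      from eventually_gr_coset_eq_iff[OF lim_h lim _ orth _ this]
      have "\<forall>\<^sub>F s in at a within ?T. gr_coset (h s) = gr_coset (g s) \<longleftrightarrow> gr_coset (h a) = gr_coset (g a)"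
        using h[OF c] h_refl[OF c a] by blast
      with ev show "\<forall>\<^sub>F b in at a within ?T. f a = f b"
      proof eventually_elim
        case (elim b)
        then show ?case using h[OF c] h[of b] by (simp add: f_def)
      qed
    qed
  qed (use t in auto)
  then show ?thesis by (simp add: f_def \<gamma>0 g_def)
qed

text \<open>\<open>Y ** reflect Q\<close> is the skew generator whose one-parameter group moves the
  involution with initial velocity \<open>Y\<close>. Existence and uniqueness of geodesics settle
  the definite description.\<close>

lemma exp_map_eq:
  assumes Q: "rotation_matrix Q" and u: "represents (gr_coset Q) u Y"
  shows "exp_map grassmannian (gr_coset Q) u = gr_coset (mexp ((1/2) *\<^sub>R (Y ** reflect Q)) ** Q)"
proof -
  let ?A = "Y ** reflect Q" and ?p = "gr_coset Q"
  have o: "orthogonal_matrix Q" using Q by (simp add: rotation_matrix_def)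
  note Y = represents_tangent[OF u Q]
  have YS: "?A ** reflect Q = Y" by (simp add: reflect_reflect[OF o] flip: matrix_mul_assoc)
  have skew: "transpose ?A = - ?A" by (simp add: matrix_transpose_mul transpose_reflect Y)
  have anti: "reflect Q ** ?A = - (?A ** reflect Q)"
    by (simp add: Y matmul.minus_left matrix_mul_assoc)
  let ?\<gamma> = "\<lambda>t. gr_coset (mexp (t *\<^sub>R ((1/2) *\<^sub>R ?A)) ** Q)"
  note geo = geodesic_mexp[OF skew Q anti]
  have vel: "velocity grassmannian {0..1} ?\<gamma> 0 = u"
  proof
    fix c
    show "velocity grassmannian {0..1} ?\<gamma> 0 c = u c"
    proof (cases "c \<in> gr_charts ?p")
      case True
      then obtain cc: "c \<in> gr_atlas" "gr_coord c ?p \<in> fst c" by (rule charts_atE)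
      have "demb c (gr_coord c ?p) (velocity grassmannian {0..1} ?\<gamma> 0 c) = demb c (gr_coord c ?p) (u c)"
        using geo(2)[OF True] u True by (simp add: YS represents_def)
      then show ?thesis using demb_inj[OF cc] by (simp only: inj_eq)
    next
      case False
      then show ?thesis using u by (simp add: velocity_def represents_def del: split_paired_All)
    qed
  qed
  show ?thesis
    unfolding exp_map_def
  proof (rule the_equality)
    show "\<exists>\<gamma>. geodesic grassmannian {0..1} \<gamma> \<and> \<gamma> 0 = ?p \<and> velocity grassmannian {0..1} \<gamma> 0 = u
        \<and> \<gamma> 1 = gr_coset (mexp ((1/2) *\<^sub>R ?A) ** Q)"
      using geo(1) vel by (intro exI[of _ ?\<gamma>]) simp
  next
    fix q assume "\<exists>\<gamma>. geodesic grassmannian {0..1} \<gamma> \<and> \<gamma> 0 = ?p \<and> velocity grassmannian {0..1} \<gamma> 0 = u \<and> \<gamma> 1 = q"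
    then obtain \<gamma> where \<gamma>: "geodesic grassmannian {0..1} \<gamma>" "\<gamma> 0 = ?p"
      "velocity grassmannian {0..1} \<gamma> 0 = u" "\<gamma> 1 = q" by blast
    have "\<gamma> 1 = gr_coset (mexp (1 *\<^sub>R ((1/2) *\<^sub>R ?A)) ** Q)"
      by (rule geodesic_unique[OF \<gamma>(1) skew Q anti \<gamma>(2)])
         (use u in \<open>auto simp: \<gamma>(2,3) represents_def YS\<close>)
    then show "q = gr_coset (mexp ((1/2) *\<^sub>R ?A) ** Q)" using \<gamma>(4) by simp
  qed
qed

section \<open>The Hessian of the exponential map\<close>

text \<open>In ambient terms the Hessian at \<open>A\<close> is the tangential part of the second derivative of
  \<open>exp (A + s B + t C)\<close>; translated by \<open>exp (- A)\<close> this is its skew part.\<close>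

lemma norm_tangent_proj_d2mexp_le:
  fixes Q A B C :: "('k::finite, 'l::finite) mat"
  assumes o: "orthogonal_matrix Q"
    and skew: "transpose A = - A" "transpose B = - B" "transpose C = - C"
    and sym: "transpose (d2mexp A B C 1 ** reflect Q) = d2mexp A B C 1 ** reflect Q"
  shows "norm (tangent_proj (mexp A ** reflect Q) (d2mexp A B C 1 ** reflect Q)) \<le> 1 / 3 * norm A * norm B * norm C"
proof -
  let ?S = "reflect Q" and ?E = "mexp A" and ?D = "d2mexp A B C 1" and ?N = "d2mexp_frame A B C 1"
  have D: "?D = ?E ** ?N" by (simp add: d2mexp_def)
  have oE: "orthogonal_matrix ?E" by (rule orthogonal_mexp[OF skew(1)])
  \<comment> \<open>Symmetry of \<open>?D ** ?S\<close> lets conjugation by \<open>?S\<close> act on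
    \<open>?D\<close> as transposition, which turns the tangential part into a skew part.\<close>
  have "?S ** transpose ?D = ?D ** ?S" using sym by (simp add: matrix_transpose_mul transpose_reflect)
  then have "?S ** (?S ** transpose ?D) = ?S ** (?D ** ?S)" by simp
  then have SDS: "?S ** (?D ** ?S) = transpose ?D" by (simp add: matrix_mul_assoc reflect_reflect[OF o])
  have "(?E ** ?S) ** (?D ** ?S) ** (?E ** ?S) = ?E ** (?S ** (?D ** ?S)) ** ?E ** ?S" by (simp add: matrix_mul_assoc)
  also have "\<dots> = ?E ** transpose ?N ** ?S"
    by (simp only: SDS) (simp add: D matrix_transpose_mul orthogonal_cancel oE flip: matrix_mul_assoc)
  finally have "tangent_proj (?E ** ?S) (?D ** ?S) = (1/2) *\<^sub>R (?E ** (?N - transpose ?N) ** ?S)"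
    by (simp add: tangent_proj_def D matmul.diff_left matmul.diff_right)
  then have "norm (tangent_proj (?E ** ?S) (?D ** ?S)) = norm (?N - transpose ?N) / 2"
    by (simp add: norm_orthogonal_mult_left norm_orthogonal_mult_right oE orthogonal_reflect[OF o])
  with norm_skew_part_d2mexp_frame_le[OF skew] show ?thesis by simp
qed

lemma tendsto_mexp_line:
  fixes A B Q :: "real^'n^'n"
  assumes "transpose A = - A" "transpose B = - B"
  shows "((\<lambda>s. mexp (A + s *\<^sub>R B) ** Q) \<longlongrightarrow> mexp A ** Q) (at 0)"
  using has_vector_derivative_continuous[OF has_vector_derivative_mexp_line[OF assms]]
  by (intro matmul.tendsto tendsto_const) (simp add: continuous_at)

theorem mainTheorem5:
  fixes p :: "('k::finite, 'l::finite) mat set"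
    and v w1 w2 :: "('k, 'l) gr_chart \<Rightarrow> real ^ 'l ^ 'k"
    and r :: real
  assumes "CARD('k) * CARD('l) \<ge> 2"
    and "p \<in> Gr"
    and "v \<in> tangent_space grassmannian p"
    and "w1 \<in> tangent_space grassmannian p"
    and "w2 \<in> tangent_space grassmannian p"
    and "tnorm grassmannian p v = 1"
    and "0 < r" and "r < pi"
  shows "tnorm grassmannian (exp_map grassmannian p (\<lambda>c. r *\<^sub>R v c))
           (hessian_exp grassmannian p (\<lambda>c. r *\<^sub>R v c) w1 w2)
         \<le> 8 * r / 3 * tnorm grassmannian p w1 * tnorm grassmannian p w2"
proof -
  obtain Q where Q: "rotation_matrix Q" and p: "p = gr_coset Q" using \<open>p \<in> Gr\<close> by (auto simp: Gr_def)
  have o: "orthogonal_matrix Q" using Q by (simp add: rotation_matrix_def)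
  let ?S = "reflect Q"
  obtain Yv Y1 Y2 where rep: "represents p v Yv" "represents p w1 Y1" "represents p w2 Y2"
    using tangent_space_represents[OF Q] assms(3-5) unfolding p by metis
  have norms: "tnorm grassmannian p u = norm Y / sqrt 8" if "represents p u Y" for u Y
    by (rule tnorm_eq) (use that charts_at_nonempty[OF Q] in \<open>auto simp: represents_def p\<close>)
  define A where "A = r *\<^sub>R (Yv ** ?S)"
  define B where "B = Y1 ** ?S"
  define C where "C = Y2 ** ?S"
  have rep_skew: "transpose (Y ** ?S) = - (Y ** ?S) \<and> ?S ** (Y ** ?S) = - ((Y ** ?S) ** ?S)"
    if "represents p u Y" for u Y
    using represents_tangent[OF that[unfolded p] Q]
    by (simp add: matrix_transpose_mul transpose_reflect matmul.minus_left matrix_mul_assoc)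
  have skew: "transpose A = - A" "transpose B = - B" "transpose C = - C"
    and anti: "?S ** A = - (A ** ?S)" "?S ** B = - (B ** ?S)" "?S ** C = - (C ** ?S)"
    using rep_skew[OF rep(1)] rep_skew[OF rep(2)] rep_skew[OF rep(3)]
    by (simp_all add: A_def B_def C_def transp_simps matmul.scaleR_left matmul.scaleR_right)
  have skew_st: "transpose (A + s *\<^sub>R B + t *\<^sub>R C) = - (A + s *\<^sub>R B + t *\<^sub>R C)"
    and anti_st: "?S ** (A + s *\<^sub>R B + t *\<^sub>R C) = - ((A + s *\<^sub>R B + t *\<^sub>R C) ** ?S)" for s t
    by (simp_all add: transp_simps skew anti matmul.add_left matmul.add_right matmul.scaleR_left matmul.scaleR_right)
  \<comment> \<open>A two-parameter lift: \<open>dexp\<close> differentiates in \<open>t\<close> for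
    each \<open>s\<close>, and the covariant derivative then differentiates in
    \<open>s\<close>.\<close>
  define g where "g s t = mexp ((1/2) *\<^sub>R (A + s *\<^sub>R B + t *\<^sub>R C)) ** Q" for s t
  have rot: "rotation_matrix (g s t)" for s t
    using rotation_mexp_mult[OF skew_st Q] by (simp add: g_def)
  then have orth: "orthogonal_matrix (g s t)" for s t by (simp add: rotation_matrix_def)
  have reflect_g: "reflect (g s t) = mexp (A + s *\<^sub>R B + t *\<^sub>R C) ** ?S" for s t
    unfolding g_def by (rule reflect_lift[OF skew_st o anti_st])
  have exp_st: "exp_map grassmannian p (\<lambda>c. (r *\<^sub>R v c + s *\<^sub>R w1 c) + t *\<^sub>R w2 c) = gr_coset (g s t)" for s t
  proof -
    have "represents p (\<lambda>c. (r *\<^sub>R v c + s *\<^sub>R w1 c) + t *\<^sub>R w2 c) ((r *\<^sub>R Yv + s *\<^sub>R Y1) + t *\<^sub>R Y2)"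
      using represents_lincomb[OF represents_lincomb[OF rep(1,2), of r s] rep(3), of 1 t] by simp
    from exp_map_eq[OF Q this[unfolded p]] show ?thesis
      by (simp add: p g_def A_def B_def C_def matmul.add_left matmul.scaleR_left)
  qed
  define q where "q = gr_coset (g 0 0)"
  define \<gamma> where "\<gamma> s = gr_coset (g s 0)" for s
  have exp_s: "exp_map grassmannian p (\<lambda>c. r *\<^sub>R v c + s *\<^sub>R w1 c) = \<gamma> s" for s
    using exp_st[of s 0] by (simp add: \<gamma>_def)
  have exp_0: "exp_map grassmannian p (\<lambda>c. r *\<^sub>R v c) = q"
    using exp_st[of 0 0] by (simp add: q_def)
  define X where "X s = dexp grassmannian p (\<lambda>c. r *\<^sub>R v c + s *\<^sub>R w1 c) w2" for s
  have X_eq: "X s = velocity grassmannian UNIV (\<lambda>t. gr_coset (g s t)) 0" for s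
    by (simp add: X_def dexp_def exp_st)
  have dmexp_t: "((\<lambda>t. mexp (A + s *\<^sub>R B + t *\<^sub>R C) ** ?S) has_vector_derivative dmexp (A + s *\<^sub>R B) C 1 ** ?S) (at 0)" for s
    using has_vector_derivative_mexp_line[of "A + s *\<^sub>R B" C] skew skew_st[of s 0]
    by (auto intro!: derivative_eq_intros simp: matmul.zero_right)
  define Y where "Y s = dmexp (A + s *\<^sub>R B) C 1 ** ?S" for s
  define Y' where "Y' = d2mexp A B C 1 ** ?S"
  have dY: "(Y has_vector_derivative Y') (at 0)"
    unfolding Y_def[abs_def] Y'_def
    using has_vector_derivative_dmexp_line[OF skew] by (auto intro!: derivative_eq_intros simp: matmul.zero_right)
  \<comment> \<open>Derivatives of symmetric matrices are symmetric; for \<open>Y'\<close> this is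
    what \<open>norm_tangent_proj_d2mexp_le\<close> asks.\<close>
  have Y_sym: "transpose (Y s) = Y s" for s
  proof -
    have "((\<lambda>t. transpose (reflect (g s t))) has_vector_derivative transpose (Y s)) (at 0)"
      unfolding reflect_g Y_def by (intro has_vector_derivative_transpose dmexp_t)
    moreover have "((\<lambda>t. transpose (reflect (g s t))) has_vector_derivative Y s) (at 0)"
      unfolding transpose_reflect unfolding reflect_g Y_def by (rule dmexp_t)
    ultimately show ?thesis by (rule vector_derivative_unique_at)
  qed
  have Y'_sym: "transpose Y' = Y'"
    using has_vector_derivative_transpose[OF dY] dY unfolding Y_sym by (rule vector_derivative_unique_at)
  have half: "transpose ((1/2) *\<^sub>R Z) = - ((1/2) *\<^sub>R Z)" if "transpose Z = - Z" for Z :: "('k, 'l) mat"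
    by (simp add: transp_simps that)
  have skew_s: "transpose (A + s *\<^sub>R B) = - (A + s *\<^sub>R B)" for s using skew_st[of s 0] by simp
  have lim_t: "(g s \<longlongrightarrow> g s 0) (at 0)" for s
    using tendsto_mexp_line[OF half[OF skew_s[of s]] half[OF skew(3)], of Q]
    by (simp add: g_def[abs_def] scaleR_add_right mult.commute)
  have lim_s: "((\<lambda>s. g s 0) \<longlongrightarrow> g 0 0) (at 0)"
    using tendsto_mexp_line[OF half[OF skew(1)] half[OF skew(2)], of Q]
    by (simp add: g_def[abs_def] scaleR_add_right mult.commute)
  have dreflect_s: "((\<lambda>s. reflect (g s 0)) has_vector_derivative dmexp A B 1 ** ?S) (at 0)"
    unfolding reflect_g using has_vector_derivative_mexp_line[OF skew(1,2)]
    by (auto intro!: derivative_eq_intros simp: matmul.zero_right)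
  have X_demb: "demb c (gr_coord c (\<gamma> s)) (X s c) = Y s" if c: "c \<in> gr_charts (\<gamma> s)" for s c
  proof -
    have dr: "((\<lambda>t. reflect (g s t)) has_vector_derivative Y s) (at 0)"
      unfolding reflect_g Y_def by (rule dmexp_t)
    have c': "c \<in> gr_charts (gr_coset (g s 0))" using c by (simp add: \<gamma>_def)
    show ?thesis
      unfolding \<gamma>_def X_eq
      by (rule lift_demb_velocity[where g = "g s" and T = UNIV, OF refl orth lim_t dr UNIV_I _ c']) simp
  qed
  have hess: "demb c (gr_coord c q) (hessian_exp grassmannian p (\<lambda>c. r *\<^sub>R v c) w1 w2 c)
      = tangent_proj (mexp A ** ?S) Y'" if c: "c \<in> gr_charts q" for c
  proof -
    have q: "q = \<gamma> 0" by (simp add: q_def \<gamma>_def)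
    from c obtain cc: "c \<in> gr_atlas" "gr_coord c q \<in> fst c" by (rule charts_atE)
    have c0: "c \<in> gr_charts (\<gamma> 0)" using c q by simp
    note lift = lift_eventually_chart[where g = "\<lambda>s. g s 0" and T = UNIV, OF \<gamma>_def orth lim_s dreflect_s UNIV_I _ c0]
      lift_coord_differentiable[where g = "\<lambda>s. g s 0" and T = UNIV, OF \<gamma>_def orth lim_s dreflect_s UNIV_I _ c0]
    have xdiff: "(\<lambda>s. gr_coord c (\<gamma> s)) differentiable (at 0)" by (rule lift(2)) simp
    have "\<forall>\<^sub>F s in at 0. c \<in> gr_charts (\<gamma> s)" by (rule lift(1)) simp
    then have evX: "\<forall>\<^sub>F s in at 0. demb c (gr_coord c (\<gamma> s)) (X s c) = Y s"
      by (rule eventually_mono) (rule X_demb)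
    have Xdiff: "(\<lambda>s. X s c) differentiable (at 0)"
      by (rule differentiable_of_demb_field[OF cc(1) vector_derivative_works[THEN iffD1, OF xdiff]
            cc(2)[unfolded q] UNIV_I dY evX X_demb[OF c0]])
    have "demb c (gr_coord c (\<gamma> 0)) (cov_deriv grassmannian UNIV \<gamma> X 0 c)
        = tangent_proj (emb c (gr_coord c (\<gamma> 0))) Y'"
      by (rule demb_cov_deriv[where Y = Y and \<gamma> = \<gamma> and X = X, OF c0 UNIV_I _ xdiff Xdiff dY evX X_demb[OF c0]]) simp
    moreover have "emb c (gr_coord c (\<gamma> 0)) = mexp A ** ?S"
      using emb_coord[of c "g 0 0"] c orth reflect_g[of 0 0] by (simp add: q_def \<gamma>_def)
    moreover have "hessian_exp grassmannian p (\<lambda>c. r *\<^sub>R v c) w1 w2 c = cov_deriv grassmannian UNIV \<gamma> X 0 c"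
    proof -
      \<comment> \<open>Constant fields have zero flat derivative, and \<open>dexp\<close> in the
        zero direction is the velocity of a constant curve.\<close>
      have flat: "flat_deriv (\<lambda>_. w1) (\<lambda>_. w2) u = (\<lambda>c. 0)" for u by (simp add: flat_deriv_def)
      have "dexp grassmannian p u (\<lambda>c. 0) c = 0" for u by (simp add: dexp_def velocity_def)
      then show ?thesis
        by (simp add: hessian_exp_def nabla_dexp_def flat exp_s X_def[symmetric])
    qed
    ultimately show ?thesis by (simp add: q)
  qed
  have "tnorm grassmannian q (hessian_exp grassmannian p (\<lambda>c. r *\<^sub>R v c) w1 w2)
      = norm (tangent_proj (mexp A ** ?S) Y') / sqrt 8"
    by (rule tnorm_eq) (use charts_at_nonempty[OF rot] hess in \<open>auto simp: q_def\<close>)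
  also have "\<dots> \<le> (1 / 3 * norm A * norm B * norm C) / sqrt 8"
    unfolding Y'_def
    by (intro divide_right_mono norm_tangent_proj_d2mexp_le o skew Y'_sym[unfolded Y'_def]) simp
  \<comment> \<open>Three factors \<open>sqrt 8\<close>, from \<open>A\<close>, \<open>B\<close> and
    \<open>C\<close>, against the one in the denominator leave \<open>8 * r / 3\<close> times the
    two quotient norms.\<close>
  also have "\<dots> = 8 * r / 3 * tnorm grassmannian p w1 * tnorm grassmannian p w2"
  proof -
    have nS: "norm (Z ** ?S) = norm Z" for Z
      by (rule norm_orthogonal_mult_right[OF orthogonal_reflect[OF o]])
    have "norm Yv = sqrt 8" using norms[OF rep(1)] assms(6) by (simp add: field_simps)
    then have "norm A = r * sqrt 8" using \<open>0 < r\<close> by (simp add: A_def nS)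
    then show ?thesis
      by (simp add: norms[OF rep(2)] norms[OF rep(3)] B_def C_def nS field_simps)
  qed
  finally show ?thesis unfolding exp_0 .
qed

end
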